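(* Let $k$ be a parameter ($k\ge1$) and let $G=(V,E)$ be an undirected weighted graph on $n$ vertices with diameter $\Delta$. Then $G$ admits a compact routing scheme in which the labels have size $O(k\log_n\Delta)$ and the routing tables have size $O(k^2\log_n\Delta)$, and such that for any two vertices $u,v\in V$ the routing path from $u$ to $v$ has length at most $O(kn^{2/k}\log n\cdot d_G(u,v))$.
   Context: Graphs are undirected with non-negative edge weights and shortest-path metric $d_G$; the minimal distance between distinct vertices is $1$. Sizes are measured in words of $O(\log n)$ bits. In a (labeled) compact routing scheme each vertex $u$ is assigned a label and a routing table; given a message carrying the label of a destination $v$, each vertex on the way decides, using only its own routing table and the label of $v$, to which neighbor to forward the message; the routing path from $u$ to $v$ is the path the message takes from $u$ until it reaches $v$.
   Formalization: Sizes O(k log_n Δ) and O(k² log_n Δ) are read as O(max(1, ·)) words, since for a unit-weight complete graph Δ = 1 would force empty labels and tables; each vertex's port numbering of its neighbors is chosen by the scheme. *)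

theory Defs
  imports Complex_Main Graph_Theory.Graph_Theory
begin

text \<open>
  An undirected edge is a pair of opposite arcs of equal weight. Multigraphs need not be considered:
  only a lightest one among parallel edges matters. Non-negativity is stated as such, although
  together with the normalization it forces every edge to weigh at least 1. The normalization also
  yields two distinct vertices, so that logarithms to base \<open>card (pverts G)\<close> make sense.
\<close>

locale connected_weighted_graph = pair_graph G for G :: "'a pair_pre_digraph" +
  fixes w :: "'a \<times> 'a \<Rightarrow> real"
  assumes connected_G: "connected G"
    and weight_nonneg: "e \<in> parcs G \<Longrightarrow> 0 \<le> w e"
    and weight_sym: "(u, v) \<in> parcs G \<Longrightarrow> w (u, v) = w (v, u)"
begin

text \<open>The conversion to a real is harmless: by connectedness and non-negativity \<open>\<mu>\<close> is finite.\<close>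

definition graph_dist :: "'a \<Rightarrow> 'a \<Rightarrow> real" where
  "graph_dist u v = real_of_ereal (\<mu> w u v)"

definition diameter :: real where
  "diameter = Max {graph_dist u v | u v. u \<in> pverts G \<and> v \<in> pverts G}"

end

locale normalized_weighted_graph = connected_weighted_graph +
  assumes dist_ge_1: "\<lbrakk>u \<in> pverts G; v \<in> pverts G; u \<noteq> v\<rbrakk> \<Longrightarrow> 1 \<le> graph_dist u v"
    and dist_eq_1: "\<exists>u\<in>pverts G. \<exists>v\<in>pverts G. u \<noteq> v \<and> graph_dist u v = 1"

definition neighbors :: "'a pair_pre_digraph \<Rightarrow> 'a \<Rightarrow> 'a set" where
  "neighbors G u = {v. (u, v) \<in> parcs G}"

text \<open>
  Labels and routing tables are lists of words, a word being a natural number. A vertex refers to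
  its neighbors through its ports, numbered \<open>0, \<dots>, deg - 1\<close>; the numbering is chosen together with
  the scheme (the designer-port model). With adversarial port numbers or vertex names, already
  unit-weight trees require more than a constant number of words.
\<close>

record 'a routing_scheme =
  label :: "'a \<Rightarrow> nat list"
  table :: "'a \<Rightarrow> nat list"
  port :: "'a \<Rightarrow> 'a \<Rightarrow> nat"

text \<open>Words of \<open>O(log n)\<close> bits: every word is smaller than \<open>n ^ c\<close>.\<close>

definition is_routing_scheme :: "'a pair_pre_digraph \<Rightarrow> nat \<Rightarrow> 'a routing_scheme \<Rightarrow> bool" where
  "is_routing_scheme G c S \<longleftrightarrow>
     (\<forall>u\<in>pverts G.
        bij_betw (port S u) (neighbors G u) {..<card (neighbors G u)} \<and>
        (\<forall>x\<in>set (label S u) \<union> set (table S u). x < card (pverts G) ^ c))"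

text \<open>
  \<open>F table label\<close> is the port on which a vertex with the given routing table forwards a message
  carrying the given label. Such an \<open>F\<close> has to be fixed independently of the graph and of the vertex
  that applies it: a decision rule depending on them could encode the routes by itself, leaving
  nothing to be stored in the tables. No rule applies if \<open>F\<close> returns a number that is not a port;
  the message is then lost.
\<close>

inductive routing_path ::
    "'a pair_pre_digraph \<Rightarrow> (nat list \<Rightarrow> nat list \<Rightarrow> nat) \<Rightarrow> 'a routing_scheme \<Rightarrow>
     'a \<Rightarrow> 'a \<Rightarrow> ('a \<times> 'a) list \<Rightarrow> bool"
  for G :: "'a pair_pre_digraph" and F :: "nat list \<Rightarrow> nat list \<Rightarrow> nat"
    and S :: "'a routing_scheme"
  where
    arrived: "routing_path G F S v v []"
  | forward: "\<lbrakk>u \<noteq> v; x \<in> neighbors G u; port S u x = F (table S u) (label S v);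
               routing_path G F S x v p\<rbrakk> \<Longrightarrow> routing_path G F S u v ((u, x) # p)"

end

theory Submission
  imports Defs
begin

text \<open>
  Put \<open>b = n powr (1 / k)\<close>, where without loss of generality \<open>b \<ge> 2\<close>. For each scale \<open>r = b ^ (i + 1)\<close>
  below the diameter, region growing yields, in each of about \<open>k\<close> rounds, disjoint clusters of
  radius \<open>O(b log n) * r\<close> such that for every vertex some round has a cluster containing the whole
  ball of radius \<open>r\<close> around it. A message to \<open>v\<close> is forwarded in the tree of the cluster of \<open>v\<close>
  at the lowest scale whose cluster contains the current vertex. The label of \<open>v\<close> describes \<open>v\<close> in
  one tree per scale, the table of a vertex describes it in the trees through it.

  The difficulty is that a description has only \<open>O(1)\<close> words, although the ports of a vertex are
  shared by all trees through it. If these are \<open>t\<close> trees, the ports can be numbered so that the child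
  of rank \<open>i\<close> by subtree size in any tree has port less than \<open>t * (i + 1)\<close>. As long as \<open>t\<close> is
  polylogarithmic in \<open>n\<close>, the ports of the about \<open>sqrt (log n)\<close> largest children can be packed into one
  word of the table, while any other child has rank at least \<open>sqrt (log n)\<close>, so that its port is
  polynomial in the ratio of the subtree sizes and can be charged to the decrease of the subtree size.

  To make \<open>t\<close> polylogarithmic for arbitrarily large diameter, edges shorter than \<open>r / n^2\<close> count as zero
  at scale \<open>r\<close>, so that clusters are unions of components with respect to short edges. If a cluster
  contains a giant component, with more than half of the vertices of its component
  \<open>O(k)\<close> scales higher up, then inside the giant component (the core) one routes in a single
  minimum spanning tree, which serves all scales, and trees are only used outside the core. A vertex is
  outside a core only at those scales at which its component doubles within the next \<open>O(k)\<close> scales,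
  which happens at \<open>O(k log n)\<close> scales.
\<close>

section \<open>Port numbers and packed words\<close>

text \<open>The charge is made by giving a subtree an interval of length \<open>size ^ e\<close>
  instead of \<open>size\<close>. A child of rank \<open>i\<close> has at most the fraction
  \<open>1 / (i + 1)\<close> of its parent's subtree, so superlinear lengths leave slack polynomial
  in \<open>i\<close>, enough for the port of a light child to be read off the position itself. The
  factor \<open>t\<close> in the ports must then be absorbed by a power of the rank:
  \<open>t <= H ^ a\<close> for ranks from \<open>H\<close> on. At the same time \<open>H\<close>
  ports below \<open>t * H\<close> must fit into one word, so \<open>H ^ H\<close> must be
  polynomial in \<open>n\<close>. An \<open>H\<close> near \<open>sqrt (log n)\<close> meets both
  demands without iterated logarithms.

  Cores are looked for \<open>O(k)\<close> scales higher up because \<open>8 * k\<close> scales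
  change lengths by the factor \<open>n ^ 8\<close>, more than the ratio of a cluster radius to the
  short edges of its scale. A cluster thus lies in one component that far up, which has room for
  only one component with more than half of its vertices: a cluster never has two giants.\<close>

lemma sorted_enumeration:
  fixes key :: "'a \<Rightarrow> 'b::linorder"
  assumes "finite X"
  shows "\<exists>f. bij_betw f X {..<card X} \<and> (\<forall>x\<in>X. \<forall>y\<in>X. f x < f y \<longrightarrow> key x \<le> key y)"
  using assms
proof (induction "card X" arbitrary: X)
  case 0
  then show ?case by (auto simp: bij_betw_def)
next
  case (Suc m)
  have ne: "X \<noteq> {}" using Suc.hyps by auto
  obtain z where z: "z \<in> X" "\<forall>x\<in>X. key x \<le> key z"
  proof -
    have "Max (key ` X) \<in> key ` X" using Suc.prems ne by (intro Max_in) auto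
    moreover have "\<forall>x\<in>X. key x \<le> Max (key ` X)" using Suc.prems by auto
    ultimately show ?thesis using that by (metis imageE)
  qed
  have card: "m = card (X - {z})" using Suc z by simp
  obtain f where f: "bij_betw f (X - {z}) {..<m}"
    "\<forall>x\<in>X - {z}. \<forall>y\<in>X - {z}. f x < f y \<longrightarrow> key x \<le> key y"
    using Suc.hyps(1)[OF card] card Suc.prems by auto
  have "bij_betw (f(z := m)) (X - {z}) {..<m}"
    using f(1) by (subst bij_betw_cong[of _ _ f]) auto
  then have "bij_betw (f(z := m)) ((X - {z}) \<union> {z}) ({..<m} \<union> {(f(z := m)) z})"
    by (intro notIn_Un_bij_betw) auto
  moreover have "(X - {z}) \<union> {z} = X" "{..<m} \<union> {(f(z := m)) z} = {..<card X}"
    using z Suc.hyps(2) by auto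
  moreover have "\<forall>x\<in>X. \<forall>y\<in>X. (f(z := m)) x < (f(z := m)) y \<longrightarrow> key x \<le> key y"
  proof (intro ballI impI)
    fix x y assume xy: "x \<in> X" "y \<in> X" "(f(z := m)) x < (f(z := m)) y"
    show "key x \<le> key y"
    proof (cases "y = z")
      case True
      then show ?thesis using z xy by auto
    next
      case False
      have "f y < m" using f(1) xy False by (auto simp: bij_betw_def)
      then have "x \<noteq> z" using xy False by auto
      then show ?thesis using f(2) xy False by auto
    qed
  qed
  ultimately show ?case by metis
qed

lemma bij_betw_card_below:
  assumes "bij_betw f X {..<card X}" "x \<in> X"
  shows "card {y \<in> X. f y \<le> f x} = Suc (f x)"
proof -
  have "f ` {y \<in> X. f y \<le> f x} = {..f x}"
    proof (intro subset_antisym subsetI)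
    fix j assume "j \<in> {..f x}"
    moreover have "f x < card X" using assms by (auto simp: bij_betw_def)
    ultimately have "j \<in> f ` X" using assms(1) by (simp add: bij_betw_def)
    then show "j \<in> f ` {y \<in> X. f y \<le> f x}" using \<open>j \<in> {..f x}\<close> by auto
  qed auto
  moreover have "inj_on f {y \<in> X. f y \<le> f x}"
    using assms by (auto simp: bij_betw_def inj_on_def)
  ultimately show ?thesis by (metis card_atMost card_image)
qed

text \<open>Numbering the neighbors by their best rank over all trees works: whoever is numbered no
  later than \<open>x\<close> has rank at most \<open>rk s x\<close> in some tree, and by
  injectivity each of the at most \<open>t\<close> trees contributes at most
  \<open>rk s x + 1\<close> such neighbors.\<close>

lemma common_port_numbering:
  fixes rk :: "'i \<Rightarrow> 'a \<Rightarrow> nat"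
  assumes "finite N" "finite I" "card I \<le> t"
    and sub: "\<And>s. s \<in> I \<Longrightarrow> X s \<subseteq> N" and inj: "\<And>s. s \<in> I \<Longrightarrow> inj_on (rk s) (X s)"
  shows "\<exists>f. bij_betw f N {..<card N} \<and> (\<forall>s\<in>I. \<forall>x\<in>X s. f x < t * (rk s x + 1))"
proof -
  \<comment> \<open>In \<open>enat\<close>, a neighbor that is a child in no tree gets the key
    infinity and is numbered last.\<close>
  define key where "key x = (INF s\<in>{s \<in> I. x \<in> X s}. enat (rk s x))" for x
  obtain f where f: "bij_betw f N {..<card N}"
    "\<forall>x\<in>N. \<forall>y\<in>N. f x < f y \<longrightarrow> key x \<le> key y"
    using sorted_enumeration[OF \<open>finite N\<close>, of key] by auto
  have "f x < t * (rk s x + 1)" if s: "s \<in> I" "x \<in> X s" for s x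
  proof -
    have key_le: "key x \<le> enat (rk s x)"
      unfolding key_def by (rule INF_lower) (use s in auto)
    have "{y \<in> N. f y \<le> f x} \<subseteq> (\<Union>s'\<in>I. {y \<in> X s'. rk s' y \<le> rk s x})"
    proof
      fix y assume y: "y \<in> {y \<in> N. f y \<le> f x}"
      have "key y \<le> key x"
      proof (cases "f y = f x")
        case True
        then have "y = x" using f(1) y s sub by (auto simp: bij_betw_def inj_on_def)
        then show ?thesis by simp
      next
        case False
        then show ?thesis using f(2) y s sub[OF s(1)] by auto
      qed
      then have le: "key y \<le> enat (rk s x)" using key_le by simp
      define Z where "Z = (\<lambda>s. enat (rk s y)) ` {s \<in> I. y \<in> X s}"
      have "Z \<noteq> {}"
      proof
        assume "Z = {}"
        then have "{s \<in> I. y \<in> X s} = {}" by (simp add: Z_def)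
        then have "key y = \<infinity>" by (simp only: key_def image_empty Inf_empty top_enat_def)
        then show False using le by simp
      qed
      then have "Inf Z \<in> Z" by (auto simp: Inf_enat_def intro: LeastI)
      moreover have "key y = Inf Z" by (simp add: key_def Z_def)
      ultimately show "y \<in> (\<Union>s'\<in>I. {y \<in> X s'. rk s' y \<le> rk s x})"
        using le by (auto simp: Z_def)
    qed
    then have "card {y \<in> N. f y \<le> f x} \<le> card (\<Union>s'\<in>I. {y \<in> X s'. rk s' y \<le> rk s x})"
      using \<open>finite I\<close> \<open>finite N\<close> sub by (intro card_mono) (auto intro: finite_subset)
    also have "\<dots> \<le> (\<Sum>s'\<in>I. card {y \<in> X s'. rk s' y \<le> rk s x})"
      by (rule card_UN_le) fact
    also have "\<dots> \<le> (\<Sum>s'\<in>I. rk s x + 1)"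
    proof (rule sum_mono)
      fix s' assume "s' \<in> I"
      then have "inj_on (rk s') {y \<in> X s'. rk s' y \<le> rk s x}"
        using inj by (auto simp: inj_on_def)
      then have "card {y \<in> X s'. rk s' y \<le> rk s x} \<le> card {..rk s x}"
        by (intro card_inj_on_le[of "rk s'"]) auto
      then show "card {y \<in> X s'. rk s' y \<le> rk s x} \<le> rk s x + 1" by simp
    qed
    also have "\<dots> = card I * (rk s x + 1)" by simp
    also have "\<dots> \<le> t * (rk s x + 1)" using assms(3) by (intro mult_right_mono) auto
    finally show ?thesis using bij_betw_card_below[OF f(1), of x] s sub[OF s(1)] by auto
  qed
  then show ?thesis using f by blast
qed

lemma pack_digits:
  fixes B :: nat
  assumes "\<And>j. j < H \<Longrightarrow> d j < B"
  shows "\<exists>W < B ^ H. \<forall>j<H. (W div B ^ j) mod B = d j"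
  using assms
proof (induction H)
  case 0
  then show ?case by auto
next
  case (Suc H)
  then obtain W where W: "W < B ^ H" "\<forall>j<H. (W div B ^ j) mod B = d j" by auto
  have dB: "d H < B" using Suc.prems by auto
  have "W + d H * B ^ H < B ^ H + d H * B ^ H" using W by simp
  also have "\<dots> = (Suc (d H)) * B ^ H" by simp
  also have "\<dots> \<le> B * B ^ H" using dB by (intro mult_right_mono) auto
  finally have lt: "W + d H * B ^ H < B ^ Suc H" by simp
  have "((W + d H * B ^ H) div B ^ j) mod B = d j" if "j < Suc H" for j
  proof (cases "j = H")
    case True
    then show ?thesis using W dB by auto
  next
    case False
    then have j: "j < H" using that by simp
    have "B ^ H = B ^ (H - Suc j) * B * B ^ j"
      using j by (metis Suc_diff_Suc add_diff_inverse_nat less_imp_not_less mult.commute power_Suc power_add)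
    then have eq: "d H * B ^ H = (d H * B ^ (H - Suc j) * B) * B ^ j"
      by (simp only: mult.assoc)
    have "(W + d H * B ^ H) div B ^ j = d H * B ^ (H - Suc j) * B + W div B ^ j"
      unfolding eq using dB by (subst div_mult_self1) auto
    then show ?thesis using W j by simp
  qed
  with lt show ?case by blast
qed

text \<open>
  An interval of length \<open>L\<close> has room for a slot of length about \<open>L / (j + 2)\<^sup>2\<close> for every \<open>j\<close>, so the
  number of a slot can be computed from \<open>L\<close> and any position in it.
\<close>

definition slot_start :: "nat \<Rightarrow> nat \<Rightarrow> nat" where
  "slot_start L m = (\<Sum>j<m. L div (j + 2)\<^sup>2)"

lemma slot_start_mono: "m \<le> m' \<Longrightarrow> slot_start L m \<le> slot_start L m'"
  unfolding slot_start_def by (rule sum_mono2) auto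

lemma slot_start_Suc: "slot_start L (Suc m) = slot_start L m + L div (m + 2)\<^sup>2"
  by (simp add: slot_start_def)

lemma slot_start_le: "slot_start L m \<le> L"
proof -
  \<comment> \<open>Telescoping: \<open>1 / (m + 2)^2\<close> is at most
    \<open>1 / (m + 1) - 1 / (m + 2)\<close>.\<close>
  have "real (slot_start L m) \<le> real L * (1 - 1 / (real m + 1))"
  proof (induction m)
    case 0
    then show ?case by (simp add: slot_start_def)
  next
    case (Suc m)
    have "real (L div (m + 2)\<^sup>2) \<le> real L / (real m + 2)\<^sup>2"
      using of_nat_div_le_of_nat[of L "(m+2)\<^sup>2", where 'a = real] by (simp add: add.commute)
    also have "\<dots> \<le> real L * (1 / ((real m + 1) * (real m + 2)))"
      unfolding divide_inverse[of "real L"]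
      by (intro mult_left_mono) (auto simp: inverse_eq_divide power2_eq_square intro!: divide_left_mono mult_right_mono)
    also have "1 / ((real m + 1) * (real m + 2)) = 1 / (real m + 1) - 1 / (real m + 2)"
      by (simp add: field_simps)
    finally have "real (L div (m + 2)\<^sup>2) \<le> real L * (1 / (real m + 1) - 1 / (real m + 2))" .
    with Suc show ?case
      unfolding slot_start_Suc by (simp add: algebra_simps)
  qed
  also have "\<dots> \<le> real L" by (simp add: mult_left_le)
  finally show ?thesis by simp
qed

section \<open>Rooted forests\<close>

definition ancs :: "('a \<Rightarrow> 'a) \<Rightarrow> 'a \<Rightarrow> 'a set" where
  "ancs f v = range (\<lambda>j. (f ^^ j) v)"

definition desc :: "'a set \<Rightarrow> ('a \<Rightarrow> 'a) \<Rightarrow> 'a \<Rightarrow> 'a set" where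
  "desc A f u = {v \<in> A. u \<in> ancs f v}"

definition children :: "'a set \<Rightarrow> ('a \<Rightarrow> 'a) \<Rightarrow> 'a \<Rightarrow> 'a set" where
  "children A f u = {c \<in> A. f c = u \<and> c \<noteq> u}"

definition top_of :: "('a \<Rightarrow> 'a) \<Rightarrow> 'a \<Rightarrow> 'a" where
  "top_of f v = (THE x. x \<in> ancs f v \<and> f x = x)"

definition next_hop :: "'a set \<Rightarrow> ('a \<Rightarrow> 'a) \<Rightarrow> 'a \<Rightarrow> 'a \<Rightarrow> 'a" where
  "next_hop A f u v = (if v \<in> desc A f u then THE c. c \<in> children A f u \<and> v \<in> desc A f c else f u)"

lemma ancs_self [simp]: "v \<in> ancs f v"
  unfolding ancs_def by (rule range_eqI[of _ _ 0]) simp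

lemma ancs_step: "ancs f v = insert v (ancs f (f v))"
proof -
  have "ancs f v = insert ((f ^^ 0) v) ((\<lambda>j. (f ^^ Suc j) v) ` UNIV)"
    unfolding ancs_def by (subst UNIV_nat_eq) (simp add: image_image)
  then show ?thesis unfolding ancs_def by (simp add: funpow_swap1)
qed

lemma ancs_parent: "x \<in> ancs f (f v) \<Longrightarrow> x \<in> ancs f v"
  by (subst ancs_step) simp

lemma ancs_trans: "x \<in> ancs f y \<Longrightarrow> y \<in> ancs f z \<Longrightarrow> x \<in> ancs f z"
  unfolding ancs_def by (auto simp: funpow_add[symmetric, unfolded comp_def fun_eq_iff, rule_format])

lemma ancs_root: "f v = v \<Longrightarrow> ancs f v = {v}"
proof -
  assume "f v = v"
  then have "(f ^^ j) v = v" for j by (induction j) auto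
  then show ?thesis by (auto simp: ancs_def)
qed

lemma ancs_parent_of: "x \<in> ancs f v \<Longrightarrow> f x \<in> ancs f v"
  unfolding ancs_def by (auto intro: range_eqI[of _ _ "Suc _"])

text \<open>Roots are the fixed points of \<open>f\<close>. The map \<open>dep\<close> is merely a
  termination measure and need not count edges: it will be the order of insertion in Prim's
  algorithm, or a rounded distance.\<close>

locale forest =
  fixes A :: "'a set" and f :: "'a \<Rightarrow> 'a" and dep :: "'a \<Rightarrow> nat"
  assumes finite_A: "finite A"
    and parent_in: "u \<in> A \<Longrightarrow> f u \<in> A"
    and dep_parent: "u \<in> A \<Longrightarrow> f u \<noteq> u \<Longrightarrow> dep (f u) < dep u"
begin

abbreviation "ch \<equiv> children A f"
abbreviation "de \<equiv> desc A f"
abbreviation "an \<equiv> ancs f"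
abbreviation "rt \<equiv> top_of f"

lemma forest_induct [consumes 1, case_names root child]:
  assumes "v \<in> A" "\<And>v. v \<in> A \<Longrightarrow> f v = v \<Longrightarrow> P v"
    "\<And>v. v \<in> A \<Longrightarrow> f v \<noteq> v \<Longrightarrow> P (f v) \<Longrightarrow> P v"
  shows "P v"
  using assms(1)
proof (induction "dep v" arbitrary: v rule: less_induct)
  case less
  then show ?case using assms(2,3)[of v] dep_parent parent_in by (cases "f v = v") auto
qed

lemma an_subset: "v \<in> A \<Longrightarrow> an v \<subseteq> A"
proof -
  assume "v \<in> A"
  then have "(f ^^ j) v \<in> A" for j by (induction j) (auto intro: parent_in)
  then show ?thesis by (auto simp: ancs_def)
qed

lemma finite_an: "v \<in> A \<Longrightarrow> finite (an v)"
  using an_subset finite_A finite_subset by blast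

lemma dep_an: "v \<in> A \<Longrightarrow> x \<in> an v \<Longrightarrow> x = v \<or> dep x < dep v"
proof (induction rule: forest_induct)
  case (root v)
  then show ?case by (simp add: ancs_root)
next
  case (child v)
  then have "x = v \<or> x \<in> an (f v)" using ancs_step[of f v] by auto
  then show ?case using child dep_parent[of v] by auto
qed

lemma an_antisym: "v \<in> A \<Longrightarrow> x \<in> an v \<Longrightarrow> v \<in> an x \<Longrightarrow> x = v"
  using dep_an[of v x] dep_an[of x v] an_subset[of v] by auto

lemma not_in_an_parent: "v \<in> A \<Longrightarrow> f v \<noteq> v \<Longrightarrow> v \<notin> an (f v)"
  using dep_an[of "f v" v] dep_parent[of v] parent_in[of v] by auto

lemma root_ex1: "v \<in> A \<Longrightarrow> \<exists>!x. x \<in> an v \<and> f x = x"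
proof (induction rule: forest_induct)
  case (root v)
  then show ?case by (intro ex1I[of _ v]) (simp_all add: ancs_root)
next
  case (child v)
  then show ?case using ancs_step[of f v] by auto
qed

lemma rt: "v \<in> A \<Longrightarrow> rt v \<in> an v" "v \<in> A \<Longrightarrow> f (rt v) = rt v"
  using theI'[OF root_ex1] by (auto simp: top_of_def)

lemma rt_eqI: "v \<in> A \<Longrightarrow> x \<in> an v \<Longrightarrow> f x = x \<Longrightarrow> rt v = x"
  using root_ex1 rt by blast

lemma rt_in: "v \<in> A \<Longrightarrow> rt v \<in> A"
  using rt an_subset by blast

lemma rt_an: "v \<in> A \<Longrightarrow> x \<in> an v \<Longrightarrow> rt x = rt v"
  using rt[of x] an_subset[of v] by (intro rt_eqI[symmetric]) (auto intro: ancs_trans)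

lemma rt_parent: "v \<in> A \<Longrightarrow> rt (f v) = rt v"
  by (intro rt_an) (auto intro: ancs_parent_of)

lemma rt_root: "v \<in> A \<Longrightarrow> f v = v \<Longrightarrow> rt v = v"
  by (intro rt_eqI) auto

lemma de_rt: "u \<in> A \<Longrightarrow> v \<in> de u \<Longrightarrow> rt v = rt u"
  by (auto simp: desc_def dest: rt_an)

lemma de_root: "v \<in> A \<Longrightarrow> v \<in> de (rt v)"
  using rt by (auto simp: desc_def)

lemma de_subset: "de u \<subseteq> A" by (auto simp: desc_def)

lemma finite_de: "finite (de u)" using finite_A de_subset finite_subset by blast

lemma de_self: "u \<in> A \<Longrightarrow> u \<in> de u" by (auto simp: desc_def)

lemma ch_subset: "ch u \<subseteq> A" by (auto simp: children_def)

lemma finite_ch: "finite (ch u)" using finite_A ch_subset finite_subset by blast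

lemma ch_parent: "c \<in> ch u \<Longrightarrow> f c = u \<and> c \<noteq> u \<and> c \<in> A \<and> u \<in> A"
  using parent_in by (auto simp: children_def)

lemma child_ex: "v \<in> de u \<Longrightarrow> v \<noteq> u \<Longrightarrow> \<exists>c\<in>ch u. v \<in> de c"
proof -
  assume "v \<in> de u" "v \<noteq> u"
  then have "v \<in> A" "u \<in> an v" "v \<noteq> u" by (auto simp: desc_def)
  then show ?thesis
  proof (induction rule: forest_induct)
    case (root v)
    then show ?case by (simp add: ancs_root)
  next
    case (child v)
    then have u: "u \<in> an (f v)" using ancs_step[of f v] by auto
    show ?case
    proof (cases "f v = u")
      case True
      then have "v \<in> ch u" using child by (auto simp: children_def)
      then show ?thesis using child de_self by blast
    next
      case False
      then obtain c where "c \<in> ch u" "f v \<in> de c" using child u by auto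
      then show ?thesis using child.hyps by (intro bexI[of _ c]) (auto simp: desc_def intro: ancs_parent)
    qed
  qed
qed

lemma de_trans: "u \<in> A \<Longrightarrow> c \<in> de u \<Longrightarrow> v \<in> de c \<Longrightarrow> v \<in> de u"
  using ancs_trans by (fastforce simp: desc_def)

lemma ch_de: "c \<in> ch u \<Longrightarrow> c \<in> de u"
  by (auto simp: children_def desc_def intro: ancs_parent_of ancs_self)

lemma an_linear: "v \<in> A \<Longrightarrow> x \<in> an v \<Longrightarrow> y \<in> an v \<Longrightarrow> x \<in> an y \<or> y \<in> an x"
proof (induction rule: forest_induct)
  case (root v)
  then show ?case by (simp add: ancs_root)
next
  case (child v)
  then show ?case using ancs_step[of f v] by auto
qed

lemma siblings_disjoint:
  assumes "c \<in> ch u" "c' \<in> ch u" "c \<noteq> c'"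
  shows "de c \<inter> de c' = {}"
proof (rule ccontr)
  assume "de c \<inter> de c' \<noteq> {}"
  then obtain v where "v \<in> A" "c \<in> an v" "c' \<in> an v" by (auto simp: desc_def)
  then have "c \<in> an c' \<or> c' \<in> an c" by (rule an_linear)
  then show False
  proof
    assume "c \<in> an c'"
    then have "c \<in> an u" using assms ancs_step[of f c'] by (auto simp: children_def)
    then show False using assms not_in_an_parent[of c] by (auto simp: children_def)
  next
    assume "c' \<in> an c"
    then have "c' \<in> an u" using assms ancs_step[of f c] by (auto simp: children_def)
    then show False using assms not_in_an_parent[of c'] by (auto simp: children_def)
  qed
qed

lemma parent_notin_de_child: "c \<in> ch u \<Longrightarrow> u \<notin> de c"
  using not_in_an_parent[of c] by (auto simp: children_def desc_def)

lemma next_hop_child: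
  assumes "v \<in> de u" "v \<noteq> u"
  shows "next_hop A f u v \<in> ch u" "v \<in> de (next_hop A f u v)"
proof -
  have "\<exists>!c. c \<in> ch u \<and> v \<in> de c"
    using child_ex[OF assms] siblings_disjoint by blast
  from theI'[OF this] show "next_hop A f u v \<in> ch u" "v \<in> de (next_hop A f u v)"
    using assms by (auto simp: next_hop_def)
qed

lemma next_hop_parent: "v \<notin> de u \<Longrightarrow> next_hop A f u v = f u"
  by (simp add: next_hop_def)

lemma not_desc_not_root: "u \<in> A \<Longrightarrow> v \<in> A \<Longrightarrow> rt u = rt v \<Longrightarrow> v \<notin> de u \<Longrightarrow> f u \<noteq> u"
  using rt_root de_root by metis

text \<open>
  Off the path to \<open>v\<close> this charges the detour through the root rather than the tree distance, which
  suffices and avoids lowest common ancestors.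
\<close>

definition pot :: "('a \<Rightarrow> real) \<Rightarrow> 'a \<Rightarrow> 'a \<Rightarrow> real" where
  "pot D u v = (if v \<in> de u then D v - D u else D u + D v)"

lemma pot_child:
  assumes "v \<in> de u" "v \<noteq> u" "D u + l \<le> D (next_hop A f u v)"
  shows "l + pot D (next_hop A f u v) v \<le> pot D u v"
  using next_hop_child[OF assms(1,2)] assms by (simp add: pot_def)

lemma pot_parent:
  assumes "v \<notin> de u" "D (f u) + l \<le> D u" "0 \<le> D (f u)" 
  shows "l + pot D (f u) v \<le> pot D u v"
  using assms by (simp add: pot_def)

end


section \<open>Subtree sizes and ranks of children\<close>

context forest
begin

abbreviation "sz u \<equiv> card (de u)"

lemma sz_pos: "u \<in> A \<Longrightarrow> 0 < sz u"
  using de_self finite_de by (auto simp: card_gt_0_iff)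

lemma sum_sz_children:
  assumes "u \<in> A" "X \<subseteq> ch u"
  shows "(\<Sum>c\<in>X. sz c) + 1 \<le> sz u"
proof -
  have fin: "finite X" using assms finite_ch finite_subset by blast
  have "(\<Sum>c\<in>X. sz c) = card (\<Union>c\<in>X. de c)"
  proof (intro card_UN_disjoint[symmetric] ballI impI fin)
    fix c c' assume "c \<in> X" "c' \<in> X" "c \<noteq> c'"
    then show "de c \<inter> de c' = {}" using siblings_disjoint assms(2) by blast
  qed (rule finite_de)
  moreover have "u \<notin> (\<Union>c\<in>X. de c)" using parent_notin_de_child assms(2) by auto
  moreover have "finite (\<Union>c\<in>X. de c)" using fin finite_de by auto
  ultimately have "(\<Sum>c\<in>X. sz c) + 1 = card (insert u (\<Union>c\<in>X. de c))" by simp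
  also have "\<dots> \<le> sz u"
  proof (rule card_mono[OF finite_de], rule insert_subsetI)
    show "u \<in> de u" using de_self assms by simp
    show "(\<Union>c\<in>X. de c) \<subseteq> de u"
      using de_trans[OF assms(1)] ch_de assms(2) by blast
  qed
  finally show ?thesis .
qed

text \<open>Children are sorted by decreasing subtree size: the \<open>rk c + 1\<close> children up
  to \<open>c\<close> have disjoint subtrees, each at least as large as that of \<open>c\<close>.
  Since a vertex has only one parent, the rankings at all vertices glue to a single
  function.\<close>

lemma rank_exists:
  "\<exists>rk :: 'a \<Rightarrow> nat. \<forall>u. inj_on rk (ch u) \<and> (\<forall>c\<in>ch u. (rk c + 1) * sz c \<le> sz u) \<and>
     (\<forall>c\<in>ch u. \<exists>c0\<in>ch u. rk c0 = 0)"
proof -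
  have "\<exists>g. bij_betw g (ch u) {..<card (ch u)} \<and>
      (\<forall>x\<in>ch u. \<forall>y\<in>ch u. g x < g y \<longrightarrow> - int (sz x) \<le> - int (sz y))" for u
    by (rule sorted_enumeration[OF finite_ch])
  then obtain g where g': "\<And>u. bij_betw (g u) (ch u) {..<card (ch u)} \<and>
      (\<forall>x\<in>ch u. \<forall>y\<in>ch u. g u x < g u y \<longrightarrow> - int (sz x) \<le> - int (sz y))"
    by metis
  have g: "\<And>u. bij_betw (g u) (ch u) {..<card (ch u)}"
    "\<And>u x y. x \<in> ch u \<Longrightarrow> y \<in> ch u \<Longrightarrow> g u x < g u y \<Longrightarrow> sz y \<le> sz x"
    using g' by auto
  define rk where "rk c = g (f c) c" for c
  have rk: "rk c = g u c" if "c \<in> ch u" for c u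
    using that by (auto simp: rk_def children_def)
  have "inj_on rk (ch u)" for u
    using g(1)[of u] rk by (subst inj_on_cong[of _ _ "g u"]) (auto simp: bij_betw_def)
  moreover have "(rk c + 1) * sz c \<le> sz u" if c: "c \<in> ch u" for c u
  proof -
    define X where "X = {y \<in> ch u. g u y \<le> g u c}"
    have "card X = rk c + 1"
      using bij_betw_card_below[OF g(1) c] c rk by (simp add: X_def)
    moreover have "card X * sz c \<le> (\<Sum>y\<in>X. sz y)"
    proof (subst of_nat_id[symmetric], rule sum_bounded_below)
      fix y assume "y \<in> X"
      then have y: "y \<in> ch u" "g u y \<le> g u c" by (auto simp: X_def)
      show "sz c \<le> sz y"
      proof (cases "g u y = g u c")
        case True
        then have "y = c" using g(1)[of u] y c by (auto simp: bij_betw_def inj_on_def)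
        then show ?thesis by simp
      next
        case False
        then show ?thesis using g(2)[of y u c] y c by simp
      qed
    qed
    ultimately have "(rk c + 1) * sz c \<le> (\<Sum>y\<in>X. sz y)" by simp
    also have "\<dots> \<le> sz u"
      using sum_sz_children[of u X] ch_parent[OF c] by (auto simp: X_def)
    finally show ?thesis .
  qed
  moreover have "\<exists>c0\<in>ch u. rk c0 = 0" if c: "c \<in> ch u" for c u
  proof -
    have "0 \<in> {..<card (ch u)}" using c finite_ch card_gt_0_iff by fastforce
    then obtain c0 where "c0 \<in> ch u" "g u c0 = 0"
      using g(1)[of u] unfolding bij_betw_def by (metis imageE)
    then show ?thesis using rk by metis
  qed
  ultimately show ?thesis by blast
qed

end

text \<open>
  The arguments of \<open>tree_port\<close> are, besides the base \<open>B\<close> of the packed ports, the data stored at a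
  vertex \<open>u\<close> (the name \<open>r\<close> of its root, the interval \<open>{l..<l + s}\<close> of its subtree, the interval
  length \<open>h\<close> and the port \<open>hp\<close> of its largest child, the packed ports \<open>pk\<close> of the next largest
  children, and the port \<open>pp\<close> of its parent) and those of the destination (the name \<open>r'\<close> of its
  root and its position \<open>x\<close>).
\<close>

definition tree_port ::
  "nat \<Rightarrow> nat \<Rightarrow> nat \<Rightarrow> nat \<Rightarrow> nat \<Rightarrow> nat \<Rightarrow> nat \<Rightarrow> nat \<Rightarrow> nat \<Rightarrow> nat \<Rightarrow> nat" where
  "tree_port B r l s h hp pk pp r' x =
    (if r = r' \<and> l \<le> x \<and> x < l + s then
       if x - l - 1 < h then hp
       else let m = (LEAST m. x - l - 1 - h < slot_start (s - h - 1) (Suc m))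
            in if even m then (pk div B ^ (m div 2)) mod B else m div 2
     else pp)"

locale coded_forest = forest +
  fixes rk :: "'a \<Rightarrow> nat" and p :: "'a \<Rightarrow> 'a \<Rightarrow> nat" and H a t B :: nat
  assumes rk_inj: "inj_on rk (children A f u)"
    and rk_sz: "c \<in> children A f u \<Longrightarrow> (rk c + 1) * card (desc A f c) \<le> card (desc A f u)"
    and rk_zero: "c \<in> children A f u \<Longrightarrow> \<exists>c0\<in>children A f u. rk c0 = 0"
    and port_less: "c \<in> children A f u \<Longrightarrow> p u c < t * (rk c + 1)"
    and port_inj: "inj_on (p u) (children A f u)"
    and H2: "2 \<le> H" and t_le: "t \<le> H ^ a" and B_ge: "t * H \<le> B" and B_pos: "0 < B"
begin

text \<open>Chosen so that \<open>e - 1 = 2 * (a + 3)\<close>: a slot number is bounded by the power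
  \<open>a + 3\<close> of the rank plus one, and the length of a slot is divided by the square of
  its number.\<close>

definition e :: nat where "e = 2 * a + 7"

text \<open>
  Intervals have length \<open>sz ^ e\<close>. That of the child of rank \<open>0\<close> comes first, those of the other
  children lie in the slots numbered by \<open>symb\<close>: even numbers encode ranks below \<open>H\<close>, odd ones ports.
\<close>

definition symb :: "'a \<Rightarrow> nat" where
  "symb c = (if rk c < H then 2 * rk c else 2 * p (f c) c + 1)"

definition heavy_len :: "'a \<Rightarrow> nat" where
  "heavy_len u = (\<Sum>c\<in>{c \<in> ch u. rk c = 0}. sz c ^ e)"

text \<open>The \<open>1\<close> reserves the first position in the interval of a vertex for the
  vertex itself.\<close>

definition off :: "'a \<Rightarrow> nat" where
  "off c = (if f c = c then 0 else if rk c = 0 then 1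
     else 1 + heavy_len (f c) + slot_start (sz (f c) ^ e - heavy_len (f c) - 1) (symb c))"

definition pos :: "'a \<Rightarrow> nat" where
  "pos v = (\<Sum>x\<in>an v. off x)"

lemma heavy_len_eq: "c \<in> ch u \<Longrightarrow> rk c = 0 \<Longrightarrow> heavy_len u = sz c ^ e"
proof -
  assume c: "c \<in> ch u" "rk c = 0"
  then have "{c \<in> ch u. rk c = 0} = {c}" using rk_inj[of u] by (auto simp: inj_on_def)
  then show ?thesis by (simp add: heavy_len_def)
qed

text \<open>Here ports are charged to ranks. For a rank below \<open>H\<close> the symbol is linear
  in \<open>r\<close>; otherwise the port is below \<open>t * r <= r ^ (a + 1)\<close>. Constants
  are absorbed by powers of \<open>r >= 2\<close>. This fails for the largest child, where
  \<open>r = 1\<close>, which is why it has an interval of its own outside the slots.\<close>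

lemma symb_bound:
  assumes c: "c \<in> ch u" and nz: "rk c \<noteq> 0"
  shows "(symb c + 2)\<^sup>2 * sz c ^ (e - 1) \<le> sz u ^ (e - 1)"
proof -
  define r where "r = rk c + 1"
  have r2: "2 \<le> r" using nz by (simp add: r_def)
  have "symb c + 2 \<le> r ^ (a + 3)"
  proof (cases "rk c < H")
    case True
    then have "symb c + 2 = 2 * r" by (simp add: symb_def r_def)
    also have "\<dots> \<le> r ^ 2" using r2 by (simp add: power2_eq_square)
    also have "\<dots> \<le> r ^ (a + 3)" using r2 by (intro power_increasing) auto
    finally show ?thesis .
  next
    case False
    have fc: "f c = u" using c by (simp add: children_def)
    have "p u c + 1 \<le> t * r" using port_less[OF c] by (simp add: r_def)
    also have "\<dots> \<le> r ^ a * r"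
    proof (rule mult_right_mono)
      have "t \<le> H ^ a" by (rule t_le)
      also have "\<dots> \<le> r ^ a" using False by (intro power_mono) (auto simp: r_def)
      finally show "t \<le> r ^ a" .
    qed auto
    finally have "p u c + 1 \<le> r ^ (a + 1)" by (simp add: mult.commute)
    moreover have "1 \<le> r ^ (a + 1)" using r2 by simp
    ultimately have "symb c + 2 \<le> 4 * r ^ (a + 1)" using False fc by (simp add: symb_def)
    also have "\<dots> \<le> r ^ 2 * r ^ (a + 1)"
      using power_mono[of 2 r 2] r2 by (intro mult_right_mono) auto
    also have "\<dots> = r ^ (a + 3)" by (simp add: power_add power2_eq_square power3_eq_cube)
    finally show ?thesis .
  qed
  then have "(symb c + 2)\<^sup>2 \<le> (r ^ (a + 3))\<^sup>2" by (rule power_mono) simp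
  also have "\<dots> = r ^ (e - 1)" by (simp add: e_def algebra_simps flip: power_mult)
  finally have "(symb c + 2)\<^sup>2 * sz c ^ (e - 1) \<le> r ^ (e - 1) * sz c ^ (e - 1)"
    by (rule mult_right_mono) simp
  also have "\<dots> = (r * sz c) ^ (e - 1)" by (simp add: power_mult_distrib)
  also have "\<dots> \<le> sz u ^ (e - 1)"
    using rk_sz[OF c] by (intro power_mono) (auto simp: r_def)
  finally show ?thesis .
qed

lemma e_pos: "e = Suc (e - 1)" by (simp add: e_def)

lemma heavy_len_less: "u \<in> A \<Longrightarrow> heavy_len u + 1 \<le> sz u ^ e"
proof -
  assume u: "u \<in> A"
  show ?thesis
  proof (cases "\<exists>c\<in>ch u. rk c = 0")
    case True
    then obtain c where c: "c \<in> ch u" "rk c = 0" by blast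
    have "sz c < sz u" using sum_sz_children[OF u, of "{c}"] c by simp
    then have "sz c ^ e < sz u ^ e" by (intro power_strict_mono) (auto simp: e_def)
    then show ?thesis using heavy_len_eq[OF c] by simp
  next
    case False
    then have "{c \<in> ch u. rk c = 0} = {}" by auto
    then have "heavy_len u = 0" by (simp only: heavy_len_def sum.empty)
    then show ?thesis using sz_pos[OF u] by simp
  qed
qed

text \<open>In \<open>sz u * sz u ^ (e - 1)\<close> the first factor is at least
  \<open>sz c0 + sz c + 1\<close>. The three summands pay for the interval of the largest child
  \<open>c0\<close>, for the slot of \<open>c\<close> including its factor
  \<open>(symb c + 2)^2\<close>, and for the position of \<open>u\<close>.\<close>

lemma slot_large:
  assumes c: "c \<in> ch u" and nz: "rk c \<noteq> 0"
  shows "sz c ^ e \<le> (sz u ^ e - heavy_len u - 1) div (symb c + 2)\<^sup>2"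
proof -
  have u: "u \<in> A" using ch_parent[OF c] by simp
  obtain c0 where c0: "c0 \<in> ch u" "rk c0 = 0" using rk_zero[OF c] by blast
  have sum: "sz c0 + sz c + 1 \<le> sz u"
  proof -
    have "c0 \<noteq> c" using c0 nz by auto
    then show ?thesis using sum_sz_children[OF u, of "{c0, c}"] c c0 by simp
  qed
  define k where "k = e - 1"
  have ek: "e = Suc k" using e_pos by (simp add: k_def)
  have "sz c0 ^ e + sz c ^ e * (symb c + 2)\<^sup>2 + 1 = sz c0 * sz c0 ^ k + sz c * ((symb c + 2)\<^sup>2 * sz c ^ k) + 1"
    unfolding ek by (simp add: algebra_simps)
  also have "\<dots> \<le> sz c0 * sz u ^ k + sz c * sz u ^ k + sz u ^ k"
  proof (intro add_mono mult_left_mono)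
    show "sz c0 ^ k \<le> sz u ^ k" using sum by (intro power_mono) auto
    show "(symb c + 2)\<^sup>2 * sz c ^ k \<le> sz u ^ k" using symb_bound[OF c nz] by (simp add: k_def)
    show "1 \<le> sz u ^ k" using sz_pos[OF u] by simp
  qed auto
  also have "\<dots> = (sz c0 + sz c + 1) * sz u ^ k" by (simp add: algebra_simps)
  also have "\<dots> \<le> sz u * sz u ^ k" by (rule mult_right_mono[OF sum]) simp
  finally have "sz c ^ e * (symb c + 2)\<^sup>2 \<le> sz u ^ e - heavy_len u - 1"
    using heavy_len_eq[OF c0] by (simp add: ek)
  then show ?thesis by (subst less_eq_div_iff_mult_less_eq) (auto simp: mult.commute)
qed

lemma pos_root: "f v = v \<Longrightarrow> pos v = 0"
  by (simp add: pos_def ancs_root off_def)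

lemma pos_child: "v \<in> A \<Longrightarrow> f v \<noteq> v \<Longrightarrow> pos v = pos (f v) + off v"
proof -
  assume v: "v \<in> A" "f v \<noteq> v"
  have "pos v = (\<Sum>x\<in>insert v (an (f v)). off x)" using ancs_step[of f v] by (simp add: pos_def)
  then show ?thesis using v not_in_an_parent[of v] finite_an[of "f v"] parent_in by (simp add: pos_def)
qed

lemma pos_ch: "c \<in> ch u \<Longrightarrow> pos c = pos u + off c"
  using pos_child[of c] ch_parent[of c u] by auto

lemma off_heavy: "c \<in> ch u \<Longrightarrow> rk c = 0 \<Longrightarrow> off c = 1"
  using ch_parent[of c u] by (auto simp: off_def)

lemma off_light: "c \<in> ch u \<Longrightarrow> rk c \<noteq> 0 \<Longrightarrow>
    off c = 1 + heavy_len u + slot_start (sz u ^ e - heavy_len u - 1) (symb c)"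
  using ch_parent[of c u] by (auto simp: off_def)

lemma light_interval:
  assumes "c \<in> ch u" "rk c \<noteq> 0"
  shows "off c + sz c ^ e \<le> 1 + heavy_len u + slot_start (sz u ^ e - heavy_len u - 1) (Suc (symb c))"
  using slot_large[OF assms] off_light[OF assms] by (simp add: slot_start_Suc)

lemma child_interval:
  assumes c: "c \<in> ch u"
  shows "1 \<le> off c" "off c + sz c ^ e \<le> sz u ^ e"
proof -
  have u: "u \<in> A" using ch_parent[OF c] by simp
  show "1 \<le> off c" using ch_parent[OF c] by (auto simp: off_def)
  show "off c + sz c ^ e \<le> sz u ^ e"
  proof (cases "rk c = 0")
    case True
    then show ?thesis using off_heavy[OF c] heavy_len_eq[OF c] heavy_len_less[OF u] by simp
  next
    case False
    then show ?thesis
      using light_interval[OF c] heavy_len_less[OF u]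
        slot_start_le[of "sz u ^ e - heavy_len u - 1" "Suc (symb c)"] by simp
  qed
qed

lemma symb_inj:
  assumes "c \<in> ch u" "c' \<in> ch u" "symb c = symb c'"
  shows "c = c'"
proof -
  have "f c = u" "f c' = u" using assms by (auto simp: children_def)
  then show ?thesis
    using assms rk_inj[of u] port_inj[of u]
    by (auto simp: symb_def inj_on_def split: if_splits) presburger+
qed

lemma sibling_intervals:
  assumes "c \<in> ch u" "c' \<in> ch u" "c \<noteq> c'"
  shows "off c + sz c ^ e \<le> off c' \<or> off c' + sz c' ^ e \<le> off c"
proof -
  have *: "off c + sz c ^ e \<le> off c'"
    if "c \<in> ch u" "c' \<in> ch u" "rk c = 0" "rk c' \<noteq> 0" for c c'
    using that off_heavy[of c u] heavy_len_eq[of c u] off_light[of c' u] by simp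
  have **: "off c + sz c ^ e \<le> off c'"
    if "c \<in> ch u" "c' \<in> ch u" "rk c \<noteq> 0" "rk c' \<noteq> 0" "symb c < symb c'" for c c'
    using that light_interval[of c u] off_light[of c' u]
      slot_start_mono[of "Suc (symb c)" "symb c'" "sz u ^ e - heavy_len u - 1"] by simp
  have "rk c \<noteq> rk c'" using assms rk_inj[of u] by (auto simp: inj_on_def)
  moreover have "symb c \<noteq> symb c'" using assms symb_inj by blast
  ultimately show ?thesis
    using *[of c c'] *[of c' c] **[of c c'] **[of c' c] assms by (metis linorder_neqE_nat)
qed

lemma pos_desc: "u \<in> A \<Longrightarrow> v \<in> A \<Longrightarrow> u \<in> an v \<Longrightarrow> pos u \<le> pos v \<and> pos v + sz v ^ e \<le> pos u + sz u ^ e"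
proof (rotate_tac, induction rule: forest_induct)
  case (root v)
  then show ?case by (simp add: ancs_root)
next
  case (child v)
  have c: "v \<in> ch (f v)" using child by (auto simp: children_def)
  have "u = v \<or> u \<in> an (f v)" using ancs_step[of f v] child by auto
  then show ?case
    using child child_interval[OF c] pos_child[of v] by auto
qed

lemma pos_desc_less:
  assumes "v \<in> de u" "u \<in> A" shows "pos u \<le> pos v" "pos v < pos u + sz u ^ e"
proof -
  have "v \<in> A" "u \<in> an v" using assms by (auto simp: desc_def)
  moreover have "0 < sz v ^ e" using sz_pos[OF \<open>v \<in> A\<close>] by simp
  ultimately show "pos u \<le> pos v" "pos v < pos u + sz u ^ e"
    using pos_desc[of u v] assms by linarith+
qed

text \<open>Intervals of different trees overlap, as every root has position \<open>0\<close>, so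
  the roots must agree. Going down from the root, \<open>v\<close> lies below the parent of
  \<open>u\<close> by induction, and the disjoint intervals of siblings leave only \<open>u\<close>
  as the child towards \<open>v\<close>.\<close>

lemma pos_interval_desc:
  "u \<in> A \<Longrightarrow> \<forall>v\<in>A. rt v = rt u \<longrightarrow> pos u \<le> pos v \<longrightarrow> pos v < pos u + sz u ^ e \<longrightarrow> v \<in> de u"
proof (induction rule: forest_induct)
  case (root u)
  then show ?case using de_root rt_root by metis
next
  case (child u)
  have c: "u \<in> ch (f u)" using child by (auto simp: children_def)
  show ?case
  proof (intro ballI impI)
    fix v assume v: "v \<in> A" "rt v = rt u" "pos u \<le> pos v" "pos v < pos u + sz u ^ e"
    have "v \<in> de (f u)"
      using child.IH v child_interval[OF c] pos_ch[OF c] rt_parent[of u] child.hyps by auto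
    moreover have "v \<noteq> f u" using v child_interval[OF c] pos_ch[OF c] by auto
    ultimately obtain c' where c': "c' \<in> ch (f u)" "v \<in> de c'" using child_ex by blast
    show "v \<in> de u"
    proof (cases "c' = u")
      case False
      then show ?thesis
        using sibling_intervals[OF c c'(1)] pos_ch[OF c] pos_ch[OF c'(1)] v
          pos_desc_less[OF c'(2)] ch_parent[OF c'(1)] by auto
    qed (use c' in simp)
  qed
qed

lemma pos_bound: "v \<in> A \<Longrightarrow> pos v < card A ^ e"
proof -
  assume v: "v \<in> A"
  have "pos v < pos (rt v) + sz (rt v) ^ e"
    using pos_desc_less[OF de_root[OF v] rt_in[OF v]] by simp
  also have "\<dots> = sz (rt v) ^ e" using pos_root rt(2)[OF v] by simp
  also have "\<dots> \<le> card A ^ e" by (intro power_mono card_mono finite_A de_subset) simp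
  finally show ?thesis .
qed

lemma sz_pow_bound: "sz u ^ e \<le> card A ^ e"
  by (intro power_mono card_mono finite_A de_subset) simp

lemma heavy_len_bound: "u \<in> A \<Longrightarrow> heavy_len u < card A ^ e"
  using heavy_len_less[of u] sz_pow_bound[of u] by simp

definition heavy_port :: "'a \<Rightarrow> nat" where
  "heavy_port u = (if \<exists>c\<in>ch u. rk c = 0 then p u (SOME c. c \<in> ch u \<and> rk c = 0) else 0)"

lemma heavy_port: "c \<in> ch u \<Longrightarrow> rk c = 0 \<Longrightarrow> heavy_port u = p u c"
proof -
  assume c: "c \<in> ch u" "rk c = 0"
  then have "(SOME c. c \<in> ch u \<and> rk c = 0) = c"
    using rk_inj[of u] by (intro some_equality) (auto simp: inj_on_def)
  then show ?thesis using c by (auto simp: heavy_port_def)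
qed

lemma packed_ports_exist:
  "\<exists>W < B ^ H. \<forall>c\<in>ch u. rk c < H \<longrightarrow> (W div B ^ rk c) mod B = p u c"
proof -
  define d where "d j = (if \<exists>c\<in>ch u. rk c = j then p u (SOME c. c \<in> ch u \<and> rk c = j) else 0)" for j
  have d: "d (rk c) = p u c" if c: "c \<in> ch u" for c
  proof -
    have "(SOME c'. c' \<in> ch u \<and> rk c' = rk c) = c"
      using rk_inj[of u] c by (intro some_equality) (auto simp: inj_on_def)
    then show ?thesis using c by (auto simp: d_def)
  qed
  have "d j < B" if "j < H" for j
  proof (cases "\<exists>c\<in>ch u. rk c = j")
    case True
    then obtain c where c: "c \<in> ch u" "rk c = j" by blast
    have "d j < t * (j + 1)" using port_less[OF c(1)] d[OF c(1)] c by simp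
    also have "\<dots> \<le> t * H" using that by (intro mult_left_mono) auto
    finally show ?thesis using B_ge by simp
  next
    case False
    then show ?thesis using B_pos by (auto simp: d_def)
  qed
  then obtain W where "W < B ^ H" "\<forall>j<H. (W div B ^ j) mod B = d j"
    using pack_digits[of H d B] by blast
  then show ?thesis using d by auto
qed

definition packed :: "'a \<Rightarrow> nat" where
  "packed u = (SOME W. W < B ^ H \<and> (\<forall>c\<in>ch u. rk c < H \<longrightarrow> (W div B ^ rk c) mod B = p u c))"

lemma packed: "packed u < B ^ H" "c \<in> ch u \<Longrightarrow> rk c < H \<Longrightarrow> (packed u div B ^ rk c) mod B = p u c"
  using someI_ex[OF packed_ports_exist[of u]] by (auto simp: packed_def)

lemma tree_port_correct:
  assumes "u \<in> A" "v \<in> A" "u \<noteq> v" and r: "r = r' \<longleftrightarrow> rt u = rt v"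
  shows "tree_port B r (pos u) (sz u ^ e) (heavy_len u) (heavy_port u) (packed u) pp r' (pos v) =
    (if v \<in> de u then p u (next_hop A f u v) else pp)"
proof (cases "v \<in> de u")
  case False
  then have "\<not> (r = r' \<and> pos u \<le> pos v \<and> pos v < pos u + sz u ^ e)"
    using pos_interval_desc[OF assms(1)] assms by auto
  then show ?thesis unfolding tree_port_def using False by (simp only: if_False)
next
  case True
  define c where "c = next_hop A f u v"
  have c: "c \<in> ch u" "v \<in> de c" using next_hop_child[OF True] assms by (auto simp: c_def)
  have cond: "r = r' \<and> pos u \<le> pos v \<and> pos v < pos u + sz u ^ e"
    using r de_rt[OF assms(1) True] pos_desc_less[OF True assms(1)] by simp
  have iv: "pos u + off c \<le> pos v" "pos v < pos u + off c + sz c ^ e"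
    using pos_desc_less[OF c(2)] pos_ch[OF c(1)] ch_parent[OF c(1)] by auto
  show ?thesis
  proof (cases "rk c = 0")
    case rk0: True
    have "pos v - pos u - 1 < heavy_len u"
      using iv off_heavy[OF c(1) rk0] heavy_len_eq[OF c(1) rk0] by simp
    then show ?thesis using cond True heavy_port[OF c(1) rk0] by (simp add: tree_port_def c_def)
  next
    case False
    define L where "L = sz u ^ e - heavy_len u - 1"
    define x where "x = pos v - pos u - 1 - heavy_len u"
    have ge: "heavy_len u \<le> pos v - pos u - 1" using iv off_light[OF c(1) False] by simp
    have x: "slot_start L (symb c) \<le> x" "x < slot_start L (Suc (symb c))"
      using iv off_light[OF c(1) False] light_interval[OF c(1) False]
      unfolding L_def[symmetric] x_def by auto
    \<comment> \<open>By monotonicity of \<open>slot_start\<close>, searching for the slot that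
      contains \<open>x\<close> inverts the encoding, although \<open>tree_port\<close> knows
      neither the light children nor their sizes.\<close>
    have m: "(LEAST m. x < slot_start L (Suc m)) = symb c"
    proof (rule Least_equality)
      show "x < slot_start L (Suc (symb c))" by (rule x)
    next
      fix m assume "x < slot_start L (Suc m)"
      then have "slot_start L (symb c) < slot_start L (Suc m)" using x by simp
      then show "symb c \<le> m" using slot_start_mono[of "Suc m" "symb c" L] by (meson not_less not_less_eq_eq)
    qed
    have "tree_port B r (pos u) (sz u ^ e) (heavy_len u) (heavy_port u) (packed u) pp r' (pos v) =
       (if even (symb c) then (packed u div B ^ (symb c div 2)) mod B else symb c div 2)"
      using cond ge m unfolding tree_port_def x_def L_def by (simp add: Let_def)
    also have "\<dots> = p u c"
      using packed(2)[OF c(1)] ch_parent[OF c(1)] by (auto simp: symb_def)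
    finally show ?thesis using True by (simp add: c_def)
  qed
qed

end

section \<open>Sparse covers\<close>

text \<open>A relation between vertices and lengths instead of a distance function, so that neither
  minima nor unreachable vertices need treatment. Walks are confined to \<open>R\<close> because the
  tree of a cluster must not leave the cluster.\<close>

inductive reach :: "('a \<times> 'a) set \<Rightarrow> ('a \<times> 'a \<Rightarrow> real) \<Rightarrow> 'a set \<Rightarrow> 'a \<Rightarrow> 'a \<Rightarrow> real \<Rightarrow> bool"
  for E W R where
  refl: "x \<in> R \<Longrightarrow> reach E W R x x 0"
| step: "(x, y) \<in> E \<Longrightarrow> x \<in> R \<Longrightarrow> reach E W R y z l \<Longrightarrow> reach E W R x z (W (x, y) + l)"

definition ball :: "('a \<times> 'a) set \<Rightarrow> ('a \<times> 'a \<Rightarrow> real) \<Rightarrow> 'a set \<Rightarrow> 'a \<Rightarrow> real \<Rightarrow> 'a set" where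
  "ball E W R v r = {y. \<exists>l\<le>r. reach E W R y v l}"

locale sym_weighted =
  fixes V :: "'a set" and E :: "('a \<times> 'a) set" and W :: "'a \<times> 'a \<Rightarrow> real"
  assumes finite_V: "finite V" and E_sub: "E \<subseteq> V \<times> V"
    and E_sym: "(x, y) \<in> E \<Longrightarrow> (y, x) \<in> E"
    and W_sym: "(x, y) \<in> E \<Longrightarrow> W (x, y) = W (y, x)"
    and W_nonneg: "(x, y) \<in> E \<Longrightarrow> 0 \<le> W (x, y)"
begin

lemma reach_in: "reach E W R x y l \<Longrightarrow> x \<in> R \<and> y \<in> R"
  by (induction rule: reach.induct) auto

lemma reach_nonneg: "reach E W R x y l \<Longrightarrow> 0 \<le> l"
  by (induction rule: reach.induct) (auto intro: add_nonneg_nonneg W_nonneg)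

lemma reach_trans: "reach E W R x y l \<Longrightarrow> reach E W R y z l' \<Longrightarrow> reach E W R x z (l + l')"
  by (induction rule: reach.induct) (auto simp: add.assoc intro: reach.intros)

lemma reach_edge: "(x, y) \<in> E \<Longrightarrow> x \<in> R \<Longrightarrow> y \<in> R \<Longrightarrow> reach E W R x y (W (x, y))"
  using reach.step[OF _ _ reach.refl, of x y E R W] by simp

lemma reach_sym: "reach E W R x y l \<Longrightarrow> reach E W R y x l"
proof (induction rule: reach.induct)
  case (step x y z l)
  then have "reach E W R y x (W (x, y))"
    using reach_edge[of y x R] E_sym[of x y] W_sym[of x y] reach_in by metis
  then show ?case using reach_trans[OF step.IH, of x "W (x, y)"] by (simp add: add.commute)
qed (auto intro: reach.intros)

lemma ball_subset: "ball E W R v r \<subseteq> R"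
  using reach_in by (auto simp: ball_def)

lemma ball_mono: "r \<le> r' \<Longrightarrow> ball E W R v r \<subseteq> ball E W R v r'"
  by (auto simp: ball_def intro: order_trans)

lemma center_in_ball: "v \<in> R \<Longrightarrow> 0 \<le> r \<Longrightarrow> v \<in> ball E W R v r"
  by (auto simp: ball_def intro: reach.refl)

text \<open>Suffixes of a walk to \<open>v\<close> are no longer than the walk, so all its vertices
  lie in the ball around \<open>v\<close>.\<close>

lemma reach_within_ball:
  assumes "reach E W R y v l" "l \<le> r" "ball E W R v r \<subseteq> S"
  shows "reach E W S y v l"
  using assms
proof (induction rule: reach.induct)
  case (refl x)
  then have "x \<in> ball E W R x r" by (auto intro: center_in_ball)
  then show ?case using refl by (auto intro: reach.refl)
next
  case (step x y z l)
  have "reach E W R x z (W (x, y) + l)" using step by (auto intro: reach.step)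
  then have "x \<in> S" using step by (auto simp: ball_def)
  then show ?case using step W_nonneg[of x y] by (auto intro: reach.step)
qed

text \<open>The edges of weight \<open>0\<close> will be the short ones. A closed cluster cannot be
  left along them, so it contains every component of short edges that it meets.\<close>

definition closed0 :: "'a set \<Rightarrow> bool" where
  "closed0 R \<longleftrightarrow> (\<forall>y z. y \<in> R \<longrightarrow> (y, z) \<in> E \<longrightarrow> W (y, z) = 0 \<longrightarrow> z \<in> R)"

definition cluster_of :: "('a \<Rightarrow> 'a option) \<Rightarrow> 'a \<Rightarrow> 'a set" where
  "cluster_of ctr x = {y. ctr y = Some x}"

definition good_clusters :: "real \<Rightarrow> 'a set \<Rightarrow> ('a \<Rightarrow> 'a option) \<Rightarrow> bool" where
  "good_clusters \<rho> R ctr \<longleftrightarrow> (\<forall>y x. ctr y = Some x \<longrightarrow> y \<in> R \<and> x \<in> R \<and> ctr x = Some x \<and>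
     closed0 (cluster_of ctr x) \<and> (\<exists>l\<le>\<rho>. reach E W (cluster_of ctr x) y x l))"

text \<open>Region growing: for some radius, the shell that is lost is a \<open>1 / b\<close> fraction of the
  part of the ball that is covered.\<close>

lemma growth_step:
  fixes g :: "nat \<Rightarrow> nat" and b :: real
  assumes g0: "1 \<le> g 0" and gb: "\<And>j. g j \<le> n" and b: "1 \<le> b"
    and J: "2 * b * ln n < real J"
  shows "\<exists>j<J. real (g (Suc j)) \<le> (1 + 1 / b) * real (g j)"
proof (rule ccontr)
  assume neg: "\<not> ?thesis"
  have "(1 + 1 / b) ^ j \<le> real (g j)" if "j \<le> J" for j
    using that
  proof (induction j)
    case (Suc j)
    have "(1 + 1 / b) ^ Suc j = (1 + 1 / b) * (1 + 1 / b) ^ j" by simp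
    also have "\<dots> \<le> (1 + 1 / b) * real (g j)" using Suc b by (intro mult_left_mono) auto
    also have "\<dots> \<le> real (g (Suc j))" using neg Suc by (meson Suc_le_lessD less_eq_real_def not_le)
    finally show ?case .
  qed (use g0 in auto)
  then have "(1 + 1 / b) ^ J \<le> real n" using gb[of J] by (meson of_nat_mono order.trans order_refl)
  moreover have n: "1 \<le> n" using g0 gb[of 0] by simp
  moreover have "0 < (1 + 1 / b)" using b by (simp add: add_pos_nonneg)
  ultimately have "real J * ln (1 + 1 / b) \<le> ln n"
    by (metis ln_le_cancel_iff ln_realpow of_nat_0_less_iff zero_less_power less_le_trans zero_less_one)
  moreover have "1 / (2 * b) \<le> ln (1 + 1 / b)"
  proof -
    define y where "y = 1 + 1 / b"
    have y: "0 < y" using b by (simp add: y_def add_pos_nonneg)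
    have "1 / (2 * b) \<le> 1 - 1 / y" using b by (simp add: y_def field_simps)
    also have "\<dots> \<le> ln y"
      using ln_le_minus_one[of "1 / y"] y by (simp add: ln_div)
    finally show ?thesis by (simp add: y_def)
  qed
  then have "real J * (1 / (2 * b)) \<le> real J * ln (1 + 1 / b)" by (intro mult_left_mono) auto
  ultimately have "real J * (1 / (2 * b)) \<le> ln n" by simp
  then show False using J b by (simp add: field_simps)
qed

text \<open>The cluster \<open>K\<close> around \<open>x\<close> has the odd radius
  \<open>2 * j + 1\<close>, in units of \<open>r\<close>. Vertices within \<open>2 * j\<close> have
  their balls inside \<open>K\<close>; those beyond \<open>2 * j + 2\<close> have balls disjoint
  from \<open>K\<close> and are treated in \<open>R - K\<close>; only the shell between is lost.
  \<open>growth_step\<close> charges the shell to the part of \<open>U\<close> within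
  \<open>2 * j\<close>, and these parts are disjoint over the recursion, whence the factor
  \<open>b\<close>.\<close>

lemma cover_round:
  fixes b :: real
  assumes "R \<subseteq> V" "U \<subseteq> R" "closed0 R" and r: "0 \<le> r" and b: "1 \<le> b"
    and J: "2 * b * ln (card V) < real J"
    and bU: "\<forall>v\<in>U. ball E W V v r \<subseteq> R"
  shows "\<exists>ctr U'. U' \<subseteq> U \<and> b * card U' \<le> card U \<and> good_clusters ((2 * real J + 1) * r) R ctr \<and>
     (\<forall>v\<in>U - U'. \<exists>x. ball E W V v r \<subseteq> cluster_of ctr x)"
  using assms(1-3) bU
proof (induction "card R" arbitrary: R U rule: less_induct)
  case less
  show ?case
  proof (cases "U = {}")
    case True
    then show ?thesis
      by (intro exI[of _ "\<lambda>_. None"] exI[of _ "{}"]) (auto simp: good_clusters_def)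
  next
    case False
    then obtain x where x: "x \<in> U" by blast
    have fin: "finite R" using less.prems finite_V finite_subset by blast
    have finU: "finite U" using less.prems fin finite_subset by blast
    define bl where "bl s = ball E W R x (real s * r)" for s
    define g where "g j = card (U \<inter> bl (2 * j))" for j
    have x_bl: "x \<in> bl s" for s
      unfolding bl_def using x less.prems r by (intro center_in_ball) auto
    have "x \<in> U \<inter> bl (2 * 0)" using x x_bl by blast
    then have "1 \<le> g 0" unfolding g_def using finU by (metis One_nat_def Suc_leI card_gt_0_iff empty_iff finite_Int)
    moreover have "g j \<le> card V" for j
      unfolding g_def using less.prems finite_V by (intro card_mono) auto
    ultimately obtain j where j: "j < J" "real (g (Suc j)) \<le> (1 + 1 / b) * real (g j)"
      using growth_step[of g "card V" b J] b J by blast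
    define K where "K = bl (2 * j + 1)"
    have K_R: "K \<subseteq> R" unfolding K_def bl_def by (rule ball_subset)
    have xK: "x \<in> K" unfolding K_def by (rule x_bl)
    have bl_mono: "bl s \<subseteq> bl s'" if "s \<le> s'" for s s'
      unfolding bl_def using that r by (intro ball_mono mult_right_mono) auto
    have K_closed: "closed0 K"
      unfolding closed0_def
    proof (intro allI impI)
      fix y z assume yz: "y \<in> K" "(y, z) \<in> E" "W (y, z) = 0"
      then obtain l where l: "l \<le> real (2 * j + 1) * r" "reach E W R y x l"
        by (auto simp: K_def bl_def ball_def)
      have "z \<in> R" using yz K_R less.prems(3) by (auto simp: closed0_def)
      then have "reach E W R z x (0 + l)"
        using reach.step[of z y E R W x l] l yz E_sym[of y z] W_sym[of y z] by simp
      then show "z \<in> K" using l by (auto simp: K_def bl_def ball_def)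
    qed
    define R' where "R' = R - K"
    define U1 where "U1 = U - bl (2 * j + 2)"
    have R'_closed: "closed0 R'"
      unfolding closed0_def
    proof (intro allI impI)
      fix y z assume yz: "y \<in> R'" "(y, z) \<in> E" "W (y, z) = 0"
      then have "z \<in> R" using less.prems(3) by (auto simp: R'_def closed0_def)
      moreover have "z \<notin> K"
        using K_closed yz E_sym[of y z] W_sym[of y z] by (auto simp: R'_def closed0_def)
      ultimately show "z \<in> R'" by (simp add: R'_def)
    qed
    have reach_R: "reach E W R y v l" if "v \<in> U" "reach E W V y v l" "l \<le> r" for y v l
      using reach_within_ball[of V y v l r R] that less.prems(4) by blast
    have bU1: "\<forall>v\<in>U1. ball E W V v r \<subseteq> R'"
    proof (intro ballI subsetI)
      fix v y assume v: "v \<in> U1" and y: "y \<in> ball E W V v r"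
      then obtain l where l: "l \<le> r" "reach E W V y v l" by (auto simp: ball_def)
      have vU: "v \<in> U" using v by (simp add: U1_def)
      have yv: "reach E W R y v l" by (rule reach_R) (use vU l in auto)
      have "y \<notin> K"
      proof
        assume "y \<in> K"
        then obtain l' where l': "l' \<le> real (2 * j + 1) * r" "reach E W R y x l'"
          by (auto simp: K_def bl_def ball_def)
        have "reach E W R v x (l + l')" using reach_trans[OF reach_sym[OF yv] l'(2)] .
        moreover have "l + l' \<le> real (2 * j + 2) * r" using l l' by (simp add: algebra_simps)
        ultimately have "v \<in> bl (2 * j + 2)" by (auto simp: bl_def ball_def)
        then show False using v by (simp add: U1_def)
      qed
      then show "y \<in> R'" using reach_in[OF yv] by (simp add: R'_def)
    qed
    have R'_V: "R' \<subseteq> V" using less.prems by (auto simp: R'_def)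
    have "card R' < card R" using xK K_R fin by (auto simp: R'_def intro!: psubset_card_mono)
    moreover have "U1 \<subseteq> R'"
      using less.prems bl_mono[of "2 * j + 1" "2 * j + 2"] by (auto simp: U1_def R'_def K_def)
    ultimately have "\<exists>ctr U'. U' \<subseteq> U1 \<and> b * card U' \<le> card U1 \<and>
        good_clusters ((2 * real J + 1) * r) R' ctr \<and>
        (\<forall>v\<in>U1 - U'. \<exists>x. ball E W V v r \<subseteq> cluster_of ctr x)"
      using R'_V R'_closed bU1 by (intro less.hyps)
    then obtain ctr U' where IH: "U' \<subseteq> U1" "b * card U' \<le> card U1"
      "good_clusters ((2 * real J + 1) * r) R' ctr"
      "\<forall>v\<in>U1 - U'. \<exists>x. ball E W V v r \<subseteq> cluster_of ctr x"
      by blast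
    define ctr' where "ctr' y = (if y \<in> K then Some x else ctr y)" for y
    define U2 where "U2 = U' \<union> (U \<inter> (bl (2 * j + 2) - bl (2 * j)))"
    have ctr_R': "ctr y = Some z \<Longrightarrow> y \<in> R' \<and> z \<in> R'" for y z
      using IH(3) by (auto simp: good_clusters_def)
    have cl_x: "cluster_of ctr' x = K"
      using ctr_R' xK by (auto simp: cluster_of_def ctr'_def R'_def)
    have cl_z: "cluster_of ctr' z = cluster_of ctr z" if "z \<in> R'" for z
      using ctr_R' that xK by (auto simp: cluster_of_def ctr'_def R'_def)
    have good: "good_clusters ((2 * real J + 1) * r) R ctr'"
      unfolding good_clusters_def
    proof (intro allI impI)
      fix y z assume yz: "ctr' y = Some z"
      show "y \<in> R \<and> z \<in> R \<and> ctr' z = Some z \<and> closed0 (cluster_of ctr' z) \<and>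
          (\<exists>l\<le>(2 * real J + 1) * r. reach E W (cluster_of ctr' z) y z l)"
      proof (cases "y \<in> K")
        case True
        then have z: "z = x" using yz by (simp add: ctr'_def)
        obtain l where l: "l \<le> real (2 * j + 1) * r" "reach E W R y x l"
          using True by (auto simp: K_def bl_def ball_def)
        have "reach E W K y x l"
          using reach_within_ball[OF l(2,1), of K] by (simp add: K_def bl_def)
        moreover have "l \<le> (2 * real J + 1) * r"
        proof -
          have "real (2 * j + 1) * r \<le> (2 * real J + 1) * r" using j r by (intro mult_right_mono) auto
          then show ?thesis using l by simp
        qed
        ultimately show ?thesis using True z K_R xK cl_x K_closed by (auto simp: ctr'_def)
      next
        case False
        then have y: "ctr y = Some z" using yz by (simp add: ctr'_def)
        then have "z \<in> R'" using ctr_R' by blast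
        then show ?thesis using y IH(3) cl_z by (auto simp: good_clusters_def ctr'_def R'_def)
      qed
    qed
    have covered: "\<exists>z. ball E W V v r \<subseteq> cluster_of ctr' z" if v: "v \<in> U - U2" for v
    proof (cases "v \<in> bl (2 * j)")
      case True
      have "ball E W V v r \<subseteq> K"
      proof
        fix y assume "y \<in> ball E W V v r"
        then obtain l where l: "l \<le> r" "reach E W V y v l" by (auto simp: ball_def)
        have yv: "reach E W R y v l" by (rule reach_R) (use v l in auto)
        obtain l' where l': "l' \<le> real (2 * j) * r" "reach E W R v x l'"
          using True by (auto simp: bl_def ball_def)
        have "reach E W R y x (l + l')" using reach_trans[OF yv l'(2)] .
        moreover have "l + l' \<le> real (2 * j + 1) * r" using l l' by (simp add: algebra_simps)
        ultimately show "y \<in> K" by (auto simp: K_def bl_def ball_def)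
      qed
      then show ?thesis using cl_x by blast
    next
      case False
      then have "v \<in> U1 - U'" using v by (auto simp: U1_def U2_def)
      then obtain z where z: "ball E W V v r \<subseteq> cluster_of ctr z" using IH(4) by blast
      have "v \<in> ball E W V v r" using v less.prems r by (intro center_in_ball) auto
      then have "ctr v = Some z" using z by (auto simp: cluster_of_def)
      then show ?thesis using z cl_z ctr_R' by metis
    qed
    have "b * card U2 \<le> card U"
    proof -
      define P where "P = U \<inter> bl (2 * j)"
      define Q where "Q = U \<inter> bl (2 * j + 2)"
      have PQ: "P \<subseteq> Q" using bl_mono[of "2 * j" "2 * j + 2"] by (auto simp: P_def Q_def)
      have finQ: "finite Q" "finite P" using finU by (auto simp: Q_def P_def)
      have "U2 = U' \<union> (Q - P)" by (auto simp: U2_def P_def Q_def)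
      then have "card U2 \<le> card U' + card (Q - P)" by (simp add: card_Un_le)
      also have "card (Q - P) = card Q - card P" using PQ finQ by (simp add: card_Diff_subset)
      finally have "real (card U2) \<le> real (card U') + (real (card Q) - real (card P))"
        using card_mono[OF finQ(1) PQ] by linarith
      then have "b * card U2 \<le> b * card U' + b * (real (card Q) - real (card P))"
        using b by (simp flip: distrib_left)
      also have "b * (real (card Q) - real (card P)) \<le> card P"
        using j(2) b by (simp add: g_def P_def Q_def field_simps)
      also have "b * card U' \<le> card U1" by (rule IH)
      also have "real (card U1) + card P \<le> card U"
      proof -
        have "U1 \<inter> P = {}" "U1 \<union> P \<subseteq> U" using bl_mono[of "2 * j" "2 * j + 2"] by (auto simp: U1_def P_def)
        then have "card U1 + card P \<le> card U"
          using card_Un_disjoint[of U1 P] card_mono[of U "U1 \<union> P"] finU finQ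
          by (metis finite_Un finite_subset sup_ge1)
        then show ?thesis by linarith
      qed
      finally show ?thesis by simp
    qed
    moreover have "U2 \<subseteq> U" using IH(1) by (auto simp: U2_def U1_def)
    ultimately show ?thesis using good covered by blast
  qed
qed

text \<open>Every round starts afresh on all of \<open>V\<close>, with only the vertices not yet
  covered as targets. Their number falls by the factor \<open>b\<close> in each round, so fewer than
  one remains after \<open>\<kappa>\<close> rounds.\<close>

theorem sparse_cover:
  fixes b :: real
  assumes r: "0 \<le> r" and b: "1 \<le> b" and J: "2 * b * ln (card V) < real J"
    and \<kappa>: "real (card V) < b ^ \<kappa>"
  shows "\<exists>ctr. (\<forall>j<\<kappa>. good_clusters ((2 * real J + 1) * r) V (ctr j)) \<and>
     (\<forall>v\<in>V. \<exists>j<\<kappa>. \<exists>x. ball E W V v r \<subseteq> cluster_of (ctr j) x)"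
proof -
  have clV: "closed0 V" using E_sub by (auto simp: closed0_def)
  have "\<exists>ctr U. U \<subseteq> V \<and> b ^ k * card U \<le> card V \<and>
      (\<forall>j<k. good_clusters ((2 * real J + 1) * r) V (ctr j)) \<and>
      (\<forall>v\<in>V - U. \<exists>j<k. \<exists>x. ball E W V v r \<subseteq> cluster_of (ctr j) x)" for k
  proof (induction k)
    case 0
    show ?case by (intro exI[of _ "\<lambda>_ _. None"] exI[of _ V]) auto
  next
    case (Suc k)
    then obtain ctr U where *: "U \<subseteq> V" "b ^ k * card U \<le> card V"
      "\<forall>j<k. good_clusters ((2 * real J + 1) * r) V (ctr j)"
      "\<forall>v\<in>V - U. \<exists>j<k. \<exists>x. ball E W V v r \<subseteq> cluster_of (ctr j) x" by blast
    obtain c U' where **: "U' \<subseteq> U" "b * card U' \<le> card U" "good_clusters ((2 * real J + 1) * r) V c"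
      "\<forall>v\<in>U - U'. \<exists>x. ball E W V v r \<subseteq> cluster_of c x"
      using cover_round[of V U r b J] *(1) clV r b J ball_subset by blast
    have "b ^ Suc k * card U' = b ^ k * (b * card U')" by simp
    also have "\<dots> \<le> b ^ k * card U" using **(2) b by (intro mult_left_mono) auto
    finally have "b ^ Suc k * card U' \<le> card V" using *(2) by simp
    moreover have "\<forall>j<Suc k. good_clusters ((2 * real J + 1) * r) V ((ctr(k := c)) j)"
      using *(3) **(3) by (auto simp: less_Suc_eq)
    moreover have "\<exists>j<Suc k. \<exists>x. ball E W V v r \<subseteq> cluster_of ((ctr(k := c)) j) x" if v: "v \<in> V - U'" for v
    proof (cases "v \<in> U")
      case True
      then show ?thesis using **(4) v by (intro exI[of _ k]) auto
    next
      case False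
      then obtain j where "j < k" "\<exists>x. ball E W V v r \<subseteq> cluster_of (ctr j) x" using *(4) v by blast
      then show ?thesis by (intro exI[of _ j]) auto
    qed
    moreover have "U' \<subseteq> V" using *(1) **(1) by blast
    ultimately show ?case by (intro exI[of _ "ctr(k := c)"] exI[of _ U'] conjI ballI)
  qed
  from this[of \<kappa>] obtain ctr U where *: "U \<subseteq> V" "b ^ \<kappa> * card U \<le> card V"
      "\<forall>j<\<kappa>. good_clusters ((2 * real J + 1) * r) V (ctr j)"
      "\<forall>v\<in>V - U. \<exists>j<\<kappa>. \<exists>x. ball E W V v r \<subseteq> cluster_of (ctr j) x" by blast
  have "card U = 0"
  proof (rule ccontr)
    assume "card U \<noteq> 0"
    then have "b ^ \<kappa> * 1 \<le> b ^ \<kappa> * card U" using b by (intro mult_left_mono) auto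
    then show False using *(2) \<kappa> by linarith
  qed
  then have "U = {}" using *(1) finite_V by (metis card_0_eq finite_subset)
  then show ?thesis using *(3,4) by auto
qed

end

section \<open>Spanning trees\<close>

fun walk_len :: "('a \<times> 'a \<Rightarrow> real) \<Rightarrow> 'a list \<Rightarrow> real" where
  "walk_len W (x # y # xs) = W (x, y) + walk_len W (y # xs)"
| "walk_len W _ = 0"

text \<open>Distinctness bounds the number of vertices on a path by \<open>card V\<close>, which
  limits what edges rounded down to weight \<open>0\<close> can add up to, and leaves finitely many
  paths, so that minima exist.\<close>

definition simple_path :: "('a \<times> 'a) set \<Rightarrow> 'a set \<Rightarrow> 'a \<Rightarrow> 'a \<Rightarrow> 'a list \<Rightarrow> bool" where
  "simple_path E R x y xs \<longleftrightarrow> xs \<noteq> [] \<and> hd xs = x \<and> last xs = y \<and> set xs \<subseteq> R \<and> distinct xs \<and>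
     successively (\<lambda>a b. (a, b) \<in> E) xs"

lemma walk_len_Cons: "xs \<noteq> [] \<Longrightarrow> walk_len W (x # xs) = W (x, hd xs) + walk_len W xs"
  by (cases xs) auto

context sym_weighted
begin

lemma walk_len_nonneg: "successively (\<lambda>a b. (a, b) \<in> E) xs \<Longrightarrow> 0 \<le> walk_len W xs"
proof (induction xs)
  case (Cons x xs)
  then show ?case by (cases xs) (auto intro!: add_nonneg_nonneg W_nonneg)
qed simp

lemma walk_len_suffix:
  "successively (\<lambda>a b. (a, b) \<in> E) (xs @ ys) \<Longrightarrow> walk_len W ys \<le> walk_len W (xs @ ys)"
proof (induction xs)
  case (Cons x xs)
  show ?case
  proof (cases "xs @ ys")
    case Nil
    then show ?thesis by simp
  next
    case (Cons z zs)
    then have "(x, z) \<in> E" "successively (\<lambda>a b. (a, b) \<in> E) (xs @ ys)" using Cons.prems by auto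
    then show ?thesis using Cons.IH Cons W_nonneg[of x z] by auto
  qed
qed simp

lemma reach_simple_path:
  "reach E W R x y l \<Longrightarrow> \<exists>xs. simple_path E R x y xs \<and> walk_len W xs \<le> l"
proof (induction rule: reach.induct)
  case (refl x)
  then show ?case by (intro exI[of _ "[x]"]) (simp add: simple_path_def)
next
  case (step x y z l)
  then obtain xs where xs: "simple_path E R y z xs" "walk_len W xs \<le> l" by blast
  show ?case
  proof (cases "x \<in> set xs")
    case False
    then show ?thesis
      using xs step by (intro exI[of _ "x # xs"]) (auto simp: simple_path_def walk_len_Cons successively_Cons)
  next
    case True
    then obtain as bs where ab: "xs = as @ x # bs" by (meson split_list)
    have "walk_len W (x # bs) \<le> walk_len W xs"
      using walk_len_suffix[of as "x # bs"] xs ab by (simp add: simple_path_def)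
    moreover have "simple_path E R x z (x # bs)"
      using xs ab by (auto simp: simple_path_def successively_append_iff)
    moreover have "0 \<le> W (x, y)" using step W_nonneg by simp
    ultimately show ?thesis using xs by (intro exI[of _ "x # bs"]) auto
  qed
qed

end

lemma walk_len_compare:
  fixes \<tau> :: real
  assumes "\<And>e. e \<in> E \<Longrightarrow> w e \<le> W e + \<tau>" "0 \<le> \<tau>" "successively (\<lambda>a b. (a, b) \<in> E) xs"
  shows "walk_len w xs \<le> walk_len W xs + length xs * \<tau>"
  using assms(3)
proof (induction xs)
  case (Cons x xs)
  show ?case
  proof (cases xs)
    case Nil
    then show ?thesis using assms(2) by simp
  next
    case (Cons y ys)
    then have "walk_len w xs \<le> walk_len W xs + length xs * \<tau>" "w (x, y) \<le> W (x, y) + \<tau>"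
      using Cons.IH Cons.prems assms(1)[of "(x, y)"] by auto
    then show ?thesis using Cons by (simp add: algebra_simps)
  qed
qed simp

locale wgraph = sym_weighted V E w for V :: "'a set" and E and w +
  assumes w_ge1: "(x, y) \<in> E \<Longrightarrow> 1 \<le> w (x, y)"
    and V_ne: "V \<noteq> {}"
    and connected: "x \<in> V \<Longrightarrow> y \<in> V \<Longrightarrow> (x, y) \<in> E\<^sup>*"
begin

text \<open>Cluster radii are known with respect to \<open>W\<close>, where short edges are free,
  but routing pays \<open>w\<close>. With \<open>D\<close> the \<open>w\<close>-length of a shortest
  simple path inside \<open>K\<close> to \<open>C\<close>, and \<open>\<pi>\<close> the next vertex
  on it, the difference is at most \<open>\<tau>\<close> per vertex of a path.\<close>

lemma spanning_forest_to_core: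
  fixes \<tau> \<rho> :: real
  assumes K: "K \<subseteq> V" and \<tau>: "0 \<le> \<tau>"
    and W: "\<And>e. e \<in> E \<Longrightarrow> 0 \<le> W e" "\<And>e. e \<in> E \<Longrightarrow> w e \<le> W e + \<tau>"
      "\<And>x y. (x, y) \<in> E \<Longrightarrow> W (x, y) = W (y, x)"
    and reach: "\<And>y. y \<in> K \<Longrightarrow> \<exists>c\<in>C. \<exists>l\<le>\<rho>. reach E W K y c l"
  shows "\<exists>\<pi> (D :: 'a \<Rightarrow> real). \<forall>y\<in>K. 0 \<le> D y \<and> D y \<le> \<rho> + card V * \<tau> \<and>
    (y \<notin> C \<longrightarrow> \<pi> y \<in> K \<and> (y, \<pi> y) \<in> E \<and> D (\<pi> y) + w (y, \<pi> y) \<le> D y)"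
proof -
  interpret W: sym_weighted V E W
    using W finite_V E_sub E_sym by unfold_locales auto
  define P where "P y = {xs. \<exists>c\<in>C. simple_path E K y c xs}" for y
  define D where "D y = Min (walk_len w ` P y)" for y
  have finK: "finite K" using K finite_V finite_subset by blast
  have "P y \<subseteq> {xs. set xs \<subseteq> K \<and> length xs \<le> card K}" for y
    using finK by (auto simp: P_def simple_path_def) (metis card_mono distinct_card)
  then have finP: "finite (P y)" for y
    using finite_lists_length_le[OF finK] finite_subset by blast
  have len: "length xs \<le> card V" if "xs \<in> P y" for xs y
    using that K card_mono[OF finite_V, of "set xs"] by (auto simp: P_def simple_path_def distinct_card)
  have D_le: "D y \<le> walk_len w xs" if "xs \<in> P y" for xs y
    unfolding D_def by (rule Min_le) (simp_all add: finP that)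
  have ex: "\<exists>xs\<in>P y. walk_len w xs \<le> \<rho> + card V * \<tau>" if y: "y \<in> K" for y
  proof -
    obtain c l where c: "c \<in> C" "l \<le> \<rho>" "reach E W K y c l" using reach[OF y] by blast
    obtain xs where xs: "simple_path E K y c xs" "walk_len W xs \<le> l"
      using W.reach_simple_path[OF c(3)] by blast
    then have xP: "xs \<in> P y" using c by (auto simp: P_def)
    have "walk_len w xs \<le> walk_len W xs + length xs * \<tau>"
      by (rule walk_len_compare[where E = E]) (use W \<tau> xs in \<open>auto simp: simple_path_def\<close>)
    also have "\<dots> \<le> \<rho> + card V * \<tau>"
      using xs c len[OF xP] \<tau> by (intro add_mono mult_right_mono) auto
    finally show ?thesis using xP by blast
  qed
  have attained: "\<exists>xs\<in>P y. walk_len w xs = D y" if y: "y \<in> K" for y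
  proof -
    have "D y \<in> walk_len w ` P y" unfolding D_def using finP ex[OF y] by (intro Min_in) auto
    then show ?thesis by auto
  qed
  define \<pi> where "\<pi> y = (SOME z. z \<in> K \<and> (y, z) \<in> E \<and> D z + w (y, z) \<le> D y)" for y
  have \<pi>_ex: "\<exists>z. z \<in> K \<and> (y, z) \<in> E \<and> D z + w (y, z) \<le> D y" if y: "y \<in> K" "y \<notin> C" for y
  proof -
    obtain xs c where xs: "c \<in> C" "simple_path E K y c xs" "walk_len w xs = D y"
      using attained[OF y(1)] by (auto simp: P_def)
    obtain z zs where xz: "xs = y # z # zs"
    proof (cases xs rule: remdups_adj.cases)
      case 1
      then show ?thesis using xs by (simp add: simple_path_def)
    next
      case (2 x)
      then show ?thesis using xs y by (auto simp: simple_path_def)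
    next
      case (3 x z zs)
      then show ?thesis using xs that by (auto simp: simple_path_def)
    qed
    have "z # zs \<in> P z" using xs xz by (auto simp: P_def simple_path_def)
    then have "D z \<le> walk_len w (z # zs)" by (rule D_le)
    then show ?thesis using xs xz by (intro exI[of _ z]) (auto simp: simple_path_def)
  qed
  have \<pi>: "\<pi> y \<in> K \<and> (y, \<pi> y) \<in> E \<and> D (\<pi> y) + w (y, \<pi> y) \<le> D y" if "y \<in> K" "y \<notin> C" for y
    unfolding \<pi>_def using someI_ex[OF \<pi>_ex[OF that]] .
  have "0 \<le> D y" if y: "y \<in> K" for y
    using attained[OF y] walk_len_nonneg by (auto simp: P_def simple_path_def) metis
  moreover have "D y \<le> \<rho> + card V * \<tau>" if y: "y \<in> K" for y
    using ex[OF y] D_le by (meson order_trans)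
  ultimately show ?thesis using \<pi> by blast
qed

section \<open>Components of short edges and a spanning tree that respects them\<close>

definition near :: "real \<Rightarrow> ('a \<times> 'a) set" where
  "near \<tau> = {e \<in> E. w e < \<tau>}\<^sup>*"

definition comp :: "real \<Rightarrow> 'a \<Rightarrow> 'a set" where
  "comp \<tau> x = near \<tau> `` {x}"

lemma near_sym: "(x, y) \<in> near \<tau> \<Longrightarrow> (y, x) \<in> near \<tau>"
proof -
  have "sym {e \<in> E. w e < \<tau>}"
    using E_sym W_sym by (auto intro!: symI)
  then show "(x, y) \<in> near \<tau> \<Longrightarrow> (y, x) \<in> near \<tau>"
    unfolding near_def by (meson sym_rtrancl symD)
qed

lemma near_trans: "(x, y) \<in> near \<tau> \<Longrightarrow> (y, z) \<in> near \<tau> \<Longrightarrow> (x, z) \<in> near \<tau>"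
  unfolding near_def by (rule rtrancl_trans)

lemma near_refl: "(x, x) \<in> near \<tau>" by (simp add: near_def)

lemma near_edge: "(x, y) \<in> E \<Longrightarrow> w (x, y) < \<tau> \<Longrightarrow> (x, y) \<in> near \<tau>"
  unfolding near_def by (rule r_into_rtrancl) simp

lemma near_mono: "\<tau> \<le> \<tau>' \<Longrightarrow> near \<tau> \<subseteq> near \<tau>'"
  unfolding near_def by (intro rtrancl_mono) auto

lemma near_V: "(x, y) \<in> near \<tau> \<Longrightarrow> x \<in> V \<Longrightarrow> y \<in> V"
  unfolding near_def by (induction rule: rtrancl_induct) (use E_sub in auto)

lemma crossing:
  "(x, y) \<in> Q\<^sup>* \<Longrightarrow> x \<in> S \<Longrightarrow> y \<notin> S \<Longrightarrow> \<exists>a b. (a, b) \<in> Q \<and> a \<in> S \<and> b \<notin> S"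
  by (induction rule: rtrancl_induct) auto

text \<open>A vertex at which the tree path to the root leaves a component of
  \<open>near\<close>.\<close>

definition is_top :: "'a \<Rightarrow> ('a \<Rightarrow> 'a) \<Rightarrow> real \<Rightarrow> 'a \<Rightarrow> bool" where
  "is_top rr par \<tau> v \<longleftrightarrow> v = rr \<or> (v, par v) \<notin> near \<tau>"

text \<open>Prim's minimum spanning tree, grown as far as \<open>S\<close>. Minimality enters
  through the last two clauses, for all \<open>\<tau>\<close> at once: tree edges inside a component
  are short, and no component has two tops, so that its part in \<open>S\<close> is connected in the
  tree.\<close>

definition prim_tree :: "'a set \<Rightarrow> 'a \<Rightarrow> ('a \<Rightarrow> 'a) \<Rightarrow> ('a \<Rightarrow> nat) \<Rightarrow> bool" where
  "prim_tree S rr par dep \<longleftrightarrow> rr \<in> S \<and> S \<subseteq> V \<and> par rr = rr \<and>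
     (\<forall>v\<in>S. dep v < card S) \<and>
     (\<forall>v\<in>S. v \<noteq> rr \<longrightarrow> par v \<in> S \<and> (v, par v) \<in> E \<and> dep (par v) < dep v) \<and>
     (\<forall>\<tau>. \<forall>v\<in>S. v \<noteq> rr \<longrightarrow> (v, par v) \<in> near \<tau> \<longrightarrow> w (v, par v) < \<tau>) \<and>
     (\<forall>\<tau>. \<forall>v\<in>S. \<forall>v'\<in>S. (v, v') \<in> near \<tau> \<longrightarrow> is_top rr par \<tau> v \<longrightarrow> is_top rr par \<tau> v' \<longrightarrow> v = v')"

text \<open>The new vertex \<open>x\<close> is attached by a lightest edge leaving \<open>S\<close>.
  If \<open>x\<close> is near to some vertex of \<open>S\<close>, a walk of short edges between them
  crosses the border of \<open>S\<close>, so the lightest edge is short as well and \<open>x\<close>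
  is not a top. A new top thus arises only in a component that \<open>S\<close> has not met.\<close>

lemma prim_step:
  assumes S: "prim_tree S rr par dep" and ne: "S \<noteq> V"
  shows "\<exists>x par dep. x \<in> V - S \<and> prim_tree (insert x S) rr par dep"
proof -
  have SV: "S \<subseteq> V" "rr \<in> S" using S by (auto simp: prim_tree_def)
  have finS: "finite S" using SV finite_V finite_subset by blast
  define X where "X = {e \<in> E. fst e \<in> S \<and> snd e \<notin> S}"
  have finX: "finite X"
    using finite_subset[OF E_sub] finite_V by (auto simp: X_def)
  obtain z where "z \<in> V - S" using SV ne by blast
  then have "X \<noteq> {}" using crossing[OF connected[of rr z], of S] SV by (auto simp: X_def)
  then have "Min (w ` X) \<in> w ` X" using finX by (intro Min_in) auto
  then obtain e where "e \<in> X" "Min (w ` X) = w e" by auto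
  then obtain s x where sx: "(s, x) \<in> X" "Min (w ` X) = w (s, x)" by (cases e) auto
  have min: "w (s, x) \<le> w e" if "e \<in> X" for e using that finX sx(2) by (metis Min_le finite_imageI imageI)
  have s: "s \<in> S" "x \<notin> S" "(s, x) \<in> E" using sx by (auto simp: X_def)
  have x: "x \<in> V" using s E_sub by auto
  have xs: "(x, s) \<in> E" "w (x, s) = w (s, x)" using s E_sym W_sym by auto
  have near_x: "w (x, s) < \<tau> \<and> (x, s) \<in> near \<tau>" if "v \<in> S" "(v, x) \<in> near \<tau>" for v \<tau>
  proof -
    have "(v, x) \<in> {e \<in> E. w e < \<tau>}\<^sup>*" using that by (simp add: near_def)
    from crossing[OF this that(1) s(2)]
    obtain a b where "(a, b) \<in> {e \<in> E. w e < \<tau>}" "a \<in> S" "b \<notin> S" by blast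
    then have "w (x, s) < \<tau>" using min[of "(a, b)"] xs by (auto simp: X_def)
    then show ?thesis using near_edge[OF xs(1)] by simp
  qed
  define par' where "par' = par(x := s)"
  define dep' where "dep' = dep(x := card S)"
  have rr: "rr \<noteq> x" using SV s by auto
  have top_S: "is_top rr par' \<tau> v \<longleftrightarrow> is_top rr par \<tau> v" if "v \<in> S" for v \<tau>
    using that s by (auto simp: is_top_def par'_def)
  have top_x: "\<not> is_top rr par' \<tau> x" if "v \<in> S" "(v, x) \<in> near \<tau>" for v \<tau>
    using near_x[OF that] rr by (auto simp: is_top_def par'_def)
  have "prim_tree (insert x S) rr par' dep'"
    unfolding prim_tree_def
  proof (intro conjI)
    show "rr \<in> insert x S" "insert x S \<subseteq> V" "par' rr = rr"
      using S x rr by (auto simp: prim_tree_def par'_def)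
    show "\<forall>v\<in>insert x S. dep' v < card (insert x S)"
      using S s finS by (auto simp: prim_tree_def dep'_def less_Suc_eq)
    show "\<forall>v\<in>insert x S. v \<noteq> rr \<longrightarrow> par' v \<in> insert x S \<and> (v, par' v) \<in> E \<and> dep' (par' v) < dep' v"
    proof (intro ballI impI)
      fix v assume v: "v \<in> insert x S" "v \<noteq> rr"
      show "par' v \<in> insert x S \<and> (v, par' v) \<in> E \<and> dep' (par' v) < dep' v"
      proof (cases "v = x")
        case True
        then show ?thesis using s xs S by (auto simp: par'_def dep'_def prim_tree_def)
      next
        case False
        then have "v \<in> S" "par v \<in> S" using v S by (auto simp: prim_tree_def)
        then show ?thesis using s v S False by (auto simp: par'_def dep'_def prim_tree_def)
      qed
    qed
    show "\<forall>\<tau>. \<forall>v\<in>insert x S. v \<noteq> rr \<longrightarrow> (v, par' v) \<in> near \<tau> \<longrightarrow> w (v, par' v) < \<tau>"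
    proof (intro allI ballI impI)
      fix \<tau> v assume v: "v \<in> insert x S" "v \<noteq> rr" "(v, par' v) \<in> near \<tau>"
      show "w (v, par' v) < \<tau>"
      proof (cases "v = x")
        case True
        then have "(s, x) \<in> near \<tau>" using v near_sym by (simp add: par'_def)
        then show ?thesis using near_x[OF s(1)] True by (simp add: par'_def)
      next
        case False
        then show ?thesis using v S by (simp add: par'_def prim_tree_def)
      qed
    qed
    show "\<forall>\<tau>. \<forall>v\<in>insert x S. \<forall>v'\<in>insert x S. (v, v') \<in> near \<tau> \<longrightarrow>
        is_top rr par' \<tau> v \<longrightarrow> is_top rr par' \<tau> v' \<longrightarrow> v = v'"
    proof (intro allI ballI impI)
      fix \<tau> v v' assume v: "v \<in> insert x S" "v' \<in> insert x S" "(v, v') \<in> near \<tau>"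
        "is_top rr par' \<tau> v" "is_top rr par' \<tau> v'"
      show "v = v'"
      proof (cases "v = x \<or> v' = x")
        case True
        then show ?thesis using v top_x near_sym by (metis insertE)
      next
        case False
        then have "v \<in> S" "v' \<in> S" using v by auto
        then show ?thesis using v S top_S unfolding prim_tree_def by blast
      qed
    qed
  qed
  then show ?thesis using x s by blast
qed

lemma prim_tree_exists: "\<exists>rr par dep. prim_tree V rr par dep"
proof -
  obtain r where r: "r \<in> V" using V_ne by blast
  have ex: "\<exists>S par dep. card S = Suc m \<and> prim_tree S r par dep" if "m < card V" for m
    using that
  proof (induction m)
    case 0
    have "prim_tree {r} r (\<lambda>v. v) (\<lambda>_. 0)" using r by (simp add: prim_tree_def)
    then show ?case by (intro exI[of _ "{r}"]) auto
  next
    case (Suc m)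
    then obtain S par dep where S: "card S = Suc m" "prim_tree S r par dep" by auto
    then have "S \<noteq> V" using Suc by auto
    then obtain x par dep where x: "x \<in> V - S" "prim_tree (insert x S) r par dep"
      using prim_step[OF S(2)] by blast
    have "finite S" using S finite_V finite_subset by (auto simp: prim_tree_def)
    then have "card (insert x S) = Suc (Suc m)" using S x by simp
    then show ?case using x by blast
  qed
  have "0 < card V" using V_ne finite_V by (simp add: card_gt_0_iff)
  then obtain S par dep where S: "card S = card V" "prim_tree S r par dep"
    using ex[of "card V - 1"] by auto
  then have "S = V" using finite_V by (intro card_subset_eq) (auto simp: prim_tree_def)
  then show ?thesis using S by blast
qed

end

locale prim = wgraph +
  fixes rr :: 'a and par :: "'a \<Rightarrow> 'a" and dep :: "'a \<Rightarrow> nat"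
  assumes prim: "prim_tree V rr par dep"
begin

lemma root_V: "rr \<in> V" and par_root: "par rr = rr"
  and dep_less: "v \<in> V \<Longrightarrow> dep v < card V"
  and par_props: "v \<in> V \<Longrightarrow> v \<noteq> rr \<Longrightarrow> par v \<in> V \<and> (v, par v) \<in> E \<and> dep (par v) < dep v"
  and par_near: "v \<in> V \<Longrightarrow> v \<noteq> rr \<Longrightarrow> (v, par v) \<in> near \<tau> \<Longrightarrow> w (v, par v) < \<tau>"
  and top_unique: "v \<in> V \<Longrightarrow> v' \<in> V \<Longrightarrow> (v, v') \<in> near \<tau> \<Longrightarrow> is_top rr par \<tau> v \<Longrightarrow>
    is_top rr par \<tau> v' \<Longrightarrow> v = v'"
  using prim unfolding prim_tree_def by blast+

sublocale M: forest V par dep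
proof
  show "finite V" by (rule finite_V)
  show "u \<in> V \<Longrightarrow> par u \<in> V" for u using par_props[of u] par_root root_V by metis
  show "u \<in> V \<Longrightarrow> par u \<noteq> u \<Longrightarrow> dep (par u) < dep u" for u using par_props[of u] par_root by metis
qed

lemma par_eq_iff: "v \<in> V \<Longrightarrow> par v = v \<longleftrightarrow> v = rr"
  using par_props[of v] par_root by (metis less_irrefl)

lemma M_rt: "v \<in> V \<Longrightarrow> M.rt v = rr"
  using M.rt[of v] par_eq_iff M.rt_in by blast

lemma top_exists:
  assumes "v \<in> V" shows "\<exists>g. g \<in> M.an v \<and> (v, g) \<in> near \<tau> \<and> is_top rr par \<tau> g"
  using assms
proof (induction rule: M.forest_induct)
  case (root v)
  then show ?case using par_eq_iff near_refl by (intro exI[of _ v]) (auto simp: is_top_def)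
next
  case (child v)
  show ?case
  proof (cases "is_top rr par \<tau> v")
    case True
    then show ?thesis using near_refl by (intro exI[of _ v]) auto
  next
    case False
    then have "(v, par v) \<in> near \<tau>" by (simp add: is_top_def)
    then show ?thesis using child near_trans ancs_parent by metis
  qed
qed

text \<open>If the tree path left the component, the component would have a second top. This is what
  lets a single tree serve the cores of all scales.\<close>

lemma near_next_hop:
  assumes u: "u \<in> V" and y: "y \<in> V" and n: "(u, y) \<in> near \<tau>" and ne: "u \<noteq> y"
  defines "x \<equiv> next_hop V par u y"
  shows "(u, x) \<in> near \<tau> \<and> (u, x) \<in> E \<and> w (u, x) < \<tau>"
proof (cases "y \<in> M.de u")
  case False
  then have x: "x = par u" by (simp add: x_def M.next_hop_parent)
  have "\<not> is_top rr par \<tau> u"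
  proof
    assume top: "is_top rr par \<tau> u"
    obtain g where g: "g \<in> M.an y" "(y, g) \<in> near \<tau>" "is_top rr par \<tau> g" using top_exists[OF y] by blast
    have "g = u"
    proof (rule top_unique[OF _ u _ g(3) top])
      show "g \<in> V" using g M.an_subset y by blast
      show "(g, u) \<in> near \<tau>" using g n near_sym near_trans by blast
    qed
    then show False using g False y by (simp add: desc_def)
  qed
  then show ?thesis using x par_near[OF u] par_props[OF u] by (auto simp: is_top_def)
next
  case True
  have x: "x \<in> M.ch u" "y \<in> M.de x" using M.next_hop_child[OF True] ne by (auto simp: x_def)
  have xu: "par x = u" "x \<in> V" "x \<noteq> rr" using x par_root by (auto simp: children_def)
  have "x \<in> M.an y \<Longrightarrow> (u, y) \<in> near \<tau> \<Longrightarrow> (u, x) \<in> near \<tau>"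
    using y
  proof (induction rule: M.forest_induct)
    case (root y)
    then show ?case by (simp add: ancs_root)
  next
    case (child y)
    show ?case
    proof (cases "x = y")
      case True
      then show ?thesis using child by simp
    next
      case False
      then have xy: "x \<in> M.an (par y)" using child ancs_step[of par y] by auto
      show ?thesis
      proof (cases "is_top rr par \<tau> y")
        case True
        \<comment> \<open>The top \<open>y\<close> would be the top reached from \<open>u\<close> as
          well, hence an ancestor of \<open>u\<close> and of \<open>x\<close>; but \<open>x\<close>
          lies strictly above \<open>y\<close>.\<close>
        obtain g where g: "g \<in> M.an u" "(u, g) \<in> near \<tau>" "is_top rr par \<tau> g" using top_exists[OF u] by blast
        have "g = y"
        proof (rule top_unique[OF _ child.hyps(1) _ g(3) True])
          show "g \<in> V" using g M.an_subset u by blast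
          show "(g, y) \<in> near \<tau>" using g child.prems near_sym near_trans by blast
        qed
        moreover have "u \<in> M.an x" using xu ancs_parent_of[of x par x] by simp
        ultimately have "y \<in> M.an x" using g ancs_trans by metis
        then show ?thesis using M.an_antisym[OF child.hyps(1), of x] child.prems False by simp
      next
        case False
        then have "(u, par y) \<in> near \<tau>" using child.prems near_trans by (auto simp: is_top_def)
        then show ?thesis using child.IH xy by simp
      qed
    qed
  qed
  then have ux: "(u, x) \<in> near \<tau>" using x n by (simp add: desc_def)
  then have "(x, par x) \<in> near \<tau>" using xu near_sym by simp
  then have "w (x, u) < \<tau>" "(x, u) \<in> E" using par_near[OF xu(2,3)] par_props[OF xu(2,3)] xu by auto
  then show ?thesis using ux E_sym[of x u] W_sym[of x u] by auto
qed

end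

section \<open>Routing in clusters\<close>

lemma (in forest) desc_mono:
  fixes D :: "'a \<Rightarrow> real"
  assumes mono: "\<And>u. u \<in> A \<Longrightarrow> f u \<noteq> u \<Longrightarrow> D (f u) \<le> D u" and v: "v \<in> de u"
  shows "D u \<le> D v"
proof -
  have "v \<in> A" "u \<in> an v" using v by (auto simp: desc_def)
  then show ?thesis
  proof (induction rule: forest_induct)
    case (root v)
    then show ?case by (simp add: ancs_root)
  next
    case (child v)
    then show ?case using ancs_step[of f v] mono[of v] by fastforce
  qed
qed

text \<open>A slot is a family of disjoint clusters with cores. \<open>attach\<close> describes
  trees hanging from the cores, with \<open>D\<close> bounding the way to the core;
  \<open>core_step\<close> says that the global tree connects a core within itself by edges of
  weight at most \<open>\<tau> s\<close>, which is vacuous for a core of one vertex.\<close>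

locale slot_clusters = prim V E w rr par dep
  for V :: "'a set" and E w rr par dep +
  fixes S :: nat and cl :: "nat \<Rightarrow> 'a \<Rightarrow> 'a option" and core :: "nat \<Rightarrow> 'a \<Rightarrow> bool"
    and \<pi> :: "nat \<Rightarrow> 'a \<Rightarrow> 'a" and D :: "nat \<Rightarrow> 'a \<Rightarrow> real" and \<tau> \<rho> :: "nat \<Rightarrow> real"
  assumes cl_V: "s < S \<Longrightarrow> u \<in> V \<Longrightarrow> cl s u = Some x \<Longrightarrow> x \<in> V"
    and attach: "s < S \<Longrightarrow> u \<in> V \<Longrightarrow> cl s u = Some x \<Longrightarrow> \<not> core s u \<Longrightarrow>
      \<pi> s u \<in> V \<and> cl s (\<pi> s u) = Some x \<and> (u, \<pi> s u) \<in> E \<and> D s (\<pi> s u) + w (u, \<pi> s u) \<le> D s u"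
    and D_bounds: "s < S \<Longrightarrow> u \<in> V \<Longrightarrow> cl s u = Some x \<Longrightarrow> 0 \<le> D s u \<and> D s u \<le> \<rho> s"
    and \<tau>_nonneg: "0 \<le> \<tau> s"
    and core_step: "s < S \<Longrightarrow> u \<in> V \<Longrightarrow> v \<in> V \<Longrightarrow> cl s u = Some x \<Longrightarrow> cl s v = Some x \<Longrightarrow>
      core s u \<Longrightarrow> core s v \<Longrightarrow> u \<noteq> v \<Longrightarrow>
      core s (next_hop V par u v) \<and> cl s (next_hop V par u v) = Some x \<and>
      (u, next_hop V par u v) \<in> E \<and> w (u, next_hop V par u v) \<le> \<tau> s"
begin

definition hang :: "nat \<Rightarrow> 'a set" where
  "hang s = {u \<in> V. s < S \<and> cl s u \<noteq> None \<and> \<not> core s u}"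

text \<open>The trees are cut where they reach the core, and a vertex attached directly to the core
  becomes a root. Core vertices stay out of these forests: the number of forests through a vertex
  enters the port bound, and a vertex may be in a core at arbitrarily many scales.\<close>

definition fp :: "nat \<Rightarrow> 'a \<Rightarrow> 'a" where
  "fp s u = (if core s (\<pi> s u) then u else \<pi> s u)"

definition dp :: "nat \<Rightarrow> 'a \<Rightarrow> nat" where
  "dp s u = nat \<lfloor>D s u\<rfloor>"

lemma hangD: "u \<in> hang s \<Longrightarrow> s < S \<and> u \<in> V \<and> (\<exists>x. cl s u = Some x) \<and> \<not> core s u"
  by (auto simp: hang_def)

lemma hang_parent:
  assumes "u \<in> hang s"
  shows "\<pi> s u \<in> V" "cl s (\<pi> s u) = cl s u" "(u, \<pi> s u) \<in> E" "D s (\<pi> s u) + w (u, \<pi> s u) \<le> D s u"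
    "0 \<le> D s (\<pi> s u)" "u \<noteq> \<pi> s u" "\<not> core s (\<pi> s u) \<Longrightarrow> \<pi> s u \<in> hang s"
proof -
  obtain x where x: "s < S" "u \<in> V" "cl s u = Some x" "\<not> core s u" using hangD[OF assms] by blast
  note * = attach[OF x]
  show "\<pi> s u \<in> V" "cl s (\<pi> s u) = cl s u" "(u, \<pi> s u) \<in> E" "D s (\<pi> s u) + w (u, \<pi> s u) \<le> D s u"
    using * x by auto
  show "0 \<le> D s (\<pi> s u)" using D_bounds[of s "\<pi> s u" x] * x by auto
  show "u \<noteq> \<pi> s u" using * w_ge1[of u "\<pi> s u"] by auto
  show "\<not> core s (\<pi> s u) \<Longrightarrow> \<pi> s u \<in> hang s" using * x by (auto simp: hang_def)
qed

lemma forest_hang: "forest (hang s) (fp s) (dp s)"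
proof
  show "finite (hang s)" using finite_V by (simp add: hang_def)
  show "u \<in> hang s \<Longrightarrow> fp s u \<in> hang s" for u using hang_parent(7)[of u s] by (auto simp: fp_def)
  fix u assume u: "u \<in> hang s" "fp s u \<noteq> u"
  then have "fp s u = \<pi> s u" by (auto simp: fp_def split: if_splits)
  moreover have "D s (\<pi> s u) + 1 \<le> D s u" "0 \<le> D s (\<pi> s u)"
    using hang_parent[OF u(1)] w_ge1[of u "\<pi> s u"] by auto
  ultimately show "dp s (fp s u) < dp s u" unfolding dp_def by (simp add: nat_less_eq_zless) linarith
qed

interpretation F: forest "hang s" "fp s" "dp s" for s by (rule forest_hang)

lemma fp_cl: "u \<in> hang s \<Longrightarrow> cl s (fp s u) = cl s u"
  using hang_parent(2)[of u s] by (simp add: fp_def)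

lemma rt_cl: "u \<in> hang s \<Longrightarrow> cl s (top_of (fp s) u) = cl s u"
proof (induction rule: F.forest_induct)
  case (root v)
  then show ?case using F.rt_root by metis
next
  case (child v)
  then show ?case using F.rt_parent[of v s] fp_cl[of v s] by simp
qed

lemma rt_core: "u \<in> hang s \<Longrightarrow> core s (\<pi> s (top_of (fp s) u))"
  using F.rt(2)[of u s] hang_parent(6)[OF F.rt_in[of u s]] by (auto simp: fp_def split: if_splits)

definition exit :: "nat \<Rightarrow> 'a \<Rightarrow> 'a" where
  "exit s v = (if core s v then v else \<pi> s (top_of (fp s) v))"

lemma exit_props:
  assumes "s < S" "v \<in> V" "cl s v = Some x"
  shows "exit s v \<in> V" "core s (exit s v)" "cl s (exit s v) = Some x"
proof -
  have "exit s v \<in> V \<and> core s (exit s v) \<and> cl s (exit s v) = Some x"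
  proof (cases "core s v")
    case False
    then have v: "v \<in> hang s" using assms by (simp add: hang_def)
    show ?thesis
      using rt_core[OF v] rt_cl[OF v] hang_parent[OF F.rt_in[OF v]] False assms by (simp add: exit_def)
  qed (use assms in \<open>simp add: exit_def\<close>)
  then show "exit s v \<in> V" "core s (exit s v)" "cl s (exit s v) = Some x" by auto
qed

definition cnh :: "nat \<Rightarrow> 'a \<Rightarrow> 'a \<Rightarrow> 'a" where
  "cnh s u v = (if core s u then
       if u = exit s v then top_of (fp s) v else next_hop V par u (exit s v)
     else if v \<in> desc (hang s) (fp s) u then next_hop (hang s) (fp s) u v else \<pi> s u)"

text \<open>A bound on the remaining length. Inside the core, \<open>dep\<close> changes by at least
  one along every tree edge, so \<open>pot\<close> of \<open>dep\<close> bounds the number of edges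
  still to be crossed, each of weight at most \<open>\<tau> s\<close>; it never exceeds
  \<open>2 * card V\<close>. Outside, a message that has to climb reserves a whole crossing of the
  core in advance.\<close>

definition \<Phi> :: "nat \<Rightarrow> 'a \<Rightarrow> 'a \<Rightarrow> real" where
  "\<Phi> s u v = (if core s u then \<tau> s * M.pot (\<lambda>u. real (dep u)) u (exit s v) + D s v
     else if v \<in> desc (hang s) (fp s) u then D s v - D s u
     else D s u + 2 * card V * \<tau> s + D s v)"

lemma M_pot_bounds: "u \<in> V \<Longrightarrow> v \<in> V \<Longrightarrow>
    0 \<le> M.pot (\<lambda>u. real (dep u)) u v \<and> M.pot (\<lambda>u. real (dep u)) u v \<le> 2 * card V"
proof -
  assume uv: "u \<in> V" "v \<in> V"
  have "v \<in> M.de u \<Longrightarrow> real (dep u) \<le> real (dep v)"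
    using M.desc_mono[of "\<lambda>u. real (dep u)" v u] M.dep_parent by (meson less_imp_le of_nat_mono)
  then show ?thesis using dep_less[OF uv(1)] dep_less[OF uv(2)] by (auto simp: M.pot_def)
qed

lemma core_\<Phi>_le:
  assumes "s < S" "u \<in> V" "v \<in> V" "cl s u = Some x" "cl s v = Some x" "core s u"
  shows "\<Phi> s u v \<le> 2 * card V * \<tau> s + D s v"
proof -
  have "\<tau> s * M.pot (\<lambda>u. real (dep u)) u (exit s v) \<le> \<tau> s * (2 * card V)"
    using M_pot_bounds[OF assms(2) exit_props(1)[OF assms(1,3,5)]] \<tau>_nonneg by (intro mult_left_mono) auto
  then show ?thesis using assms by (simp add: \<Phi>_def mult_ac)
qed

lemma \<Phi>_bounds:
  assumes "s < S" "u \<in> V" "v \<in> V" "cl s u = Some x" "cl s v = Some x"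
  shows "0 \<le> \<Phi> s u v" "\<Phi> s u v \<le> 2 * \<rho> s + 2 * card V * \<tau> s"
proof -
  have D: "0 \<le> D s u" "D s u \<le> \<rho> s" "0 \<le> D s v" "D s v \<le> \<rho> s"
    using D_bounds assms by auto
  have M: "0 \<le> \<tau> s * M.pot (\<lambda>u. real (dep u)) u (exit s v)"
    using M_pot_bounds[OF assms(2) exit_props(1)[OF assms(1,3,5)]] \<tau>_nonneg by simp
  have mono: "v \<in> F.de s u \<Longrightarrow> D s u \<le> D s v"
  proof (rule F.desc_mono)
    fix u assume "u \<in> hang s" "fp s u \<noteq> u"
    then show "D s (fp s u) \<le> D s u"
      using hang_parent[of u s] w_ge1[of u "\<pi> s u"] by (auto simp: fp_def)
  qed
  show "0 \<le> \<Phi> s u v" using D M mono \<tau>_nonneg[of s] by (auto simp: \<Phi>_def)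
  show "\<Phi> s u v \<le> 2 * \<rho> s + 2 * card V * \<tau> s"
  proof (cases "core s u")
    case True
    then show ?thesis using core_\<Phi>_le[OF assms True] D by linarith
  next
    case False
    have nn: "0 \<le> 2 * card V * \<tau> s" using \<tau>_nonneg by simp
    have "\<Phi> s u v \<le> D s u + 2 * card V * \<tau> s + D s v"
    proof (cases "v \<in> F.de s u")
      case True
      then have "\<Phi> s u v = D s v - D s u" using False by (simp add: \<Phi>_def)
      then show ?thesis using D nn by linarith
    next
      case nd: False
      then show ?thesis using False by (simp add: \<Phi>_def)
    qed
    then show ?thesis using D by linarith
  qed
qed

lemma cnh_step:
  assumes s: "s < S" and u: "u \<in> V" and v: "v \<in> V" and cl: "cl s u = Some x" "cl s v = Some x"
    and ne: "u \<noteq> v"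
  defines "y \<equiv> cnh s u v"
  shows "(u, y) \<in> E" "cl s y = Some x" "w (u, y) + \<Phi> s y v \<le> \<Phi> s u v"
proof -
  have D: "0 \<le> D s u" "0 \<le> D s v" using D_bounds s u v cl by auto
  note ex = exit_props[OF s v cl(2)]
  have "(u, y) \<in> E \<and> cl s y = Some x \<and> w (u, y) + \<Phi> s y v \<le> \<Phi> s u v"
  proof (cases "core s u")
    case True
    show ?thesis
    proof (cases "u = exit s v")
      case eq: True
      then have nc: "\<not> core s v" using ne by (auto simp: exit_def)
      then have vh: "v \<in> hang s" using s v cl by (simp add: hang_def)
      define r where "r = top_of (fp s) v"
      have r: "r \<in> hang s" using F.rt_in[OF vh] by (simp add: r_def)
      have y: "y = r" using True eq by (simp add: y_def cnh_def r_def)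
      have ur: "u = \<pi> s r" using eq nc by (simp add: exit_def r_def)
      have "v \<in> F.de s r" using F.de_root[OF vh] by (simp add: r_def)
      then have "\<Phi> s r v = D s v - D s r" using hangD[OF r] by (simp add: \<Phi>_def)
      moreover have "\<Phi> s u v = D s v"
        using True eq M.de_self[OF u] by (simp add: \<Phi>_def M.pot_def)
      \<comment> \<open>The edge from the core to the root \<open>r\<close> is paid by
        \<open>D s r\<close>, because \<open>D s u\<close> is nonnegative.\<close>
      moreover have "w (u, r) \<le> D s r" "(u, r) \<in> E"
        using hang_parent[OF r] ur E_sym W_sym by (metis add_increasing order_refl order_trans)+
      ultimately show ?thesis using y rt_cl[OF vh] cl r_def by simp
    next
      case False
      then have y: "y = next_hop V par u (exit s v)" using True by (simp add: y_def cnh_def)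
      have step: "core s y \<and> cl s y = Some x \<and> (u, y) \<in> E \<and> w (u, y) \<le> \<tau> s"
        unfolding y by (rule core_step[OF s u ex(1) cl(1) ex(3) True ex(2) False])
      let ?d = "\<lambda>u. real (dep u)"
      have "1 + M.pot ?d y (exit s v) \<le> M.pot ?d u (exit s v)"
      proof (cases "exit s v \<in> M.de u")
        case d: True
        have "y \<in> M.ch u" using M.next_hop_child[OF d] False y by simp
        then have "dep u < dep y" using M.dep_parent[of y] M.ch_parent[of y u] by auto
        then show ?thesis unfolding y by (intro M.pot_child) (use d False y in auto)
      next
        case d: False
        then have yp: "y = par u" using y by (simp add: M.next_hop_parent)
        have "par u \<noteq> u" using M.not_desc_not_root[OF u ex(1) _ d] M_rt u ex by simp
        then have "dep (par u) < dep u" using M.dep_parent[OF u] by simp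
        then show ?thesis unfolding yp by (intro M.pot_parent) (use d in auto)
      qed
      then have "\<tau> s * (1 + M.pot ?d y (exit s v)) \<le> \<tau> s * M.pot ?d u (exit s v)"
        using \<tau>_nonneg by (intro mult_left_mono) auto
      then show ?thesis using step True by (simp add: \<Phi>_def distrib_left)
    qed
  next
    case False
    then have uh: "u \<in> hang s" using s u cl by (simp add: hang_def)
    note par = hang_parent[OF uh]
    show ?thesis
    proof (cases "v \<in> F.de s u")
      case True
      then have y: "y = next_hop (hang s) (fp s) u v" using False by (simp add: y_def cnh_def)
      have yc: "y \<in> F.ch s u" "v \<in> F.de s y" using F.next_hop_child[OF True] ne y by auto
      then have yu: "y \<in> hang s" "fp s y = u" "y \<noteq> u" by (auto simp: children_def)
      then have \<pi>y: "\<pi> s y = u" by (auto simp: fp_def split: if_splits)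
      have yE: "(u, y) \<in> E" "w (u, y) = w (y, u)" "D s u + w (u, y) \<le> D s y" "cl s y = cl s u"
        using hang_parent[OF yu(1)] \<pi>y E_sym[of y u] W_sym[of y u] by auto
      have "\<Phi> s y v = D s v - D s y" using yc hangD[OF yu(1)] by (simp add: \<Phi>_def)
      moreover have "\<Phi> s u v = D s v - D s u" using True False by (simp add: \<Phi>_def)
      ultimately show ?thesis using yE cl by simp
    next
      case nd: False
      then have y: "y = \<pi> s u" using False by (simp add: y_def cnh_def)
      have \<Phi>u: "\<Phi> s u v = D s u + 2 * card V * \<tau> s + D s v" using False nd by (simp add: \<Phi>_def)
      have ycl: "cl s y = Some x" "y \<in> V" using par y cl by auto
      have nn: "0 \<le> 2 * card V * \<tau> s" using \<tau>_nonneg by simp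
      have "\<Phi> s y v \<le> D s y + 2 * card V * \<tau> s + D s v"
      proof (cases "core s y")
        case True
        then show ?thesis using core_\<Phi>_le[OF s ycl(2) v ycl(1) cl(2)] par y by simp
      next
        case False
        then show ?thesis using nn par y by (simp add: \<Phi>_def)
      qed
      then show ?thesis using \<Phi>u par y ycl by simp
    qed
  qed
  then show "(u, y) \<in> E" "cl s y = Some x" "w (u, y) + \<Phi> s y v \<le> \<Phi> s u v" by auto
qed

end

section \<open>Choosing the level\<close>

locale leveled_clusters = slot_clusters +
  fixes m :: nat and slot :: "nat \<Rightarrow> 'a \<Rightarrow> nat" and \<Lambda> :: "nat \<Rightarrow> real"
  assumes slot_less: "i \<le> m \<Longrightarrow> v \<in> V \<Longrightarrow> slot i v < S"
    and slot_cl: "i \<le> m \<Longrightarrow> v \<in> V \<Longrightarrow> cl (slot i v) v \<noteq> None"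
    and top_slot: "u \<in> V \<Longrightarrow> v \<in> V \<Longrightarrow> cl (slot m v) u = cl (slot m v) v"
    and \<Lambda>_ge: "i \<le> m \<Longrightarrow> v \<in> V \<Longrightarrow> 2 * \<rho> (slot i v) + 2 * card V * \<tau> (slot i v) \<le> \<Lambda> i"
begin

definition lev :: "'a \<Rightarrow> 'a \<Rightarrow> nat" where
  "lev u v = (LEAST i. cl (slot i v) u = cl (slot i v) v)"

definition nh :: "'a \<Rightarrow> 'a \<Rightarrow> 'a" where
  "nh u v = cnh (slot (lev u v) v) u v"

text \<open>Every vertex on the way determines \<open>lev\<close> afresh from its own table, so the
  level may fall during the journey. The sum reserves \<open>\<Lambda> i\<close> for each lower
  level, and a change of level only releases part of this reserve.\<close>

definition \<Psi> :: "'a \<Rightarrow> 'a \<Rightarrow> real" where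
  "\<Psi> u v = \<Phi> (slot (lev u v) v) u v + (\<Sum>i<lev u v. \<Lambda> i)"

lemma lev: "u \<in> V \<Longrightarrow> v \<in> V \<Longrightarrow> lev u v \<le> m \<and> cl (slot (lev u v) v) u = cl (slot (lev u v) v) v"
  using LeastI[of "\<lambda>i. cl (slot i v) u = cl (slot i v) v" m]
    Least_le[of "\<lambda>i. cl (slot i v) u = cl (slot i v) v" m] top_slot[of u v] by (simp add: lev_def)

lemma lev_le: "cl (slot i v) u = cl (slot i v) v \<Longrightarrow> lev u v \<le> i"
  unfolding lev_def by (rule Least_le)

lemma \<Lambda>_nonneg: "i \<le> m \<Longrightarrow> 0 \<le> \<Lambda> i"
proof -
  assume i: "i \<le> m"
  obtain v where v: "v \<in> V" using V_ne by blast
  obtain x where x: "cl (slot i v) v = Some x" using slot_cl[OF i v] by blast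
  show ?thesis
    using \<Phi>_bounds[OF slot_less[OF i v] v v x x] \<Lambda>_ge[OF i v] by linarith
qed

lemma \<Psi>_bounds:
  assumes "u \<in> V" "v \<in> V"
  shows "0 \<le> \<Psi> u v" "\<Psi> u v \<le> (\<Sum>i\<le>lev u v. \<Lambda> i)"
proof -
  let ?i = "lev u v"
  have i: "?i \<le> m" "cl (slot ?i v) u = cl (slot ?i v) v" using lev[OF assms] by auto
  obtain x where x: "cl (slot ?i v) v = Some x" using slot_cl[OF i(1) assms(2)] by blast
  have b: "0 \<le> \<Phi> (slot ?i v) u v" "\<Phi> (slot ?i v) u v \<le> \<Lambda> ?i"
    using \<Phi>_bounds[OF slot_less[OF i(1) assms(2)] assms _ x, of] i x \<Lambda>_ge[OF i(1) assms(2)] by auto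
  have "0 \<le> (\<Sum>i<?i. \<Lambda> i)" using \<Lambda>_nonneg i(1) by (intro sum_nonneg) auto
  then show "0 \<le> \<Psi> u v" using b by (simp add: \<Psi>_def)
  show "\<Psi> u v \<le> (\<Sum>i\<le>lev u v. \<Lambda> i)"
    using b by (simp add: \<Psi>_def lessThan_Suc_atMost[symmetric])
qed

lemma nh_step:
  assumes u: "u \<in> V" and v: "v \<in> V" and ne: "u \<noteq> v"
  shows "(u, nh u v) \<in> E" "w (u, nh u v) + \<Psi> (nh u v) v \<le> \<Psi> u v"
proof -
  let ?i = "lev u v" let ?s = "slot (lev u v) v" let ?y = "nh u v"
  have i: "?i \<le> m" "cl ?s u = cl ?s v" using lev[OF u v] by auto
  obtain x where x: "cl ?s v = Some x" using slot_cl[OF i(1) v] by blast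
  note s = slot_less[OF i(1) v]
  have step: "(u, ?y) \<in> E" "cl ?s ?y = Some x" "w (u, ?y) + \<Phi> ?s ?y v \<le> \<Phi> ?s u v"
    using cnh_step[OF s u v _ x ne] i x by (auto simp: nh_def)
  show "(u, ?y) \<in> E" by (rule step)
  have yV: "?y \<in> V" using step E_sub by auto
  have le: "lev ?y v \<le> ?i" using step x by (intro lev_le) simp
  show "w (u, ?y) + \<Psi> ?y v \<le> \<Psi> u v"
  proof (cases "lev ?y v = ?i")
    case True
    then show ?thesis using step by (simp add: \<Psi>_def)
  next
    case False
    then have "\<Psi> ?y v \<le> (\<Sum>i<?i. \<Lambda> i)"
    proof -
      have "(\<Sum>i\<le>lev ?y v. \<Lambda> i) \<le> (\<Sum>i<?i. \<Lambda> i)"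
        using False le i(1) \<Lambda>_nonneg by (intro sum_mono2) auto
      then show ?thesis using \<Psi>_bounds(2)[OF yV v] by simp
    qed
    moreover have "w (u, ?y) \<le> \<Phi> ?s u v"
      using step \<Phi>_bounds(1)[OF s yV v step(2) x] by simp
    ultimately show ?thesis by (simp add: \<Psi>_def)
  qed
qed

end

section \<open>Labels and tables\<close>

text \<open>
  A table consists of blocks of nine words. The first block holds the constants \<open>\<kappa>\<close> and \<open>B\<close> and
  the data of the vertex in the spanning tree; block \<open>s + 1\<close> holds the name of the cluster
  in slot \<open>s\<close>, a flag which is \<open>0\<close> on the core, and the data in the forest hanging from the cores.
  A label has a block of six words for each level \<open>i\<close>: the offset of the slot \<open>i * \<kappa> + j\<close>, the name
  of the cluster there, the position of the exit vertex in the spanning tree, the port on which to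
  leave the core from the exit vertex, and the root and the position in the forest.
\<close>

definition decide :: "nat list \<Rightarrow> nat list \<Rightarrow> nat" where
  "decide tb lb =
    (let i = (LEAST i. tb ! (9 * Suc (i * (tb ! 0) + lb ! (6 * i + 0)) + 0) = lb ! (6 * i + 1));
         b = Suc (i * (tb ! 0) + lb ! (6 * i + 0))
     in if tb ! (9 * b + 1) = 0 then
          if tb ! (9 * 0 + 3) = lb ! (6 * i + 2) then lb ! (6 * i + 3)
          else tree_port (tb ! 1) (tb ! (9 * 0 + 2)) (tb ! (9 * 0 + 3)) (tb ! (9 * 0 + 4)) (tb ! (9 * 0 + 5))
            (tb ! (9 * 0 + 6)) (tb ! (9 * 0 + 7)) (tb ! (9 * 0 + 8)) (tb ! (9 * 0 + 2)) (lb ! (6 * i + 2))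
        else tree_port (tb ! 1) (tb ! (9 * b + 2)) (tb ! (9 * b + 3)) (tb ! (9 * b + 4)) (tb ! (9 * b + 5))
            (tb ! (9 * b + 6)) (tb ! (9 * b + 7)) (tb ! (9 * b + 8)) (lb ! (6 * i + 4)) (lb ! (6 * i + 5)))"

text \<open>Positions within one tree serve as names. This is how a core vertex recognizes that it
  is the exit vertex of a label.\<close>

lemma (in coded_forest) pos_inj:
  assumes "u \<in> A" "v \<in> A" "rt u = rt v" "pos u = pos v"
  shows "u = v"
proof -
  have "0 < sz u ^ e" "0 < sz v ^ e" using sz_pos assms by auto
  then have "v \<in> de u" "u \<in> de v"
    using pos_interval_desc[OF assms(1)] pos_interval_desc[OF assms(2)] assms by auto
  then show ?thesis using an_antisym[of v u] by (auto simp: desc_def)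
qed

lemma (in coded_forest) heavy_port_bound:
  assumes "\<And>c. c \<in> ch u \<Longrightarrow> p u c < n" "0 < n"
  shows "heavy_port u < n"
proof (cases "\<exists>c\<in>ch u. rk c = 0")
  case True
  then obtain c where "c \<in> ch u" "rk c = 0" by blast
  then show ?thesis using heavy_port assms(1) by metis
next
  case False
  then have "heavy_port u = 0" by (auto simp: heavy_port_def)
  then show ?thesis using assms by simp
qed

locale coded_clusters = leveled_clusters V E w rr par dep S cl core \<pi> D \<tau> \<rho> m slot \<Lambda>
  for V :: "'a set" and E w rr par dep S cl core \<pi> D \<tau> \<rho> m slot \<Lambda> +
  fixes \<kappa> :: nat and j :: "nat \<Rightarrow> 'a \<Rightarrow> nat" and H a t B d :: nat
  assumes slot_eq: "i \<le> m \<Longrightarrow> v \<in> V \<Longrightarrow> slot i v = i * \<kappa> + j i v"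
    and hang_count: "u \<in> V \<Longrightarrow> card {s. u \<in> hang s} + 1 \<le> t"
    and H2: "2 \<le> H" and t_le: "t \<le> H ^ a" and B_ge: "t * H \<le> B" and B_pos: "0 < B"
    and n2: "2 \<le> card V" and BH: "B ^ H \<le> card V ^ d" and \<kappa>_le: "\<kappa> \<le> card V ^ d"
    and j_le: "i \<le> m \<Longrightarrow> v \<in> V \<Longrightarrow> j i v \<le> \<kappa>"
begin

text \<open>The index agrees with the numbering of the blocks in a table. All forests are treated as
  one family because they share the ports.\<close>

definition FA :: "nat \<Rightarrow> 'a set" where
  "FA q = (case q of 0 \<Rightarrow> V | Suc s \<Rightarrow> hang s)"
definition Ff :: "nat \<Rightarrow> 'a \<Rightarrow> 'a" where
  "Ff q = (case q of 0 \<Rightarrow> par | Suc s \<Rightarrow> fp s)"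
definition Fd :: "nat \<Rightarrow> 'a \<Rightarrow> nat" where
  "Fd q = (case q of 0 \<Rightarrow> dep | Suc s \<Rightarrow> dp s)"

lemma F_simps [simp]:
  "FA 0 = V" "Ff 0 = par" "Fd 0 = dep" "FA (Suc s) = hang s" "Ff (Suc s) = fp s" "Fd (Suc s) = dp s"
  by (simp_all add: FA_def Ff_def Fd_def)

lemma forest_F: "forest (FA q) (Ff q) (Fd q)"
  by (cases q) (simp_all add: forest_hang M.forest_axioms)

lemma FA_V: "FA q \<subseteq> V" by (cases q) (auto simp: hang_def)

lemma parent_edge: "u \<in> FA q \<Longrightarrow> Ff q u \<noteq> u \<Longrightarrow> (u, Ff q u) \<in> E"
proof (cases q)
  case 0
  then show "u \<in> FA q \<Longrightarrow> Ff q u \<noteq> u \<Longrightarrow> (u, Ff q u) \<in> E"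
    using par_props[of u] par_root by auto
next
  case (Suc s)
  then show "u \<in> FA q \<Longrightarrow> Ff q u \<noteq> u \<Longrightarrow> (u, Ff q u) \<in> E"
    using hang_parent(3)[of u s] by (auto simp: fp_def split: if_splits)
qed

lemma children_neighbors: "children (FA q) (Ff q) u \<subseteq> E `` {u}"
  using parent_edge E_sym by (fastforce simp: children_def)

lemma ports_exist:
  "\<exists>rk port. (\<forall>u\<in>V. bij_betw (port u) (E `` {u}) {..<card (E `` {u})}) \<and>
     (\<forall>q. coded_forest (FA q) (Ff q) (Fd q) (rk q) port H a t B)"
proof -
  have "\<exists>rk :: 'a \<Rightarrow> nat. \<forall>u. inj_on rk (children (FA q) (Ff q) u) \<and>
      (\<forall>c\<in>children (FA q) (Ff q) u. (rk c + 1) * card (desc (FA q) (Ff q) c) \<le> card (desc (FA q) (Ff q) u)) \<and>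
      (\<forall>c\<in>children (FA q) (Ff q) u. \<exists>c0\<in>children (FA q) (Ff q) u. rk c0 = 0)" for q
    by (rule forest.rank_exists[OF forest_F])
  then obtain rk :: "nat \<Rightarrow> 'a \<Rightarrow> nat" where rk: "\<And>q u. inj_on (rk q) (children (FA q) (Ff q) u) \<and>
      (\<forall>c\<in>children (FA q) (Ff q) u. (rk q c + 1) * card (desc (FA q) (Ff q) c) \<le> card (desc (FA q) (Ff q) u)) \<and>
      (\<forall>c\<in>children (FA q) (Ff q) u. \<exists>c0\<in>children (FA q) (Ff q) u. rk q c0 = 0)"
    by metis
  have "\<exists>f. bij_betw f (E `` {u}) {..<card (E `` {u})} \<and>
      (\<forall>q\<in>{q. u \<in> FA q}. \<forall>c\<in>children (FA q) (Ff q) u. f c < t * (rk q c + 1))" if u: "u \<in> V" for u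
  proof (rule common_port_numbering)
    have "E `` {u} \<subseteq> V" using E_sub by auto
    then show "finite (E `` {u})" using finite_V finite_subset by blast
    have fin: "finite {s. u \<in> hang s}"
      by (rule finite_subset[of _ "{..<S}"]) (auto simp: hang_def)
    have eq: "{q. u \<in> FA q} = insert 0 (Suc ` {s. u \<in> hang s})"
    proof (intro set_eqI)
      fix q show "q \<in> {q. u \<in> FA q} \<longleftrightarrow> q \<in> insert 0 (Suc ` {s. u \<in> hang s})"
        using u by (cases q) auto
    qed
    then show "finite {q. u \<in> FA q}" using fin by simp
    have "card {q. u \<in> FA q} \<le> card {s. u \<in> hang s} + 1"
      unfolding eq using fin by (simp add: card_insert_if card_image)
    then show "card {q. u \<in> FA q} \<le> t" using hang_count[OF u] by simp
    show "children (FA q) (Ff q) u \<subseteq> E `` {u}" for q by (rule children_neighbors)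
    show "inj_on (rk q) (children (FA q) (Ff q) u)" for q using rk by blast
  qed
  then obtain port where port: "\<And>u. u \<in> V \<Longrightarrow> bij_betw (port u) (E `` {u}) {..<card (E `` {u})} \<and>
      (\<forall>q\<in>{q. u \<in> FA q}. \<forall>c\<in>children (FA q) (Ff q) u. port u c < t * (rk q c + 1))"
    by metis
  have "coded_forest (FA q) (Ff q) (Fd q) (rk q) port H a t B" for q
  proof -
    interpret forest "FA q" "Ff q" "Fd q" by (rule forest_F)
    show ?thesis
    proof unfold_locales
      fix u
      show "inj_on (rk q) (ch u)" using rk by blast
      have u: "u \<in> V \<and> u \<in> FA q" if "c \<in> ch u" for c using ch_parent[OF that] FA_V by blast
      show "inj_on (port u) (ch u)"
      proof (cases "ch u = {}")
        case False
        then have "inj_on (port u) (E `` {u})" using u port by (auto simp: bij_betw_def)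
        then show ?thesis using children_neighbors by (rule inj_on_subset)
      qed simp
      fix c assume c: "c \<in> ch u"
      show "(rk q c + 1) * sz c \<le> sz u" "\<exists>c0\<in>ch u. rk q c0 = 0" using rk c by blast+
      show "port u c < t * (rk q c + 1)" using port[of u] u[OF c] c by auto
    qed (use H2 t_le B_ge B_pos in auto)
  qed
  then show ?thesis using port by blast
qed

end

locale ported_clusters = coded_clusters +
  fixes rk :: "nat \<Rightarrow> 'a \<Rightarrow> nat" and port :: "'a \<Rightarrow> 'a \<Rightarrow> nat" and nm :: "'a \<Rightarrow> nat"
  assumes port_bij: "u \<in> V \<Longrightarrow> bij_betw (port u) (E `` {u}) {..<card (E `` {u})}"
    and coded: "coded_forest (FA q) (Ff q) (Fd q) (rk q) port H a t B"
    and nm_inj: "inj_on nm V" and nm_less: "u \<in> V \<Longrightarrow> nm u < card V"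
begin

interpretation CF: coded_forest "FA q" "Ff q" "Fd q" "rk q" port H a t B for q
  by (rule coded)

abbreviation "n \<equiv> card V"

text \<open>For slot \<open>s\<close> the parent is \<open>\<pi> s u\<close> and not
  \<open>fp s u\<close>: at the root of a hanging tree, the port has to lead into the core.\<close>

definition parent_port :: "nat \<Rightarrow> 'a \<Rightarrow> nat" where
  "parent_port q u = (let y = (case q of 0 \<Rightarrow> par u | Suc s \<Rightarrow> \<pi> s u) in if (u, y) \<in> E then port u y else 0)"

definition entry :: "nat \<Rightarrow> 'a \<Rightarrow> nat \<Rightarrow> nat" where
  "entry q u r = (if u \<in> FA q then
     [nm (top_of (Ff q) u), CF.pos q u, card (desc (FA q) (Ff q) u) ^ CF.e, CF.heavy_len q u,
      CF.heavy_port q u, CF.packed q u, parent_port q u] ! r else 0)"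

text \<open>Names of centers are below \<open>n\<close>, so \<open>n\<close> marks a vertex outside
  all clusters of the slot.\<close>

definition cluster_name :: "nat \<Rightarrow> 'a \<Rightarrow> nat" where
  "cluster_name s u = (case cl s u of None \<Rightarrow> n | Some x \<Rightarrow> nm x)"

definition table_word :: "'a \<Rightarrow> nat \<Rightarrow> nat \<Rightarrow> nat" where
  "table_word u b q = (if q = 0 then (case b of 0 \<Rightarrow> \<kappa> | Suc s \<Rightarrow> cluster_name s u)
     else if q = 1 then (case b of 0 \<Rightarrow> B | Suc s \<Rightarrow> if core s u then 0 else 1)
     else entry b u (q - 2))"

text \<open>For a destination in the core, \<open>n\<close> as the name of the root matches no root,
  so every vertex outside the core forwards the message to its parent.\<close>

definition label_word :: "'a \<Rightarrow> nat \<Rightarrow> nat \<Rightarrow> nat" where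
  "label_word v i q = (let s = slot i v; r = top_of (fp s) v in
     [j i v, cluster_name s v, CF.pos 0 (exit s v),
      if core s v then 0 else port (exit s v) r,
      if core s v then n else nm r,
      if core s v then 0 else CF.pos (Suc s) v] ! q)"

definition tab :: "'a \<Rightarrow> nat list" where
  "tab u = map (\<lambda>p. table_word u (p div 9) (p mod 9)) [0..<9 * Suc S]"

definition lab :: "'a \<Rightarrow> nat list" where
  "lab v = map (\<lambda>p. label_word v (p div 6) (p mod 6)) [0..<6 * Suc m]"

lemma tab_nth: "b \<le> S \<Longrightarrow> q < 9 \<Longrightarrow> tab u ! (9 * b + q) = table_word u b q"
  by (simp add: tab_def)

lemma lab_nth: "i \<le> m \<Longrightarrow> q < 6 \<Longrightarrow> lab v ! (6 * i + q) = label_word v i q"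
  by (simp add: lab_def)

lemma port_less_n: "u \<in> V \<Longrightarrow> (u, x) \<in> E \<Longrightarrow> port u x < n"
proof -
  assume u: "u \<in> V" "(u, x) \<in> E"
  have "port u x < card (E `` {u})" using port_bij[OF u(1)] u(2) by (auto simp: bij_betw_def)
  also have "\<dots> \<le> n" using E_sub finite_V by (intro card_mono) auto
  finally show ?thesis .
qed

definition c :: nat where "c = d + CF.e + 1"

lemma le_word: "x \<le> n ^ k \<Longrightarrow> k < c \<Longrightarrow> x < n ^ c"
  using n2 power_strict_increasing[of k c n] by linarith

lemma word_consts:
  "x \<le> n \<Longrightarrow> x < n ^ c" "x \<le> n ^ CF.e \<Longrightarrow> x < n ^ c" "x \<le> n ^ d \<Longrightarrow> x < n ^ c"
  using le_word[of x 1] le_word[of x CF.e] le_word[of x d] by (auto simp: c_def CF.e_def)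

lemma FA_card: "card (FA q) ^ k \<le> n ^ k"
  using FA_V finite_V by (intro power_mono card_mono) auto

lemma entry_word: "u \<in> V \<Longrightarrow> r < 7 \<Longrightarrow> entry q u r < n ^ c"
proof (cases "u \<in> FA q")
  case True
  assume u: "u \<in> V" and r: "r < 7"
  have "parent_port q u \<le> n"
    using port_less_n[OF u] by (auto simp: parent_port_def Let_def split: nat.split intro: less_imp_le)
  moreover have "CF.heavy_port q u < n"
    by (rule CF.heavy_port_bound) (use children_neighbors port_less_n[OF u] n2 in auto)
  moreover have "nm (top_of (Ff q) u) < n" using CF.rt_in[OF True] FA_V nm_less by blast
  moreover have "CF.pos q u \<le> n ^ CF.e" using CF.pos_bound[OF True] FA_card[of q CF.e] by simp
  moreover have "card (desc (FA q) (Ff q) u) ^ CF.e \<le> n ^ CF.e"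
    using CF.sz_pow_bound[of q u] FA_card[of q CF.e] by simp
  moreover have "CF.heavy_len q u \<le> n ^ CF.e"
    using CF.heavy_len_bound[OF True] FA_card[of q CF.e] by simp
  moreover have "CF.packed q u \<le> n ^ d" using CF.packed(1)[of q u] BH by simp
  moreover have "r = 0 \<or> r = 1 \<or> r = 2 \<or> r = 3 \<or> r = 4 \<or> r = 5 \<or> r = 6" using r by auto
  ultimately show ?thesis
    using True word_consts by (auto simp: entry_def less_imp_le)
next
  case False
  then show ?thesis using word_consts(1)[of 0] by (simp add: entry_def)
qed

lemma cluster_name_le: "s < S \<Longrightarrow> u \<in> V \<Longrightarrow> cluster_name s u \<le> n"
  using cl_V[of s u] nm_less by (auto simp: cluster_name_def less_imp_le split: option.split)

lemma tab_words:
  assumes u: "u \<in> V" and x: "x \<in> set (tab u)" shows "x < n ^ c"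
proof -
  obtain p where p: "p < 9 * Suc S" "x = table_word u (p div 9) (p mod 9)"
    using x by (auto simp: tab_def)
  have b: "p div 9 \<le> S" using p(1) by auto
  have "B \<le> B ^ H" using B_pos H2 by (intro self_le_power) auto
  then have "B \<le> n ^ d" using BH by simp
  moreover have "entry (p div 9) u (p mod 9 - 2) < n ^ c" by (rule entry_word[OF u]) auto
  moreover have "p div 9 = Suc s \<Longrightarrow> cluster_name s u \<le> n" for s
    using b u by (intro cluster_name_le) auto
  ultimately show ?thesis
    using p(2) n2 \<kappa>_le word_consts by (auto simp: table_word_def split: nat.split)
qed

lemma lab_words:
  assumes v: "v \<in> V" and x: "x \<in> set (lab v)" shows "x < n ^ c"
proof -
  obtain p where p: "p < 6 * Suc m" "x = label_word v (p div 6) (p mod 6)"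
    using x by (auto simp: lab_def)
  define i where "i = p div 6"
  define s where "s = slot i v"
  have i: "i \<le> m" using p(1) by (auto simp: i_def)
  have s: "s < S" "cl s v \<noteq> None" using slot_less slot_cl i v by (auto simp: s_def)
  then obtain y where y: "cl s v = Some y" by blast
  have ex: "exit s v \<in> V" using exit_props[OF s(1) v y] by simp
  have noncore: "port (exit s v) (top_of (fp s) v) < n \<and> nm (top_of (fp s) v) < n \<and> CF.pos (Suc s) v \<le> n ^ CF.e"
    if nc: "\<not> core s v"
  proof -
    have vh: "v \<in> FA (Suc s)" using nc s v by (simp add: hang_def)
    then have r: "top_of (fp s) v \<in> hang s" using CF.rt_in[OF vh] by simp
    have "(exit s v, top_of (fp s) v) \<in> E"
      using hang_parent(3)[OF r] E_sym nc by (simp add: exit_def)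
    moreover have "top_of (fp s) v \<in> V" using r by (simp add: hang_def)
    moreover have "CF.pos (Suc s) v \<le> n ^ CF.e"
      using CF.pos_bound[OF vh] FA_card[of "Suc s" CF.e] by simp
    ultimately show ?thesis using port_less_n[OF ex] nm_less by blast
  qed
  have "CF.pos 0 (exit s v) \<le> n ^ CF.e"
    using CF.pos_bound[of "exit s v" 0] ex by simp
  moreover have "j i v \<le> n ^ d" using j_le[OF i v] \<kappa>_le by simp
  moreover have "cluster_name s v \<le> n" by (rule cluster_name_le[OF s(1) v])
  moreover have "p mod 6 = 0 \<or> p mod 6 = 1 \<or> p mod 6 = 2 \<or> p mod 6 = 3 \<or> p mod 6 = 4 \<or> p mod 6 = 5" by presburger
  ultimately show ?thesis
    using p(2) n2 noncore word_consts unfolding i_def[symmetric]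
    by (auto simp: label_word_def Let_def s_def[symmetric] less_imp_le)
qed

lemma same_name_iff:
  assumes "s < S" "u \<in> V" "v \<in> V" "cl s v \<noteq> None"
  shows "cluster_name s u = cluster_name s v \<longleftrightarrow> cl s u = cl s v"
proof -
  obtain y where y: "cl s v = Some y" using assms by blast
  have yV: "y \<in> V" using cl_V[OF assms(1,3) y] .
  show ?thesis
  proof (cases "cl s u")
    case None
    then show ?thesis using y nm_less[OF yV] by (simp add: cluster_name_def)
  next
    case (Some x)
    have "x \<in> V" using cl_V[OF assms(1,2) Some] .
    then show ?thesis using Some y yV nm_inj by (simp add: cluster_name_def inj_on_eq_iff)
  qed
qed

lemma decide_correct:
  assumes u: "u \<in> V" and v: "v \<in> V" and ne: "u \<noteq> v"
  shows "decide (tab u) (lab v) = port u (nh u v)"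
proof -
  have blk: "tab u ! (9 * b + q) = table_word u b q" if "b \<le> S" "q < 9" for b q
    using tab_nth that by blast
  have t0: "tab u ! 0 = \<kappa>" "tab u ! 1 = B"
    using tab_nth[of 0 0 u] tab_nth[of 0 1 u] by (auto simp: table_word_def)
  have slot: "Suc (i * (tab u ! 0) + lab v ! (6 * i + 0)) = Suc (slot i v)" if "i \<le> m" for i
    using lab_nth[of i 0 v] that slot_eq[OF that v] t0 by (simp add: label_word_def)
  define P where "P i \<longleftrightarrow> tab u ! (9 * Suc (i * (tab u ! 0) + lab v ! (6 * i + 0)) + 0) = lab v ! (6 * i + 1)" for i
  have P_iff: "P i \<longleftrightarrow> cl (slot i v) u = cl (slot i v) v" if i: "i \<le> m" for i
  proof -
    have "tab u ! (9 * Suc (i * (tab u ! 0) + lab v ! (6 * i + 0)) + 0) = cluster_name (slot i v) u"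
      unfolding slot[OF i] using slot_less[OF i v] by (subst blk) (auto simp: table_word_def)
    moreover have "lab v ! (6 * i + 1) = cluster_name (slot i v) v"
      using i by (subst lab_nth) (auto simp: label_word_def Let_def)
    ultimately show ?thesis
      using same_name_iff[OF slot_less[OF i v] u v slot_cl[OF i v]] by (simp add: P_def)
  qed
  define i where "i = lev u v"
  have i: "i \<le> m" "cl (slot i v) u = cl (slot i v) v" using lev[OF u v] by (auto simp: i_def)
  \<comment> \<open>Beyond level \<open>m\<close> the predicate reads words that mean nothing, but
    it already holds at some level up to \<open>m\<close>, so the least solution does not depend on
    them.\<close>
  have least: "(LEAST i. P i) = i"
  proof (rule Least_equality)
    show "P i" using P_iff i by simp
    fix k assume "P k"
    then show "i \<le> k" using P_iff[of k] lev_le[of k v u] i by (cases "k \<le> m") (auto simp: i_def)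
  qed
  define s where "s = slot i v"
  obtain x where x: "cl s v = Some x" "cl s u = Some x" using slot_cl[OF i(1) v] i by (auto simp: s_def)
  have s: "s < S" using slot_less i v by (simp add: s_def)
  note ex = exit_props[OF s v x(1)]
  have TW: "tab u ! (9 * Suc s + q) = table_word u (Suc s) q" if "q < 9" for q
    by (rule blk) (use s that in auto)
  have T0: "tab u ! (9 * 0 + q) = table_word u 0 q" if "q < 9" for q
    by (rule blk) (use that in auto)
  have LW: "lab v ! (6 * i + q) = label_word v i q" if "q < 6" for q
    using lab_nth i that by blast
  have dec: "decide (tab u) (lab v) =
      (if tab u ! (9 * Suc s + 1) = 0 then
          if tab u ! (9 * 0 + 3) = lab v ! (6 * i + 2) then lab v ! (6 * i + 3)
          else tree_port (tab u ! 1) (tab u ! (9 * 0 + 2)) (tab u ! (9 * 0 + 3)) (tab u ! (9 * 0 + 4)) (tab u ! (9 * 0 + 5))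
            (tab u ! (9 * 0 + 6)) (tab u ! (9 * 0 + 7)) (tab u ! (9 * 0 + 8)) (tab u ! (9 * 0 + 2)) (lab v ! (6 * i + 2))
        else tree_port (tab u ! 1) (tab u ! (9 * Suc s + 2)) (tab u ! (9 * Suc s + 3)) (tab u ! (9 * Suc s + 4)) (tab u ! (9 * Suc s + 5))
            (tab u ! (9 * Suc s + 6)) (tab u ! (9 * Suc s + 7)) (tab u ! (9 * Suc s + 8)) (lab v ! (6 * i + 4)) (lab v ! (6 * i + 5)))"
    unfolding decide_def Let_def P_def[symmetric] least slot[OF i(1)] s_def[symmetric] ..
  have nh: "nh u v = cnh s u v" by (simp add: nh_def s_def i_def)
  show ?thesis
  proof (cases "core s u")
    case True
    have flag: "tab u ! (9 * Suc s + 1) = 0" using TW[of 1] True by (simp add: table_word_def)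
    have l2: "lab v ! (6 * i + 2) = CF.pos 0 (exit s v)"
      by (subst LW) (auto simp: label_word_def Let_def s_def)
    have t3: "tab u ! (9 * 0 + 3) = CF.pos 0 u"
      by (subst T0) (use u in \<open>auto simp: table_word_def entry_def\<close>)
    have rts: "top_of par u = top_of par (exit s v)" using M_rt u ex by simp
    show ?thesis
    proof (cases "u = exit s v")
      case eq: True
      have nc: "\<not> core s v" using ne eq by (auto simp: exit_def)
      have "lab v ! (6 * i + 3) = port (exit s v) (top_of (fp s) v)"
        by (subst LW) (use nc in \<open>auto simp: label_word_def Let_def s_def\<close>)
      moreover have "nh u v = top_of (fp s) v" using nh True eq by (simp add: cnh_def)
      ultimately show ?thesis unfolding dec using flag l2 t3 eq by simp
    next
      case False
      have "CF.pos 0 u \<noteq> CF.pos 0 (exit s v)"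
        using CF.pos_inj[of u 0 "exit s v"] u ex(1) rts False by auto
      then have "decide (tab u) (lab v) =
          tree_port (tab u ! 1) (tab u ! (9 * 0 + 2)) (tab u ! (9 * 0 + 3)) (tab u ! (9 * 0 + 4)) (tab u ! (9 * 0 + 5))
            (tab u ! (9 * 0 + 6)) (tab u ! (9 * 0 + 7)) (tab u ! (9 * 0 + 8)) (tab u ! (9 * 0 + 2)) (lab v ! (6 * i + 2))"
        unfolding dec using flag l2 t3 by simp
      also have "\<dots> = tree_port B (nm (top_of par u)) (CF.pos 0 u) (card (desc V par u) ^ CF.e)
          (CF.heavy_len 0 u) (CF.heavy_port 0 u) (CF.packed 0 u) (parent_port 0 u)
          (nm (top_of par u)) (CF.pos 0 (exit s v))"
        unfolding l2 t0(2)
        by (subst T0, simp)+ (use u in \<open>simp add: table_word_def entry_def eval_nat_numeral\<close>)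
      also have "\<dots> = (if exit s v \<in> desc V par u then port u (next_hop V par u (exit s v)) else parent_port 0 u)"
        using CF.tree_port_correct[of u 0 "exit s v" "nm (top_of par u)" "nm (top_of par u)"]
          u ex(1) False rts by simp
      also have "\<dots> = port u (next_hop V par u (exit s v))"
      proof (cases "exit s v \<in> desc V par u")
        case nd: False
        have "par u \<noteq> u" using M.not_desc_not_root[OF u ex(1) rts nd] .
        then have "(u, par u) \<in> E" using parent_edge[of u 0] u by simp
        then show ?thesis using nd by (simp add: parent_port_def next_hop_def)
      qed simp
      finally show ?thesis using nh True False by (simp add: cnh_def)
    qed
  next
    case False
    then have uh: "u \<in> hang s" using s u x by (simp add: hang_def)
    have flag: "tab u ! (9 * Suc s + 1) \<noteq> 0" using TW[of 1] False by (simp add: table_word_def)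
    let ?r = "nm (top_of (fp s) u)"
    let ?r' = "if core s v then n else nm (top_of (fp s) v)"
    let ?x = "if core s v then 0 else CF.pos (Suc s) v"
    have l45: "lab v ! (6 * i + 4) = ?r'" "lab v ! (6 * i + 5) = ?x"
      by (subst LW; auto simp: label_word_def Let_def s_def eval_nat_numeral)+
    have pp: "parent_port (Suc s) u = port u (\<pi> s u)"
      using hang_parent(3)[OF uh] by (simp add: parent_port_def)
    have ruV: "top_of (fp s) u \<in> V" using CF.rt_in[of u "Suc s"] uh by (auto simp: hang_def)
    have "decide (tab u) (lab v) =
          tree_port (tab u ! 1) (tab u ! (9 * Suc s + 2)) (tab u ! (9 * Suc s + 3)) (tab u ! (9 * Suc s + 4)) (tab u ! (9 * Suc s + 5))
            (tab u ! (9 * Suc s + 6)) (tab u ! (9 * Suc s + 7)) (tab u ! (9 * Suc s + 8)) (lab v ! (6 * i + 4)) (lab v ! (6 * i + 5))"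
      unfolding dec using flag by simp
    also have "\<dots> = tree_port B ?r (CF.pos (Suc s) u) (card (desc (hang s) (fp s) u) ^ CF.e)
          (CF.heavy_len (Suc s) u) (CF.heavy_port (Suc s) u) (CF.packed (Suc s) u) (port u (\<pi> s u)) ?r' ?x"
      unfolding l45 t0(2)
      by (subst TW, simp)+ (use uh in \<open>simp add: table_word_def entry_def pp eval_nat_numeral\<close>)
    also have "\<dots> = (if v \<in> desc (hang s) (fp s) u then port u (next_hop (hang s) (fp s) u v) else port u (\<pi> s u))"
    proof (cases "core s v")
      case True
      then have "v \<notin> desc (hang s) (fp s) u" by (auto simp: desc_def hang_def)
      moreover have "?r \<noteq> ?r'" using nm_less[OF ruV] True by simp
      ultimately show ?thesis by (simp add: tree_port_def)
    next
      case nc: False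
      then have vh: "v \<in> hang s" using s v x by (simp add: hang_def)
      have rvV: "top_of (fp s) v \<in> V" using CF.rt_in[of v "Suc s"] vh by (auto simp: hang_def)
      have "?r = nm (top_of (fp s) v) \<longleftrightarrow> top_of (fp s) u = top_of (fp s) v"
        using nm_inj ruV rvV by (auto simp: inj_on_def)
      then show ?thesis
        using CF.tree_port_correct[of u "Suc s" v "?r" "nm (top_of (fp s) v)"] uh vh ne nc by simp
    qed
    finally show ?thesis using nh False by (simp add: cnh_def)
  qed
qed

end

section \<open>Scales\<close>

locale scales = prim V E w rr par dep for V :: "'a set" and E w rr par dep +
  fixes b :: real and \<kappa> g m :: nat and dd :: "'a \<Rightarrow> 'a \<Rightarrow> real"
  assumes n2: "2 \<le> card V" and b2: "2 \<le> b" and b_le: "b \<le> card V"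
    and \<kappa>: "card V < b ^ \<kappa>" and g: "real (card V) ^ 8 \<le> b ^ g"
    and dd_reach: "u \<in> V \<Longrightarrow> v \<in> V \<Longrightarrow> \<exists>l\<le>dd u v. reach E w V u v l"
    and dd_top: "u \<in> V \<Longrightarrow> v \<in> V \<Longrightarrow> dd u v \<le> b ^ Suc m"
begin

abbreviation "n \<equiv> card V"

definition J :: nat where "J = nat \<lfloor>2 * b * ln n\<rfloor> + 1"
definition rad :: "nat \<Rightarrow> real" where "rad i = b ^ Suc i"
definition thr :: "nat \<Rightarrow> real" where "thr i = rad i / n\<^sup>2"
definition crad :: "nat \<Rightarrow> real" where "crad i = (2 * real J + 1) * rad i"
definition Wt :: "nat \<Rightarrow> 'a \<times> 'a \<Rightarrow> real" where "Wt i e = (if w e < thr i then 0 else w e)"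

lemma \<kappa>_pos: "0 < \<kappa>" using \<kappa> n2 by (cases \<kappa>) auto

lemma ln_n: "0 \<le> ln (real n)" "ln (real n) \<le> n"
  using n2 ln_le_minus_one[of "real n"] by auto

lemma J_bounds: "2 * b * ln n < J" "J \<le> 2 * b * ln n + 1"
proof -
  have "0 \<le> 2 * b * ln n" using b2 ln_n by simp
  then show "2 * b * ln n < J" "J \<le> 2 * b * ln n + 1" unfolding J_def by linarith+
qed

lemma rad_pos: "0 < rad i" using b2 by (simp add: rad_def)

lemma thr_pos: "0 < thr i" using rad_pos n2 by (simp add: thr_def)

lemma thr_mono: "i \<le> i' \<Longrightarrow> thr i \<le> thr i'"
  using b2 unfolding thr_def rad_def by (intro divide_right_mono power_increasing) auto

lemma n_thr: "n * thr i \<le> rad i"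
proof -
  have "n * thr i = rad i / n" using n2 by (simp add: thr_def power2_eq_square)
  also have "\<dots> \<le> rad i / 1" using rad_pos[of i] n2 by (intro divide_left_mono) auto
  finally show ?thesis by simp
qed

text \<open>Source of the exponent \<open>8\<close>: as \<open>b\<close> and \<open>ln n\<close> are
  at most \<open>n\<close>, the radius factor \<open>2 * J + 1\<close> is below
  \<open>n ^ 6\<close>, and two more powers make up for the \<open>n^2\<close> in
  \<open>thr\<close>. A cluster is therefore contained in one component \<open>g\<close> scales
  higher.\<close>

lemma crad_less_thr: "crad i < thr (i + g)"
proof -
  have n: "2 \<le> real n" using n2 by simp
  have "b * ln n \<le> real n * real n" using ln_n b2 b_le by (intro mult_mono) auto
  then have "2 * real J + 1 \<le> 4 * (real n * real n) + 3" using J_bounds(2) by simp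
  also have "\<dots> < 16 * (real n)\<^sup>2"
    using power_mono[OF n, of 2] by (simp add: power2_eq_square)
  also have "\<dots> \<le> real n ^ 4 * (real n)\<^sup>2"
    using power_mono[OF n, of 4] by (intro mult_right_mono) auto
  also have "\<dots> = real n ^ 8 / (real n)\<^sup>2" using n by (simp add: field_simps flip: power_add)
  also have "\<dots> \<le> b ^ g / (real n)\<^sup>2" using g by (intro divide_right_mono) auto
  finally have "crad i < (b ^ g / (real n)\<^sup>2) * rad i"
    unfolding crad_def by (rule mult_strict_right_mono[OF _ rad_pos])
  also have "\<dots> = thr (i + g)" by (simp add: thr_def rad_def power_add)
  finally show ?thesis .
qed

lemma Wt_sym_weighted: "sym_weighted V E (Wt i)"
  using finite_V E_sub E_sym W_sym W_nonneg by unfold_locales (auto simp: Wt_def)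

interpretation Wi: sym_weighted V E "Wt i" for i by (rule Wt_sym_weighted)

lemma reach_Wt: "reach E w R x y l \<Longrightarrow> \<exists>l'\<le>l. reach E (Wt i) R x y l'"
proof (induction rule: reach.induct)
  case (refl x)
  then show ?case by (auto intro: reach.refl)
next
  case (step x y z l)
  then obtain l' where l': "l' \<le> l" "reach E (Wt i) R y z l'" by blast
  have "Wt i (x, y) \<le> w (x, y)" using W_nonneg step by (simp add: Wt_def)
  then show ?case using l' step by (intro exI[of _ "Wt i (x, y) + l'"]) (auto intro: reach.step)
qed

lemma reach_near: "reach E (Wt i) R x y l \<Longrightarrow> l \<le> crad i \<Longrightarrow> (x, y) \<in> near (thr (i + g))"
proof (induction rule: reach.induct)
  case (refl x)
  then show ?case by (simp add: near_refl)
next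
  case (step x y z l)
  have "0 \<le> l" "0 \<le> Wt i (x, y)" using Wi.reach_nonneg step Wi.W_nonneg by auto
  then have "Wt i (x, y) \<le> crad i" "l \<le> crad i" using step by auto
  then have "w (x, y) < thr (i + g)"
    using crad_less_thr[of i] thr_mono[of i "i + g"] by (auto simp: Wt_def split: if_splits)
  then show ?case using near_edge[OF step(1)] step near_trans \<open>l \<le> crad i\<close> by blast
qed

lemma cover_exists: "\<exists>ctr. (\<forall>q<\<kappa>. Wi.good_clusters i (crad i) V (ctr q)) \<and>
     (\<forall>v\<in>V. \<exists>q<\<kappa>. \<exists>x. ball E (Wt i) V v (rad i) \<subseteq> cluster_of (ctr q) x)"
  unfolding crad_def using rad_pos[of i] b2 J_bounds \<kappa> by (intro Wi.sparse_cover[where b = b]) auto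

definition ctr :: "nat \<Rightarrow> nat \<Rightarrow> 'a \<Rightarrow> 'a option" where
  "ctr i = (SOME ctr. (\<forall>q<\<kappa>. Wi.good_clusters i (crad i) V (ctr q)) \<and>
     (\<forall>v\<in>V. \<exists>q<\<kappa>. \<exists>x. ball E (Wt i) V v (rad i) \<subseteq> cluster_of (ctr q) x))"

lemma ctr: "q < \<kappa> \<Longrightarrow> Wi.good_clusters i (crad i) V (ctr i q)"
  "v \<in> V \<Longrightarrow> \<exists>q<\<kappa>. \<exists>x. ball E (Wt i) V v (rad i) \<subseteq> cluster_of (ctr i q) x"
  using someI_ex[OF cover_exists[of i]] unfolding ctr_def by blast+

lemma ctr_props:
  assumes "q < \<kappa>" "ctr i q y = Some x"
  shows "y \<in> V" "x \<in> V" "ctr i q x = Some x" "\<exists>l\<le>crad i. reach E (Wt i) (cluster_of (ctr i q) x) y x l"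
    "(y, x) \<in> near (thr (i + g))"
proof -
  have *: "y \<in> V \<and> x \<in> V \<and> ctr i q x = Some x \<and> (\<exists>l\<le>crad i. reach E (Wt i) (cluster_of (ctr i q) x) y x l)"
    using ctr(1)[OF assms(1), of i] assms(2) unfolding Wi.good_clusters_def by blast
  then show "y \<in> V" "x \<in> V" "ctr i q x = Some x" "\<exists>l\<le>crad i. reach E (Wt i) (cluster_of (ctr i q) x) y x l"
    by blast+
  show "(y, x) \<in> near (thr (i + g))" using * reach_near by blast
qed

lemma ctr_near_closed:
  assumes "q < \<kappa>" "ctr i q y = Some x" "(y, z) \<in> near (thr i)"
  shows "ctr i q z = Some x"
proof -
  have cl: "Wi.closed0 i (cluster_of (ctr i q) x)"
    using ctr(1)[OF assms(1), of i] assms(2) unfolding Wi.good_clusters_def by blast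
  have "(y, z) \<in> {e \<in> E. w e < thr i}\<^sup>*" using assms(3) by (simp add: near_def)
  then show ?thesis
  proof (induction rule: rtrancl_induct)
    case (step z z')
    then have "Wt i (z, z') = 0" "(z, z') \<in> E" by (auto simp: Wt_def)
    then have "z' \<in> cluster_of (ctr i q) x"
      using cl step by (auto simp: Wi.closed0_def Wi.cluster_of_def)
    then show ?case by (simp add: Wi.cluster_of_def)
  qed (rule assms)
qed

section \<open>Giant components and cores\<close>

definition giant :: "nat \<Rightarrow> 'a \<Rightarrow> bool" where
  "giant i u \<longleftrightarrow> card (comp (thr (i + g)) u) < 2 * card (comp (thr i) u)"

lemma comp_eq: "(x, y) \<in> near \<theta> \<Longrightarrow> comp \<theta> x = comp \<theta> y"
  unfolding comp_def using near_sym near_trans by blast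

lemma finite_comp: "x \<in> V \<Longrightarrow> finite (comp \<theta> x)"
  by (rule finite_subset[OF _ finite_V]) (auto simp: comp_def intro: near_V)

lemma giant_near: "(u, v) \<in> near (thr i) \<Longrightarrow> giant i u \<longleftrightarrow> giant i v"
  using comp_eq[of u v "thr i"] comp_eq[of u v "thr (i + g)"] near_mono[OF thr_mono[of i "i + g"]]
  by (auto simp: giant_def)

lemma giants_near:
  assumes "giant i u" "giant i v" "(u, v) \<in> near (thr (i + g))" "u \<in> V" "v \<in> V"
  shows "(u, v) \<in> near (thr i)"
proof (rule ccontr)
  assume not: "(u, v) \<notin> near (thr i)"
  have "comp (thr i) u \<inter> comp (thr i) v = {}"
    using not near_sym near_trans unfolding comp_def by blast
  then have "card (comp (thr i) u) + card (comp (thr i) v) = card (comp (thr i) u \<union> comp (thr i) v)"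
    using finite_comp assms by (simp add: card_Un_disjoint)
  also have "\<dots> \<le> card (comp (thr (i + g)) u)"
  proof (rule card_mono)
    show "finite (comp (thr (i + g)) u)" using finite_comp assms by simp
    have "comp (thr i) x \<subseteq> comp (thr (i + g)) x" for x
      using near_mono[OF thr_mono[of i "i + g"]] by (auto simp: comp_def)
    then show "comp (thr i) u \<union> comp (thr i) v \<subseteq> comp (thr (i + g)) u"
      using comp_eq[OF assms(3)] by auto
  qed
  finally show False using assms(1,2) comp_eq[OF assms(3)] by (simp add: giant_def)
qed

text \<open>
  The core of a cluster is its giant component, if there is one, and otherwise its center alone.
\<close>

definition lcore :: "nat \<Rightarrow> nat \<Rightarrow> 'a \<Rightarrow> bool" where
  "lcore i q u \<longleftrightarrow> (if \<exists>y. ctr i q y = ctr i q u \<and> giant i y then giant i u else ctr i q u = Some u)"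

text \<open>This keeps the number of hanging forests through a vertex small: below the top level, it
  hangs only at scales at which its own component is not giant.\<close>

lemma lcore_noncore: "\<not> lcore i q u \<Longrightarrow> \<not> giant i u"
  unfolding lcore_def by metis

lemma lcore_exists: "q < \<kappa> \<Longrightarrow> ctr i q u = Some x \<Longrightarrow> \<exists>c. ctr i q c = Some x \<and> lcore i q c"
  using ctr_props(3)[of q i u x] unfolding lcore_def by metis

text \<open>Two different vertices can only share a core that is a giant component, since otherwise
  the core is the center alone. Tree steps between them stay in this component, which the cluster
  contains entirely.\<close>

lemma lcore_step:
  assumes q: "q < \<kappa>" and c: "ctr i q u = Some x" "ctr i q v = Some x" "lcore i q u" "lcore i q v" "u \<noteq> v"
  defines "y \<equiv> next_hop V par u v"
  shows "lcore i q y \<and> ctr i q y = Some x \<and> (u, y) \<in> E \<and> w (u, y) \<le> thr i"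
proof -
  have V: "u \<in> V" "v \<in> V" using ctr_props(1)[OF q] c by auto
  have ex: "\<exists>y. ctr i q y = Some x \<and> giant i y" using c by (auto simp: lcore_def split: if_splits)
  then have gi: "giant i u" "giant i v" using c by (auto simp: lcore_def split: if_splits)
  have "(u, v) \<in> near (thr (i + g))"
    using ctr_props(5)[OF q c(1)] ctr_props(5)[OF q c(2)] near_sym near_trans by blast
  then have "(u, v) \<in> near (thr i)" using giants_near gi V by blast
  then have y: "(u, y) \<in> near (thr i) \<and> (u, y) \<in> E \<and> w (u, y) < thr i"
    unfolding y_def by (rule near_next_hop[OF V _ c(5)])
  have "giant i y" using y gi giant_near by blast
  moreover have "ctr i q y = Some x" using ctr_near_closed[OF q c(1)] y by blast
  ultimately show ?thesis using y by (auto simp: lcore_def)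
qed

text \<open>The radius doubles because the core need not contain the center: the walk bounding
  \<open>D\<close> goes to the center and from there to a core vertex.\<close>

lemma level_trees:
  assumes q: "q < \<kappa>"
  shows "\<exists>\<pi> (D :: 'a \<Rightarrow> real). \<forall>u x. ctr i q u = Some x \<longrightarrow> 0 \<le> D u \<and> D u \<le> 2 * crad i + n * thr i \<and>
     (\<not> lcore i q u \<longrightarrow> ctr i q (\<pi> u) = Some x \<and> (u, \<pi> u) \<in> E \<and> D (\<pi> u) + w (u, \<pi> u) \<le> D u)"
proof -
  let ?K = "\<lambda>x. cluster_of (ctr i q) x"
  let ?P = "\<lambda>x \<pi> (D :: 'a \<Rightarrow> real). \<forall>u\<in>?K x. 0 \<le> D u \<and> D u \<le> 2 * crad i + n * thr i \<and>
      (u \<notin> {c. lcore i q c} \<longrightarrow> \<pi> u \<in> ?K x \<and> (u, \<pi> u) \<in> E \<and> D (\<pi> u) + w (u, \<pi> u) \<le> D u)"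
  have "\<exists>\<pi> D. ?P x \<pi> D" for x
  proof (rule spanning_forest_to_core[where W = "Wt i"])
    show "?K x \<subseteq> V" using ctr_props(1)[OF q] by (auto simp: Wi.cluster_of_def)
    show "0 \<le> thr i" using thr_pos[of i] by simp
    show "0 \<le> Wt i e" "w e \<le> Wt i e + thr i" if "e \<in> E" for e
      using Wi.W_nonneg[of "fst e" "snd e"] thr_pos[of i] that by (auto simp: Wt_def)
    show "Wt i (x, y) = Wt i (y, x)" if "(x, y) \<in> E" for x y using Wi.W_sym that by blast
    fix y assume "y \<in> ?K x"
    then have y: "ctr i q y = Some x" by (simp add: Wi.cluster_of_def)
    obtain c where c: "ctr i q c = Some x" "lcore i q c" using lcore_exists[OF q y] by blast
    obtain l l' where "l \<le> crad i" "reach E (Wt i) (?K x) y x l" "l' \<le> crad i" "reach E (Wt i) (?K x) c x l'"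
      using ctr_props(4)[OF q y] ctr_props(4)[OF q c(1)] by blast
    then have "reach E (Wt i) (?K x) y c (l + l')" "l + l' \<le> 2 * crad i"
      using Wi.reach_trans Wi.reach_sym by (blast, simp)
    then show "\<exists>c\<in>{c. lcore i q c}. \<exists>l\<le>2 * crad i. reach E (Wt i) (?K x) y c l" using c by blast
  qed
  then obtain \<pi> D where *: "\<And>x. ?P x (\<pi> x) (D x)" by metis
  show ?thesis
    by (intro exI[of _ "\<lambda>u. \<pi> (the (ctr i q u)) u"] exI[of _ "\<lambda>u. D (the (ctr i q u)) u"])
      (use * in \<open>auto simp: Wi.cluster_of_def\<close>)
qed

definition hub :: 'a where "hub = (SOME x. x \<in> V)"

lemma hub: "hub \<in> V" using V_ne by (auto simp: hub_def intro: someI)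

lemma top_tree:
  "\<exists>\<pi> (D :: 'a \<Rightarrow> real). \<forall>u\<in>V. 0 \<le> D u \<and> D u \<le> rad m \<and>
     (u \<noteq> hub \<longrightarrow> \<pi> u \<in> V \<and> (u, \<pi> u) \<in> E \<and> D (\<pi> u) + w (u, \<pi> u) \<le> D u)"
proof -
  have "\<exists>\<pi> (D :: 'a \<Rightarrow> real). \<forall>u\<in>V. 0 \<le> D u \<and> D u \<le> rad m + real n * 0 \<and>
     (u \<notin> {hub} \<longrightarrow> \<pi> u \<in> V \<and> (u, \<pi> u) \<in> E \<and> D (\<pi> u) + w (u, \<pi> u) \<le> D u)"
  proof (rule spanning_forest_to_core[where W = w])
    show "0 \<le> w e" if "e \<in> E" for e using W_nonneg[of "fst e" "snd e"] that by simp
    fix y assume "y \<in> V"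
    then obtain l where "l \<le> dd y hub" "reach E w V y hub l" "dd y hub \<le> rad m"
      using dd_reach[of y hub] dd_top[of y hub] hub unfolding rad_def by blast
    then show "\<exists>c\<in>{hub}. \<exists>l\<le>rad m. reach E w V y c l" by (intro bexI exI[of _ l]) auto
  qed (use W_sym in auto)
  then show ?thesis by simp
qed

text \<open>
  Slot \<open>i * \<kappa> + q\<close> holds the clusters of round \<open>q\<close> at scale \<open>i < m\<close>. The last slot \<open>m * \<kappa>\<close> holds a single
  shortest-path tree; more than one slot there would exceed the table size if \<open>log n \<Delta>\<close> is small.
\<close>

definition scl :: "nat \<Rightarrow> 'a \<Rightarrow> 'a option" where
  "scl s = (if s < m * \<kappa> then ctr (s div \<kappa>) (s mod \<kappa>) else (\<lambda>_. Some hub))"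
definition score :: "nat \<Rightarrow> 'a \<Rightarrow> bool" where
  "score s = (if s < m * \<kappa> then lcore (s div \<kappa>) (s mod \<kappa>) else (\<lambda>u. u = hub))"
definition srho :: "nat \<Rightarrow> real" where
  "srho s = (if s < m * \<kappa> then 2 * crad (s div \<kappa>) + n * thr (s div \<kappa>) else rad m)"
definition stau :: "nat \<Rightarrow> real" where
  "stau s = (if s < m * \<kappa> then thr (s div \<kappa>) else 0)"

lemma slot_trees:
  "\<exists>\<pi> (D :: 'a \<Rightarrow> real). \<forall>u\<in>V. \<forall>x. scl s u = Some x \<longrightarrow> 0 \<le> D u \<and> D u \<le> srho s \<and>
     (\<not> score s u \<longrightarrow> \<pi> u \<in> V \<and> scl s (\<pi> u) = Some x \<and> (u, \<pi> u) \<in> E \<and> D (\<pi> u) + w (u, \<pi> u) \<le> D u)"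
proof (cases "s < m * \<kappa>")
  case True
  have q: "s mod \<kappa> < \<kappa>" using \<kappa>_pos by simp
  show ?thesis
    using level_trees[OF q, of "s div \<kappa>"] ctr_props(1)[OF q] True
    unfolding scl_def score_def srho_def if_P[OF True] by blast
next
  case False
  then show ?thesis using top_tree by (auto simp: scl_def score_def srho_def)
qed

definition spi :: "nat \<Rightarrow> 'a \<Rightarrow> 'a" where
  "spi s = (SOME \<pi>. \<exists>D :: 'a \<Rightarrow> real. \<forall>u\<in>V. \<forall>x. scl s u = Some x \<longrightarrow> 0 \<le> D u \<and> D u \<le> srho s \<and>
     (\<not> score s u \<longrightarrow> \<pi> u \<in> V \<and> scl s (\<pi> u) = Some x \<and> (u, \<pi> u) \<in> E \<and> D (\<pi> u) + w (u, \<pi> u) \<le> D u))"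
definition sD :: "nat \<Rightarrow> 'a \<Rightarrow> real" where
  "sD s = (SOME D. \<forall>u\<in>V. \<forall>x. scl s u = Some x \<longrightarrow> 0 \<le> D u \<and> D u \<le> srho s \<and>
     (\<not> score s u \<longrightarrow> spi s u \<in> V \<and> scl s (spi s u) = Some x \<and> (u, spi s u) \<in> E \<and> D (spi s u) + w (u, spi s u) \<le> D u))"

lemma slot_tree: "u \<in> V \<Longrightarrow> scl s u = Some x \<Longrightarrow> 0 \<le> sD s u \<and> sD s u \<le> srho s \<and>
     (\<not> score s u \<longrightarrow> spi s u \<in> V \<and> scl s (spi s u) = Some x \<and> (u, spi s u) \<in> E \<and>
       sD s (spi s u) + w (u, spi s u) \<le> sD s u)"
  using someI_ex[OF someI_ex[OF slot_trees[of s]]] unfolding spi_def[symmetric] sD_def[symmetric] by blast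

definition home :: "nat \<Rightarrow> 'a \<Rightarrow> nat" where
  "home i v = (if i < m then SOME q. q < \<kappa> \<and> (\<exists>x. ball E (Wt i) V v (rad i) \<subseteq> cluster_of (ctr i q) x) else 0)"

lemma home_less: "v \<in> V \<Longrightarrow> home i v < \<kappa>"
  using someI_ex[OF ctr(2)[of v i]] \<kappa>_pos by (auto simp: home_def)

lemma home_ball:
  assumes "v \<in> V" "i < m" shows "\<exists>x. ball E (Wt i) V v (rad i) \<subseteq> cluster_of (ctr i (home i v)) x"
  using someI_ex[OF ctr(2)[OF assms(1), of i]] assms(2) by (auto simp: home_def)

definition slot :: "nat \<Rightarrow> 'a \<Rightarrow> nat" where "slot i v = i * \<kappa> + home i v"

lemma slot_level: "i < m \<Longrightarrow> v \<in> V \<Longrightarrow> slot i v < m * \<kappa> \<and> slot i v div \<kappa> = i \<and> slot i v mod \<kappa> = home i v"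
proof -
  assume i: "i < m" "v \<in> V"
  have "slot i v < Suc i * \<kappa>" using home_less[OF i(2), of i] by (simp add: slot_def)
  also have "\<dots> \<le> m * \<kappa>" using i by (intro mult_right_mono) auto
  finally show ?thesis using home_less[OF i(2), of i] by (simp add: slot_def)
qed

lemma slot_top: "slot m v = m * \<kappa>" by (simp add: slot_def home_def)

text \<open>The constant: a route inside a cluster costs at most
  \<open>4 * crad i + 4 * rad i = (8 * J + 8) * rad i\<close>, where
  \<open>J <= 2 * b * log 2 n + 1\<close> and \<open>2 <= b * log 2 n\<close>.\<close>

definition \<Lambda> :: "nat \<Rightarrow> real" where "\<Lambda> i = 24 * b * log 2 n * rad i"

lemma log2_n: "1 \<le> log 2 n" "ln n \<le> log 2 n"
proof -
  show "1 \<le> log 2 n" using n2 by (simp add: le_log_iff)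
  have "ln 2 \<le> (1 :: real)" using ln_le_minus_one[of 2] by simp
  then have "ln n * ln 2 \<le> ln (real n) * 1" using ln_n by (intro mult_left_mono) auto
  then show "ln n \<le> log 2 n" by (simp add: log_def field_simps)
qed

lemma \<Lambda>_ge: "4 * crad i + 4 * rad i \<le> \<Lambda> i" "2 * rad i \<le> \<Lambda> i"
proof -
  have bl: "2 * 1 \<le> b * log 2 n" using b2 log2_n by (intro mult_mono) auto
  have "b * ln n \<le> b * log 2 n" using b2 log2_n by (intro mult_left_mono) auto
  then have "8 * real J + 8 \<le> 24 * b * log 2 n" using J_bounds(2) bl by simp
  then have "(8 * real J + 8) * rad i \<le> \<Lambda> i"
    unfolding \<Lambda>_def using rad_pos[of i] by (intro mult_right_mono) auto
  then show *: "4 * crad i + 4 * rad i \<le> \<Lambda> i" by (simp add: crad_def algebra_simps)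
  have "0 \<le> crad i" using rad_pos[of i] by (simp add: crad_def)
  then show "2 * rad i \<le> \<Lambda> i" using * rad_pos[of i] by auto
qed

lemma leveled: "leveled_clusters V E w rr par dep (m * \<kappa> + 1) scl score spi sD stau srho m slot \<Lambda>"
proof unfold_locales
  fix s u x assume s: "s < m * \<kappa> + 1" and u: "u \<in> V" "scl s u = Some x"
  have q: "s mod \<kappa> < \<kappa>" using \<kappa>_pos by simp
  show "x \<in> V" using u hub ctr_props(2)[OF q] by (auto simp: scl_def split: if_splits)
  show "0 \<le> sD s u \<and> sD s u \<le> srho s" using slot_tree[OF u] by blast
  show "spi s u \<in> V \<and> scl s (spi s u) = Some x \<and> (u, spi s u) \<in> E \<and>
       sD s (spi s u) + w (u, spi s u) \<le> sD s u" if "\<not> score s u"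
    using slot_tree[OF u] that by blast
  fix v assume v: "v \<in> V" "scl s v = Some x" "score s u" "score s v" "u \<noteq> v"
  show "score s (next_hop V par u v) \<and> scl s (next_hop V par u v) = Some x \<and>
      (u, next_hop V par u v) \<in> E \<and> w (u, next_hop V par u v) \<le> stau s"
  proof (cases "s < m * \<kappa>")
    case True
    show ?thesis
      using u v True lcore_step[OF q, of "s div \<kappa>" u x v] by (simp add: scl_def score_def stau_def)
  next
    case False
    then show ?thesis using v by (simp add: score_def)
  qed
next
  show "0 \<le> stau s" for s using thr_pos[of "s div \<kappa>"] by (simp add: stau_def)
next
  fix i v assume i: "i \<le> m" and v: "v \<in> V"
  have im: "i = m \<or> i < m" using i by auto
  show "slot i v < m * \<kappa> + 1" using im slot_level[OF _ v, of i] slot_top[of v] by (metis add.commute less_SucI lessI plus_1_eq_Suc)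
  show "scl (slot i v) v \<noteq> None"
  proof (cases "i = m")
    case False
    then have il: "i < m" using i by simp
    obtain x where x: "ball E (Wt i) V v (rad i) \<subseteq> cluster_of (ctr i (home i v)) x"
      using home_ball[OF v il] by blast
    have "v \<in> ball E (Wt i) V v (rad i)" using rad_pos[of i] by (intro Wi.center_in_ball v) simp
    then show ?thesis using x slot_level[OF il v] by (auto simp: scl_def Wi.cluster_of_def)
  qed (simp add: slot_top scl_def)
  show "2 * srho (slot i v) + real (2 * n) * stau (slot i v) \<le> \<Lambda> i"
  proof (cases "i = m")
    case True
    then show ?thesis using \<Lambda>_ge(2)[of m] by (simp add: slot_top srho_def stau_def)
  next
    case False
    then have il: "i < m" using i by simp
    have "2 * srho (slot i v) + real (2 * n) * stau (slot i v) = 4 * crad i + 4 * (n * thr i)"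
      using slot_level[OF il v] by (simp add: srho_def stau_def)
    then show ?thesis using n_thr[of i] \<Lambda>_ge(1)[of i] by simp
  qed
next
  show "scl (slot m v) u = scl (slot m v) v" for u v by (simp add: slot_top scl_def)
qed

interpretation L: leveled_clusters V E w rr par dep "m * \<kappa> + 1" scl score spi sD stau srho m slot \<Lambda>
  by (rule leveled)

lemma lev_bound:
  assumes u: "u \<in> V" and v: "v \<in> V" and i: "i < m" and d: "dd u v \<le> rad i"
  shows "L.lev u v \<le> i"
proof (rule L.lev_le)
  obtain x where x: "ball E (Wt i) V v (rad i) \<subseteq> cluster_of (ctr i (home i v)) x"
    using home_ball[OF v i] by blast
  obtain l where l: "l \<le> dd u v" "reach E w V u v l" using dd_reach[OF u v] by blast
  obtain l' where l': "l' \<le> l" "reach E (Wt i) V u v l'" using reach_Wt[OF l(2)] by blast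
  have "u \<in> ball E (Wt i) V v (rad i)" using l l' d by (auto simp: ball_def intro!: exI[of _ l'])
  moreover have "v \<in> ball E (Wt i) V v (rad i)" using rad_pos[of i] by (intro Wi.center_in_ball v) simp
  ultimately have "ctr i (home i v) u = Some x" "ctr i (home i v) v = Some x"
    using x by (auto simp: Wi.cluster_of_def)
  then show "scl (slot i v) u = scl (slot i v) v"
    using slot_level[OF i v] by (simp add: scl_def)
qed

lemma sum_\<Lambda>: "(\<Sum>i\<le>k. \<Lambda> i) \<le> 48 * b * log 2 n * rad k"
proof -
  have "(\<Sum>i\<le>k. rad i) \<le> 2 * rad k"
  proof (induction k)
    case (Suc k)
    have "2 * rad k \<le> b * rad k" using b2 rad_pos[of k] by (intro mult_right_mono) auto
    then show ?case using Suc by (simp add: rad_def)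
  qed (use rad_pos[of 0] in simp)
  then have "24 * b * log 2 n * (\<Sum>i\<le>k. rad i) \<le> 24 * b * log 2 n * (2 * rad k)"
    using b2 log2_n by (intro mult_left_mono) auto
  moreover have "(\<Sum>i\<le>k. \<Lambda> i) = 24 * b * log 2 n * (\<Sum>i\<le>k. rad i)"
    by (simp add: \<Lambda>_def sum_distrib_left)
  ultimately show ?thesis by simp
qed

text \<open>One factor \<open>b\<close> is due to the radius of clusters and contained in
  \<open>\<Lambda>\<close>; the other arises from rounding the distance up to the next
  scale.\<close>

lemma stretch:
  assumes u: "u \<in> V" and v: "v \<in> V" and d: "1 \<le> dd u v"
  shows "L.\<Psi> u v \<le> 48 * b\<^sup>2 * log 2 n * dd u v"
proof -
  have "\<exists>i. L.lev u v \<le> i \<and> rad i \<le> b * dd u v"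
  proof -
    define P where "P i \<longleftrightarrow> dd u v \<le> rad i" for i
    have Pm: "P m" using dd_top[OF u v] by (simp add: P_def rad_def)
    define i where "i = (LEAST i. P i)"
    have i: "P i" "i \<le> m" using LeastI[of P m] Least_le[of P m] Pm by (auto simp: i_def)
    have "L.lev u v \<le> i"
    proof (cases "i = m")
      case True
      then show ?thesis using L.lev[OF u v] by simp
    next
      case False
      then show ?thesis using lev_bound[OF u v, of i] i by (simp add: P_def)
    qed
    \<comment> \<open>Even the lowest scale \<open>rad 0 = b\<close> overshoots by no more than the
      factor \<open>b\<close>, because the distance is at least \<open>1\<close>.\<close>
    moreover have "rad i \<le> b * dd u v"
    proof (cases i)
      case 0
      then show ?thesis using d b2 by (simp add: rad_def)
    next
      case (Suc i')
      then have "\<not> P i'" using not_less_Least[of i' P] by (simp add: i_def)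
      then have "b * rad i' \<le> b * dd u v" using b2 by (intro mult_left_mono) (auto simp: P_def)
      then show ?thesis using Suc by (simp add: rad_def)
    qed
    ultimately show ?thesis by blast
  qed
  then obtain i where i: "L.lev u v \<le> i" "rad i \<le> b * dd u v" by blast
  have "L.\<Psi> u v \<le> (\<Sum>i\<le>L.lev u v. \<Lambda> i)" by (rule L.\<Psi>_bounds[OF u v])
  also have "\<dots> \<le> 48 * b * log 2 n * rad (L.lev u v)" by (rule sum_\<Lambda>)
  also have "\<dots> \<le> 48 * b * log 2 n * (b * dd u v)"
  proof (rule mult_left_mono)
    have "rad (L.lev u v) \<le> rad i" unfolding rad_def using i b2 by (intro power_increasing) auto
    then show "rad (L.lev u v) \<le> b * dd u v" using i by simp
    show "0 \<le> 48 * b * log 2 n" using b2 log2_n by simp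
  qed
  finally show ?thesis by (simp add: power2_eq_square mult_ac)
qed

text \<open>The binary logarithm \<open>\<phi>\<close> of the component size rises by at least one
  from \<open>i\<close> to \<open>i + g\<close> whenever \<open>u\<close> is not giant at scale
  \<open>i\<close>. In the sum of these differences, shifting the index leaves only \<open>g\<close>
  terms, each at most \<open>log 2 n\<close>. The bound is free of \<open>m\<close>, hence of the
  diameter.\<close>

lemma active_levels:
  assumes u: "u \<in> V"
  shows "card {i. i < m \<and> \<not> giant i u} \<le> g * log 2 n"
proof -
  define \<phi> where "\<phi> i = log 2 (card (comp (thr i) u))" for i
  have pos: "1 \<le> card (comp (thr i) u)" for i
    using finite_comp[OF u, of "thr i"] near_refl by (auto simp: comp_def Suc_le_eq card_gt_0_iff)
  have le_n: "card (comp (thr i) u) \<le> n" for i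
    using finite_V near_V u by (intro card_mono) (auto simp: comp_def)
  have \<phi>: "0 \<le> \<phi> i" "\<phi> i \<le> log 2 n" for i
    using pos[of i] le_n[of i] by (auto simp: \<phi>_def)
  have mono: "\<phi> i \<le> \<phi> (i + g)" for i
  proof -
    have "card (comp (thr i) u) \<le> card (comp (thr (i + g)) u)"
      using near_mono[OF thr_mono[of i "i + g"]] finite_comp[OF u] by (intro card_mono) (auto simp: comp_def)
    then show ?thesis using pos[of i] by (simp add: \<phi>_def)
  qed
  have step: "\<phi> i + 1 \<le> \<phi> (i + g)" if "\<not> giant i u" for i
  proof -
    have "2 * real (card (comp (thr i) u)) \<le> card (comp (thr (i + g)) u)"
      using that by (simp add: giant_def)
    then have "log 2 (2 * real (card (comp (thr i) u))) \<le> \<phi> (i + g)"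
      using pos[of i] pos[of "i + g"] unfolding \<phi>_def by (subst log_le_cancel_iff) auto
    then show ?thesis using pos[of i] by (simp add: \<phi>_def log_mult)
  qed
  have tele: "(\<Sum>i<m. \<phi> (i + g) - \<phi> i) = (\<Sum>i<g. \<phi> (i + m) - \<phi> i)"
  proof -
    have "(\<Sum>i<m. \<phi> (i + g)) + (\<Sum>i<g. \<phi> i) = (\<Sum>i<m + g. \<phi> i)" for m g
      by (induction m) (auto simp: add.commute)
    from this[of m g] this[of g m] show ?thesis by (simp add: sum_subtractf add.commute)
  qed
  have "real (card {i. i < m \<and> \<not> giant i u}) = (\<Sum>i\<in>{i. i < m \<and> \<not> giant i u}. 1)" by simp
  also have "\<dots> \<le> (\<Sum>i\<in>{i. i < m \<and> \<not> giant i u}. \<phi> (i + g) - \<phi> i)"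
    using step by (intro sum_mono) (auto simp: algebra_simps)
  also have "\<dots> \<le> (\<Sum>i<m. \<phi> (i + g) - \<phi> i)"
    using mono by (intro sum_mono2) auto
  also have "\<dots> = (\<Sum>i<g. \<phi> (i + m) - \<phi> i)" by (rule tele)
  also have "\<dots> \<le> (\<Sum>i<g. log 2 n)"
  proof (rule sum_mono)
    show "\<phi> (i + m) - \<phi> i \<le> log 2 n" for i using \<phi>(2)[of "i + m"] \<phi>(1)[of i] by simp
  qed
  finally show ?thesis by simp
qed

text \<open>Each active scale contributes at most \<open>\<kappa>\<close> slots. The summand
  \<open>2\<close> is for the slot of the top level and for the spanning tree.\<close>

lemma hang_count:
  assumes u: "u \<in> V" and H: "log 2 n \<le> real (H ^ 2)"
  shows "card {s. u \<in> L.hang s} + 1 \<le> \<kappa> * (g * H ^ 2) + 2"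
proof -
  define X where "X = {i. i < m \<and> \<not> giant i u}"
  have finX: "finite X" by (simp add: X_def)
  have "real (card X) \<le> g * log 2 n" using active_levels[OF u] by (simp add: X_def)
  also have "\<dots> \<le> real (g * H ^ 2)" using H by (simp add: mult_left_mono)
  finally have cX: "card X \<le> g * H ^ 2" by (simp only: of_nat_le_iff)
  have "{s. u \<in> L.hang s} \<subseteq> insert (m * \<kappa>) ((\<lambda>(i, q). i * \<kappa> + q) ` (X \<times> {..<\<kappa>}))"
  proof
    fix s assume "s \<in> {s. u \<in> L.hang s}"
    then have s: "s < m * \<kappa> + 1" "\<not> score s u" using L.hangD[of u s] by blast+
    show "s \<in> insert (m * \<kappa>) ((\<lambda>(i, q). i * \<kappa> + q) ` (X \<times> {..<\<kappa>}))"
    proof (cases "s = m * \<kappa>")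
      case False
      then have sm: "s < m * \<kappa>" using s by simp
      then have "\<not> giant (s div \<kappa>) u" using s lcore_noncore by (simp add: score_def)
      moreover have "s div \<kappa> < m" using sm by (simp add: less_mult_imp_div_less)
      ultimately have "(s div \<kappa>, s mod \<kappa>) \<in> X \<times> {..<\<kappa>}" using \<kappa>_pos by (simp add: X_def)
      moreover have "s = (\<lambda>(i, q). i * \<kappa> + q) (s div \<kappa>, s mod \<kappa>)" by simp
      ultimately show ?thesis by blast
    qed simp
  qed
  then have "card {s. u \<in> L.hang s} \<le> card (insert (m * \<kappa>) ((\<lambda>(i, q). i * \<kappa> + q) ` (X \<times> {..<\<kappa>})))"
    using finX by (intro card_mono) auto
  also have "\<dots> \<le> Suc (card ((\<lambda>(i, q). i * \<kappa> + q) ` (X \<times> {..<\<kappa>})))"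
    using finX by (simp add: card_insert_if)
  also have "\<dots> \<le> Suc (card (X \<times> {..<\<kappa>}))" using finX card_image_le[of "X \<times> {..<\<kappa>}"] by blast
  also have "card (X \<times> {..<\<kappa>}) = \<kappa> * card X" by (simp add: card_cartesian_product mult.commute)
  also have "\<kappa> * card X \<le> \<kappa> * (g * H ^ 2)" using cX by (rule mult_left_mono) simp
  finally show ?thesis by simp
qed

end

section \<open>The routing scheme\<close>

text \<open>With \<open>h\<close> the integer part of \<open>sqrt x\<close>, take
  \<open>H = h + 1\<close>: then \<open>H <= 2 ^ h\<close> gives
  \<open>H ^ H <= 2 ^ (h * (h + 1))\<close>, whose exponent is at most \<open>2 * x\<close>. For
  \<open>x = log 2 n\<close> this makes \<open>H ^ H\<close> at most \<open>n ^ 2\<close>.\<close>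

lemma self_power_bound:
  fixes x :: real
  assumes "1 \<le> x"
  shows "\<exists>H :: nat. 2 \<le> H \<and> x \<le> real (H ^ 2) \<and> real (H ^ H) \<le> 2 powr (2 * x)"
proof -
  define h where "h = nat \<lfloor>sqrt x\<rfloor>"
  have s: "1 \<le> sqrt x" using assms by simp
  have h: "real h \<le> sqrt x" "sqrt x < real h + 1" "1 \<le> h" using s unfolding h_def by linarith+
  have "x = (sqrt x)\<^sup>2" using assms by simp
  also have "\<dots> \<le> (real h + 1)\<^sup>2" using h s by (intro power_mono) auto
  finally have x: "x \<le> real ((h + 1) ^ 2)" by (simp add: add.commute)
  have "h + 1 \<le> 2 ^ h" by (induction h) auto
  then have "(h + 1) ^ (h + 1) \<le> (2 ^ h) ^ (h + 1)" by (rule power_mono) simp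
  also have "\<dots> = 2 ^ (h * (h + 1))" by (rule power_mult[symmetric])
  finally have "real ((h + 1) ^ (h + 1)) \<le> real (2 ^ (h * (h + 1)))" by (rule of_nat_mono)
  also have "\<dots> = 2 powr (real h * (real h + 1))"
    using powr_realpow[of 2 "h * (h + 1)"] by (simp add: algebra_simps)
  also have "\<dots> \<le> 2 powr (2 * x)"
  proof (rule powr_mono)
    have "real h * (real h + 1) \<le> sqrt x * (2 * sqrt x)" using h s by (intro mult_mono; linarith)
    also have "\<dots> = 2 * x" using assms by simp
    finally show "real h * (real h + 1) \<le> 2 * x" .
  qed simp
  finally have "real ((h + 1) ^ (h + 1)) \<le> 2 powr (2 * x)" .
  then show ?thesis using x h by (intro exI[of _ "h + 1"]) simp
qed

lemma (in ported_clusters) length_words: "length (lab v) = 6 * Suc m" "length (tab v) = 9 * Suc S"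
  by (simp_all add: lab_def tab_def)

context wgraph
begin

text \<open>The restriction \<open>k <= log 2 (card V)\<close> ensures \<open>b >= 2\<close>. The
  potential \<open>\<Psi>\<close> is part of the conclusion because both the arrival and the length
  of a route are derived from its descent.\<close>

lemma scheme_exists:
  fixes k \<Delta> :: real and dd :: "'a \<Rightarrow> 'a \<Rightarrow> real"
  assumes n2: "2 \<le> card V" and k: "1 \<le> k" "k \<le> log 2 (card V)" and \<Delta>: "1 \<le> \<Delta>"
    and dd_reach: "\<And>u v. u \<in> V \<Longrightarrow> v \<in> V \<Longrightarrow> \<exists>l\<le>dd u v. reach E w V u v l"
    and dd_\<Delta>: "\<And>u v. u \<in> V \<Longrightarrow> v \<in> V \<Longrightarrow> dd u v \<le> \<Delta>"
    and dd1: "\<And>u v. u \<in> V \<Longrightarrow> v \<in> V \<Longrightarrow> u \<noteq> v \<Longrightarrow> 1 \<le> dd u v"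
  shows "\<exists>lab tab port nh \<Psi>.
    (\<forall>u\<in>V. bij_betw (port u) (E `` {u}) {..<card (E `` {u})} \<and>
       (\<forall>x\<in>set (lab u) \<union> set (tab u). x < card V ^ 54) \<and>
       real (length (lab u)) \<le> 36 * max 1 (k * log (card V) \<Delta>) \<and>
       real (length (tab u)) \<le> 36 * max 1 (k\<^sup>2 * log (card V) \<Delta>)) \<and>
    (\<forall>u\<in>V. \<forall>v\<in>V. 0 \<le> \<Psi> u v \<and> (u \<noteq> v \<longrightarrow>
       (u, nh u v) \<in> E \<and> w (u, nh u v) + \<Psi> (nh u v) v \<le> \<Psi> u v \<and>
       decide (tab u) (lab v) = port u (nh u v) \<and>
       \<Psi> u v \<le> 48 * card V powr (2 / k) * log 2 (card V) * dd u v))"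
proof -
  let ?n = "real (card V)"
  have n: "2 \<le> ?n" using n2 by simp
  define b where "b = ?n powr (1 / k)"
  define L where "L = k * log ?n \<Delta>"
  \<comment> \<open>As \<open>b powr L\<close> is \<open>\<Delta>\<close>, the scale
    \<open>b ^ (m + 1)\<close> reaches the diameter.\<close>
  define m where "m = nat \<lfloor>L\<rfloor>"
  \<comment> \<open>Strictly above \<open>k\<close>, so that \<open>b ^ \<kappa>\<close> exceeds
    \<open>n\<close>.\<close>
  define \<kappa> where "\<kappa> = nat \<lfloor>k\<rfloor> + 1"
  define g where "g = nat \<lceil>8 * k\<rceil>"
  obtain H :: nat where H: "2 \<le> H" "log 2 ?n \<le> real (H ^ 2)" "real (H ^ H) \<le> 2 powr (2 * log 2 ?n)"
    using self_power_bound[of "log 2 ?n"] k by auto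
  have b_powr: "b powr x = ?n powr (x / k)" for x
    unfolding b_def by (simp add: powr_powr)
  have b2: "2 \<le> b"
  proof -
    have "2 powr k \<le> ?n" using k n by (simp add: le_log_iff)
    then have "(2 powr k) powr (1 / k) \<le> b" unfolding b_def using k by (intro powr_mono2) auto
    then show ?thesis using k by (simp add: powr_powr)
  qed
  have b_le: "b \<le> ?n"
    using powr_mono[of "1 / k" 1 ?n] k n by (simp add: b_def)
  have log_\<Delta>: "0 \<le> log ?n \<Delta>" using \<Delta> n by simp
  have L: "0 \<le> L" "real m \<le> L" "L < real m + 1"
  proof -
    show "0 \<le> L" using k log_\<Delta> by (simp add: L_def)
    then show "real m \<le> L" "L < real m + 1" unfolding m_def by linarith+
  qed
  have \<kappa>: "k < real \<kappa>" "real \<kappa> \<le> k + 1" using k unfolding \<kappa>_def by linarith+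
  have g: "8 * k \<le> real g" "real g \<le> 8 * k + 1" using k unfolding g_def by linarith+
  have n\<kappa>: "?n < b ^ \<kappa>"
  proof -
    have "?n powr 1 < ?n powr (real \<kappa> / k)" using n k \<kappa> by (intro powr_less_mono) auto
    also have "\<dots> = b powr real \<kappa>" by (rule b_powr[symmetric])
    finally show ?thesis using n b2 by (simp add: powr_realpow)
  qed
  have ng: "?n ^ 8 \<le> b ^ g"
  proof -
    have "?n powr 8 \<le> ?n powr (real g / k)" using n k g by (intro powr_mono) (auto simp: field_simps)
    also have "\<dots> = b powr real g" by (rule b_powr[symmetric])
    finally show ?thesis using n b2 by (simp add: powr_realpow)
  qed
  have top: "\<Delta> \<le> b ^ Suc m"
  proof -
    have "log ?n \<Delta> \<le> real (Suc m) / k" using L k by (simp add: L_def field_simps)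
    then have "?n powr log ?n \<Delta> \<le> ?n powr (real (Suc m) / k)" using n by (intro powr_mono) auto
    also have "\<dots> = b powr real (Suc m)" by (rule b_powr[symmetric])
    finally show ?thesis using n b2 \<Delta> by (simp add: powr_realpow del: of_nat_Suc power_Suc)
  qed
  have HH: "H ^ H \<le> card V ^ 2"
  proof -
    have "2 powr (2 * log 2 ?n) = (2 powr log 2 ?n) powr 2" by (simp add: powr_powr mult.commute)
    also have "\<dots> = ?n ^ 2" using n by (simp add: powr_numeral)
    finally have "real (H ^ H) \<le> real (card V ^ 2)" using H(3) by simp
    then show ?thesis by (simp only: of_nat_le_iff)
  qed
  define t where "t = \<kappa> * (g * H ^ 2) + 2"
  have k_H: "k \<le> real (H ^ 2)" using H(2) k by simp
  have H1: "1 \<le> real (H ^ 2)" using H(1) by simp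
  have \<kappa>_H: "\<kappa> \<le> 2 * H ^ 2"
  proof -
    have "real \<kappa> \<le> 2 * real (H ^ 2)" using \<kappa>(2) k_H H1 by linarith
    then have "real \<kappa> \<le> real (2 * H ^ 2)" by simp
    then show ?thesis by (simp only: of_nat_le_iff)
  qed
  have g_H: "g \<le> 9 * H ^ 2"
  proof -
    have "real g \<le> 9 * real (H ^ 2)" using g(2) k_H H1 by linarith
    then have "real g \<le> real (9 * H ^ 2)" by simp
    then show ?thesis by (simp only: of_nat_le_iff)
  qed
  \<comment> \<open>With \<open>k\<close> at most \<open>H ^ 2\<close>, the count is at most
    \<open>18 * H ^ 6 + 2\<close>; the constants are absorbed by \<open>H ^ 5 >= 32\<close>.\<close>
  have t_H: "t \<le> H ^ 11"
  proof -
    have "t \<le> (2 * H ^ 2) * ((9 * H ^ 2) * H ^ 2) + 2"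
      unfolding t_def using \<kappa>_H g_H by (intro add_mono mult_mono) auto
    also have "\<dots> = 18 * H ^ 6 + 2" by (simp add: power_add[symmetric] mult.assoc flip: power_add)
    also have "\<dots> \<le> 32 * H ^ 6" using H(1) by simp
    also have "\<dots> \<le> H ^ 5 * H ^ 6" using power_mono[OF H(1), of 5] by (intro mult_right_mono) auto
    also have "\<dots> = H ^ 11" by (simp flip: power_add)
    finally show ?thesis .
  qed
  \<comment> \<open>One power of \<open>H\<close> beyond the bound on \<open>t\<close>, as
    \<open>t * H <= B\<close> is required; \<open>B ^ H\<close> is then a power of
    \<open>H ^ H\<close>.\<close>
  define B where "B = H ^ 12"
  have BH: "B ^ H \<le> card V ^ 24"
  proof -
    have "B ^ H = (H ^ H) ^ 12" by (simp add: B_def mult.commute flip: power_mult)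
    also have "\<dots> \<le> (card V ^ 2) ^ 12" using HH by (rule power_mono) simp
    finally show ?thesis by (simp flip: power_mult)
  qed
  have \<kappa>_n: "\<kappa> \<le> card V ^ 24"
  proof -
    have "\<kappa> \<le> 2 * H ^ 2" by (rule \<kappa>_H)
    also have "\<dots> \<le> H ^ 1 * H ^ 2" using H(1) by (intro mult_right_mono) auto
    also have "\<dots> \<le> B" unfolding B_def power_add[symmetric] using H(1) by (intro power_increasing) auto
    also have "B \<le> B ^ H" using H(1) by (intro self_le_power) (auto simp: B_def)
    finally show ?thesis using BH by simp
  qed
  obtain rr par dep where pt: "prim_tree V rr par dep" using prim_tree_exists by blast
  interpret P: prim V E w rr par dep by unfold_locales (rule pt)
  interpret S: scales V E w rr par dep b \<kappa> g m dd
  proof unfold_locales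
    show "dd u v \<le> b ^ Suc m" if "u \<in> V" "v \<in> V" for u v using dd_\<Delta>[OF that] top by simp
  qed (use n2 b2 b_le n\<kappa> ng dd_reach in auto)
  interpret L: leveled_clusters V E w rr par dep "m * \<kappa> + 1" S.scl S.score S.spi S.sD S.stau S.srho m S.slot S.\<Lambda>
    by (rule S.leveled)
  interpret C: coded_clusters V E w rr par dep "m * \<kappa> + 1" S.scl S.score S.spi S.sD S.stau S.srho m S.slot S.\<Lambda>
    \<kappa> S.home H 11 t B 24
  proof unfold_locales
    show "card {s. u \<in> L.hang s} + 1 \<le> t" if "u \<in> V" for u
      unfolding t_def using S.hang_count[OF that H(2)] by simp
    show "t * H \<le> B" using mult_right_mono[OF t_H, of H] by (simp add: B_def eval_nat_numeral)
    show "0 < B" using H(1) by (simp add: B_def)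
    show "S.home i v \<le> \<kappa>" if "v \<in> V" for i v using S.home_less[OF that, of i] by simp
  qed (use H t_H n2 BH \<kappa>_n in \<open>auto simp: S.slot_def\<close>)
  obtain rk port where rp: "\<And>u. u \<in> V \<Longrightarrow> bij_betw (port u) (E `` {u}) {..<card (E `` {u})}"
    "\<And>q. coded_forest (C.FA q) (C.Ff q) (C.Fd q) (rk q) port H 11 t B"
    using C.ports_exist by blast
  obtain nm where nm: "bij_betw nm V {0..<card V}" using ex_bij_betw_finite_nat[OF finite_V] by blast
  interpret R: ported_clusters V E w rr par dep "m * \<kappa> + 1" S.scl S.score S.spi S.sD S.stau S.srho m S.slot S.\<Lambda>
    \<kappa> S.home H 11 t B 24 rk port nm
  proof (intro ported_clusters.intro ported_clusters_axioms.intro)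
    show "inj_on nm V" "\<And>u. u \<in> V \<Longrightarrow> nm u < card V" using nm by (auto simp: bij_betw_def)
  qed (rule C.coded_clusters_axioms rp; assumption?)+
  \<comment> \<open>\<open>24\<close> for the packed ports, \<open>29 = 2 * 11 + 7\<close> for
    positions, and \<open>1\<close> for strictness.\<close>
  have c: "R.c = 54" by (simp add: R.c_def coded_forest.e_def[OF rp(2)])
  have len_lab: "real (length (R.lab v)) \<le> 36 * max 1 (k * log ?n \<Delta>)" for v
  proof -
    have "real (length (R.lab v)) = 6 * (real m + 1)" unfolding R.length_words by simp
    also have "\<dots> \<le> 36 * max 1 L" using L by simp
    finally show ?thesis by (simp add: L_def)
  qed
  have len_tab: "real (length (R.tab v)) \<le> 36 * max 1 (k\<^sup>2 * log ?n \<Delta>)" for v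
  proof -
    \<comment> \<open>There are \<open>m * \<kappa> + 1\<close> slots, and
      \<open>\<kappa> <= 2 * k\<close> because \<open>k >= 1\<close>: the second factor
      \<open>k\<close> in the table size is the number of rounds.\<close>
    have "real m * real \<kappa> \<le> L * (2 * k)" using L \<kappa> k by (intro mult_mono) auto
    moreover have "real (length (R.tab v)) = 9 * (real m * real \<kappa> + 2)"
      unfolding R.length_words by simp
    ultimately have "real (length (R.tab v)) \<le> 18 * (k * L) + 18" by (simp add: mult_ac)
    also have "\<dots> \<le> 36 * max 1 (k * L)" by simp
    finally show ?thesis by (simp add: L_def power2_eq_square mult.assoc)
  qed
  have stretch: "L.\<Psi> u v \<le> 48 * ?n powr (2 / k) * log 2 ?n * dd u v"
    if "u \<in> V" "v \<in> V" "u \<noteq> v" for u v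
  proof -
    have "b\<^sup>2 = ?n powr (2 / k)" using b_powr[of 2] b2 by (simp add: powr_numeral)
    then show ?thesis using S.stretch[OF that(1,2) dd1[OF that]] by simp
  qed
  show ?thesis
  proof (rule exI[of _ R.lab], rule exI[of _ R.tab], rule exI[of _ port], rule exI[of _ L.nh],
      rule exI[of _ L.\<Psi>], intro conjI ballI impI)
    fix u assume u: "u \<in> V"
    show "bij_betw (port u) (E `` {u}) {..<card (E `` {u})}" by (rule rp(1)[OF u])
    show "x < card V ^ 54" if "x \<in> set (R.lab u) \<union> set (R.tab u)" for x
      using R.lab_words[OF u] R.tab_words[OF u] that c by auto
  next
    fix u v assume "u \<in> V" "v \<in> V"
    then show "0 \<le> L.\<Psi> u v" by (rule L.\<Psi>_bounds)
  next
    fix u v assume uv: "u \<in> V" "v \<in> V" "u \<noteq> v"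
    show "(u, L.nh u v) \<in> E" "w (u, L.nh u v) + L.\<Psi> (L.nh u v) v \<le> L.\<Psi> u v"
      using L.nh_step[OF uv] by auto
    show "decide (R.tab u) (R.lab v) = port u (L.nh u v)" by (rule R.decide_correct[OF uv])
  qed (use len_lab len_tab stretch in auto)
qed

end

text \<open>Edges weigh at least \<open>1\<close>, so the integer part of \<open>\<Psi>\<close>
  falls with every hop: the message arrives, and the lengths add up to at most the initial
  value.\<close>

lemma routing_path_descent:
  fixes \<Psi> :: "'a \<Rightarrow> 'a \<Rightarrow> real"
  assumes step: "\<And>u. u \<in> V \<Longrightarrow> u \<noteq> v \<Longrightarrow> nh u \<in> neighbors G u \<and> nh u \<in> V \<and> 1 \<le> w (u, nh u) \<and>
      w (u, nh u) + \<Psi> (nh u) v \<le> \<Psi> u v \<and> port S u (nh u) = F (table S u) (label S v)"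
    and nonneg: "\<And>u. u \<in> V \<Longrightarrow> 0 \<le> \<Psi> u v" and u: "u \<in> V"
  shows "\<exists>p. routing_path G F S u v p \<and> sum_list (map w p) \<le> \<Psi> u v"
  using u
proof (induction "nat \<lfloor>\<Psi> u v\<rfloor>" arbitrary: u rule: less_induct)
  case less
  show ?case
  proof (cases "u = v")
    case True
    then show ?thesis using routing_path.arrived[of G F S v] nonneg[OF less.prems] by (intro exI[of _ "[]"]) simp
  next
    case False
    note st = step[OF less.prems False]
    have "nat \<lfloor>\<Psi> (nh u) v\<rfloor> < nat \<lfloor>\<Psi> u v\<rfloor>"
      using st nonneg[of "nh u"] by linarith
    then obtain p where "routing_path G F S (nh u) v p" "sum_list (map w p) \<le> \<Psi> (nh u) v"
      using less.hyps st by blast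
    then show ?thesis
      using st False by (intro exI[of _ "(u, nh u) # p"]) (auto intro: routing_path.forward)
  qed
qed

section \<open>Transfer to graphs with their shortest-path metric\<close>

context normalized_weighted_graph
begin

lemma \<mu>_attained:
  assumes "u \<in> pverts G" "v \<in> pverts G"
  shows "\<exists>p. awalk u p v \<and> \<mu> w u v = ereal (awalk_cost w p)"
proof -
  have "strongly_connected (with_proj G)"
    using symmetric_connected_imp_strongly_connected[OF pair_sym_arcs connected_G] .
  then have "reachable (with_proj G) u v" using assms by (auto simp: strongly_connected_def)
  then obtain p where "apath u p v" "\<mu> w u v = ereal (awalk_cost w p)"
    using min_cost_awalk[of u v w] weight_nonneg by auto
  then show ?thesis by (auto simp: apath_def)
qed

lemma graph_dist_le_weight: "(u, v) \<in> parcs G \<Longrightarrow> graph_dist u v \<le> w (u, v)"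
proof -
  assume uv: "(u, v) \<in> parcs G"
  then have "awalk u [(u, v)] v" by (simp add: awalk_Cons_iff awalk_Nil_iff wellformed')
  then have le: "\<mu> w u v \<le> ereal (awalk_cost w [(u, v)])" by (rule min_cost_le_walk_cost)
  obtain p where "\<mu> w u v = ereal (awalk_cost w p)" using \<mu>_attained uv wellformed' by blast
  then show ?thesis using le by (simp add: graph_dist_def)
qed

lemma wgraph: "wgraph (pverts G) (parcs G) w"
proof unfold_locales
  show "finite (pverts G)" by (rule pair_finite_verts)
  show "parcs G \<subseteq> pverts G \<times> pverts G" using wellformed' by auto
  show "pverts G \<noteq> {}" using dist_eq_1 by blast
  fix x y
  show "(y, x) \<in> parcs G" "w (x, y) = w (y, x)" "0 \<le> w (x, y)" "1 \<le> w (x, y)" if xy: "(x, y) \<in> parcs G"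
  proof -
    show "(y, x) \<in> parcs G" using arcs_symmetric xy .
    show "w (x, y) = w (y, x)" using weight_sym xy .
    show "0 \<le> w (x, y)" using weight_nonneg xy .
    have "1 \<le> graph_dist x y" using dist_ge_1 wellformed' xy no_loops' by blast
    then show "1 \<le> w (x, y)" using graph_dist_le_weight[OF xy] by simp
  qed
  assume xy: "x \<in> pverts G" "y \<in> pverts G"
  then obtain p where "awalk x p y" using \<mu>_attained by blast
  then have "reachable (with_proj G) x y" by (rule reachable_awalkI)
  then show "(x, y) \<in> (parcs G)\<^sup>*" using reachable_rtranclI by fastforce
qed

lemma awalk_reach: "awalk u p v \<Longrightarrow> reach (parcs G) w (pverts G) u v (awalk_cost w p)"
proof (induction p arbitrary: u)
  case Nil
  then show ?case by (auto simp: awalk_Nil_iff intro: reach.refl)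
next
  case (Cons e p)
  obtain x y where e: "e = (x, y)" by (cases e)
  then show ?case using Cons wellformed' by (auto simp: awalk_Cons_iff intro!: reach.step)
qed

lemma graph_dist_reach:
  "u \<in> pverts G \<Longrightarrow> v \<in> pverts G \<Longrightarrow> reach (parcs G) w (pverts G) u v (graph_dist u v)"
  using \<mu>_attained[of u v] awalk_reach by (force simp: graph_dist_def)

lemma graph_dist_le_diameter: "u \<in> pverts G \<Longrightarrow> v \<in> pverts G \<Longrightarrow> graph_dist u v \<le> diameter"
proof -
  assume uv: "u \<in> pverts G" "v \<in> pverts G"
  have "{graph_dist u v | u v. u \<in> pverts G \<and> v \<in> pverts G} = (\<lambda>(u, v). graph_dist u v) ` (pverts G \<times> pverts G)"
    by auto
  then have "finite {graph_dist u v | u v. u \<in> pverts G \<and> v \<in> pverts G}"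
    using pair_finite_verts by simp
  then show ?thesis unfolding diameter_def using uv by (intro Max_ge) auto
qed

lemma card_ge_2: "2 \<le> card (pverts G)"
proof -
  obtain u v where "u \<in> pverts G" "v \<in> pverts G" "u \<noteq> v" using dist_eq_1 by blast
  then have "card {u, v} \<le> card (pverts G)" by (intro card_mono pair_finite_verts) auto
  then show ?thesis using \<open>u \<noteq> v\<close> by simp
qed

lemma diameter_ge_1: "1 \<le> diameter"
  using dist_eq_1 graph_dist_le_diameter by metis

lemma graph_dist_self: "u \<in> pverts G \<Longrightarrow> 0 \<le> graph_dist u u"
proof -
  interpret W: wgraph "pverts G" "parcs G" w by (rule wgraph)
  assume "u \<in> pverts G"
  then show ?thesis using W.reach_nonneg graph_dist_reach by blast
qed

text \<open>For \<open>k\<close> beyond \<open>log 2 n\<close> the scheme for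
  \<open>k' = log 2 n\<close> is used. Then \<open>n powr (1 / k')\<close> is \<open>2\<close>, so
  the stretch grows by at most the factor \<open>4\<close>, while the size bounds are monotone in
  \<open>k\<close>. Together with the constant \<open>48\<close> this gives
  \<open>192\<close>.\<close>

lemma compact_routing:
  fixes k :: real
  assumes k: "1 \<le> k"
  shows "let n = real (card (pverts G)) in \<exists>S. is_routing_scheme G 54 S \<and>
     (\<forall>v\<in>pverts G. real (length (label S v)) \<le> 192 * max 1 (k * log n diameter)) \<and>
     (\<forall>u\<in>pverts G. real (length (table S u)) \<le> 192 * max 1 (k\<^sup>2 * log n diameter)) \<and>
     (\<forall>u\<in>pverts G. \<forall>v\<in>pverts G. \<exists>p. routing_path G decide S u v p \<and>
        sum_list (map w p) \<le> 192 * (k * n powr (2 / k) * log 2 n * graph_dist u v))"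
proof -
  interpret W: wgraph "pverts G" "parcs G" w by (rule wgraph)
  let ?n = "real (card (pverts G))"
  have n: "2 \<le> ?n" using card_ge_2 by simp
  have log2n: "1 \<le> log 2 ?n" using n by (simp add: le_log_iff)
  define k' where "k' = min k (log 2 ?n)"
  have k': "1 \<le> k'" "k' \<le> log 2 ?n" "k' \<le> k" using k log2n by (auto simp: k'_def)
  have powr: "?n powr (2 / k') \<le> 4 * ?n powr (2 / k)"
  proof (cases "k \<le> log 2 ?n")
    case True
    then show ?thesis by (simp add: k'_def)
  next
    case False
    then have "k' = log 2 ?n" by (simp add: k'_def)
    then have "?n powr (2 / k') = (?n powr (1 / log 2 ?n)) powr 2" by (simp add: powr_powr)
    also have "?n powr (1 / log 2 ?n) = 2"
      using card_ge_2 by (auto simp: powr_def log_def)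
    also have "(2 :: real) powr 2 = 4 * 1" by simp
    also have "\<dots> \<le> 4 * ?n powr (2 / k)" using n k by (intro mult_left_mono ge_one_powr_ge_zero) auto
    finally show ?thesis .
  qed
  have log\<Delta>: "0 \<le> log ?n diameter" using n diameter_ge_1 by simp
  obtain lab tab port' nh \<Psi> where *:
    "\<forall>u\<in>pverts G. bij_betw (port' u) (parcs G `` {u}) {..<card (parcs G `` {u})} \<and>
       (\<forall>x\<in>set (lab u) \<union> set (tab u). x < card (pverts G) ^ 54) \<and>
       real (length (lab u)) \<le> 36 * max 1 (k' * log ?n diameter) \<and>
       real (length (tab u)) \<le> 36 * max 1 (k'\<^sup>2 * log ?n diameter)"
    "\<forall>u\<in>pverts G. \<forall>v\<in>pverts G. 0 \<le> \<Psi> u v \<and> (u \<noteq> v \<longrightarrow>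
       (u, nh u v) \<in> parcs G \<and> w (u, nh u v) + \<Psi> (nh u v) v \<le> \<Psi> u v \<and>
       decide (tab u) (lab v) = port' u (nh u v) \<and>
       \<Psi> u v \<le> 48 * ?n powr (2 / k') * log 2 ?n * graph_dist u v)"
    using W.scheme_exists[OF card_ge_2 k'(1,2) diameter_ge_1, of graph_dist]
      graph_dist_reach graph_dist_le_diameter dist_ge_1 by blast
  define S where "S = \<lparr>label = lab, table = tab, port = port'\<rparr>"
  have nb: "neighbors G u = parcs G `` {u}" for u by (auto simp: neighbors_def)
  have "is_routing_scheme G 54 S" using *(1) by (simp add: is_routing_scheme_def nb S_def)
  moreover have "\<forall>v\<in>pverts G. real (length (label S v)) \<le> 192 * max 1 (k * log ?n diameter)"
  proof
    fix v assume "v \<in> pverts G"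
    then have "real (length (lab v)) \<le> 36 * max 1 (k' * log ?n diameter)" using *(1) by blast
    also have "\<dots> \<le> 192 * max 1 (k * log ?n diameter)"
      using mult_right_mono[OF k'(3) log\<Delta>] by simp
    finally show "real (length (label S v)) \<le> 192 * max 1 (k * log ?n diameter)" by (simp add: S_def)
  qed
  moreover have "\<forall>u\<in>pverts G. real (length (table S u)) \<le> 192 * max 1 (k\<^sup>2 * log ?n diameter)"
  proof
    fix v assume "v \<in> pverts G"
    then have "real (length (tab v)) \<le> 36 * max 1 (k'\<^sup>2 * log ?n diameter)" using *(1) by blast
    also have "\<dots> \<le> 192 * max 1 (k\<^sup>2 * log ?n diameter)"
    proof -
      have "k'\<^sup>2 \<le> k\<^sup>2" using k' by (intro power_mono) auto
      then show ?thesis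
        using mult_right_mono[OF _ log\<Delta>, of "k'\<^sup>2" "k\<^sup>2"] by simp
    qed
    finally show "real (length (table S v)) \<le> 192 * max 1 (k\<^sup>2 * log ?n diameter)" by (simp add: S_def)
  qed
  moreover have "\<exists>p. routing_path G decide S u v p \<and>
        sum_list (map w p) \<le> 192 * (k * ?n powr (2 / k) * log 2 ?n * graph_dist u v)"
    if u: "u \<in> pverts G" and v: "v \<in> pverts G" for u v
  proof (cases "u = v")
    case True
    then show ?thesis
      using routing_path.arrived[of G decide S v] graph_dist_self[OF v] k log2n
      by (intro exI[of _ "[]"]) simp
  next
    case False
    have "\<exists>p. routing_path G decide S u v p \<and> sum_list (map w p) \<le> \<Psi> u v"
    proof (rule routing_path_descent[where V = "pverts G" and nh = "\<lambda>u. nh u v"])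
      fix u assume u': "u \<in> pverts G" "u \<noteq> v"
      then have e: "(u, nh u v) \<in> parcs G" using *(2) v by blast
      show "nh u v \<in> neighbors G u \<and> nh u v \<in> pverts G \<and> 1 \<le> w (u, nh u v) \<and>
          w (u, nh u v) + \<Psi> (nh u v) v \<le> \<Psi> u v \<and>
          routing_scheme.port S u (nh u v) = decide (table S u) (label S v)"
        using *(2) v u' e W.w_ge1[OF e] wellformed'[OF e] by (simp add: S_def nb)
    qed (use *(2) u v in auto)
    moreover have "\<Psi> u v \<le> 192 * (k * ?n powr (2 / k) * log 2 ?n * graph_dist u v)"
    proof -
      have d: "1 \<le> graph_dist u v" using dist_ge_1 u v False by blast
      have "\<Psi> u v \<le> 48 * ?n powr (2 / k') * (log 2 ?n * graph_dist u v)"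
        using *(2) u v False by (simp add: mult.assoc)
      also have "\<dots> \<le> 48 * (4 * (k * ?n powr (2 / k))) * (log 2 ?n * graph_dist u v)"
      proof (intro mult_right_mono mult_left_mono)
        have "1 * ?n powr (2 / k) \<le> k * ?n powr (2 / k)" using k by (intro mult_right_mono) auto
        then show "?n powr (2 / k') \<le> 4 * (k * ?n powr (2 / k))" using powr by simp
      qed (use d log2n in auto)
      finally show ?thesis by (simp add: mult_ac)
    qed
    ultimately show ?thesis by force
  qed
  ultimately show ?thesis unfolding Let_def by blast
qed

end

text \<open>\<open>log n \<Delta>\<close> vanishes for a complete graph with unit weights, where
  destinations still have to be told apart; hence the maximum with \<open>1\<close>.\<close>

theorem theorem5:
  shows "\<exists>(C :: real) (c :: nat) (F :: nat list \<Rightarrow> nat list \<Rightarrow> nat).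
    \<forall>(G :: 'a pair_pre_digraph) (w :: 'a \<times> 'a \<Rightarrow> real) (k :: real).
      normalized_weighted_graph G w \<longrightarrow> 1 \<le> k \<longrightarrow>
      (let n = real (card (pverts G));
           \<Delta> = connected_weighted_graph.diameter G w;
           d = connected_weighted_graph.graph_dist G w
       in \<exists>S. is_routing_scheme G c S \<and>
            (\<forall>v\<in>pverts G. real (length (label S v)) \<le> C * max 1 (k * log n \<Delta>)) \<and>
            (\<forall>u\<in>pverts G. real (length (table S u)) \<le> C * max 1 (k\<^sup>2 * log n \<Delta>)) \<and>
            (\<forall>u\<in>pverts G. \<forall>v\<in>pverts G. \<exists>p. routing_path G F S u v p \<and>
               sum_list (map w p) \<le> C * (k * n powr (2 / k) * log 2 n * d u v)))"
proof (rule exI[of _ "192 :: real"], rule exI[of _ "54 :: nat"], rule exI[of _ decide], intro allI impI)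
  fix G :: "'a pair_pre_digraph" and w :: "'a \<times> 'a \<Rightarrow> real" and k :: real
  assume G: "normalized_weighted_graph G w" and k: "1 \<le> k"
  interpret normalized_weighted_graph G w by (rule G)
  show "let n = real (card (pverts G)); \<Delta> = diameter; d = graph_dist
       in \<exists>S. is_routing_scheme G 54 S \<and>
            (\<forall>v\<in>pverts G. real (length (label S v)) \<le> 192 * max 1 (k * log n \<Delta>)) \<and>
            (\<forall>u\<in>pverts G. real (length (table S u)) \<le> 192 * max 1 (k\<^sup>2 * log n \<Delta>)) \<and>
            (\<forall>u\<in>pverts G. \<forall>v\<in>pverts G. \<exists>p. routing_path G decide S u v p \<and>
               sum_list (map w p) \<le> 192 * (k * n powr (2 / k) * log 2 n * d u v))"
    using compact_routing[OF k] by (simp add: Let_def)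
qed

end
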